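(* Consider the closed-loop system described in the context. Let $\delta>0$ and let $N\in\mathbb{N}$ satisfy $a-(n\pi)^2<-\delta$ for all $n>N$. Suppose that $K=[k_0\ k_1\ \ldots\ k_N]\in\mathbb{R}^{1\times(N+1)}$ and $L=[\ell_0\ \ell_1\ \ldots\ \ell_N]^\top\in\mathbb{R}^{N+1}$ are such that there exist matrices $P_2,P_3\in\mathbb{R}^{(N+1)\times(N+1)}$ and positive-definite matrices $P_1,S,R,Q\in\mathbb{R}^{(N+1)\times(N+1)}$ with $\Phi<0$ and $$Q(A+LC)+(A+LC)^\top Q<-2\delta Q .$$ Then for any initial value $\big(w(\cdot,0),p(0),\hat\epsilon(\cdot,0),\xi(0),\hat\chi_1(0),\hat\varphi(0),\hat\theta(0)\big)\in L^2(0,1)\times\mathbb{R}^2\times L^2(0,1)\times\mathbb{R}^4$, the tracking error satisfies $\lim_{t\to\infty}|y_e(t)|=0$ exponentially.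
   Context: Data: $a\in\mathbb{R}$, delay $\tau>0$, $d_1\in L^\infty(0,1;\mathbb{R}^{1\times 2})$, $d_2,d_3,d_4\in\mathbb{R}^{1\times 2}$, $G\in\mathbb{R}^{2\times2}$ whose spectrum is $\{i\omega,-i\omega\}$ for some (unknown) $\omega>0$. The plant and exosystem are $w_t(x,t)=w_{xx}(x,t)+aw(x,t)+d_1(x)p(t)$, $x\in(0,1)$; $w_x(0,t)=d_2p(t)$; $w_x(1,t)=U(t-\tau)+d_3p(t)$, with $U(s)=0$ for $s<0$; $\dot p(t)=Gp(t)$; tracking error $y_e(t)=w(0,t)-d_4p(t)$ (output $w(0,t)$, reference $d_4p(t)$). Let $\lambda_n=(n\pi)^2$, $\phi_0\equiv1$, $\phi_n(x)=\sqrt2\cos(n\pi x)$ for $n\ge1$ (an orthonormal basis of $L^2(0,1)$); $\langle\cdot,\cdot\rangle$ is the $L^2(0,1)$ inner product. Set $A=\mathrm{diag}(a-\lambda_0,\ldots,a-\lambda_N)$, $B=[1\ \ -\sqrt2\ \ \sqrt2\ \ldots\ (-1)^N\sqrt2]^\top$ (entries $\phi_n(1)$), $C=[1\ \sqrt2\ \ldots\ \sqrt2]\in\mathbb{R}^{1\times(N+1)}$ (entries $\phi_n(0)$). $\Phi$ is the symmetric $3\times3$ block matrix with blocks $\Phi_{11}=A^\top P_2+P_2^\top A+2\delta P_1+S-e^{-2\delta\tau}R$, $\Phi_{12}=P_1-P_2^\top+A^\top P_3$, $\Phi_{13}=e^{-2\delta\tau}R+P_2^\top BK$, $\Phi_{22}=-P_3-P_3^\top+\tau^2R$,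 $\Phi_{23}=P_3^\top BK$, $\Phi_{33}=-e^{-2\delta\tau}(S+R)$. Let $\mathcal L(x)=\sum_{n=0}^N\ell_n\phi_n(x)$, $\gamma_c=[1,0]$, and for $\vartheta\in\mathbb{R}$ let $S_c(\vartheta)=\begin{bmatrix}0&1\\-\vartheta&0\end{bmatrix}$ and let $f(\cdot,\vartheta):[0,1]\to\mathbb{R}^{1\times2}$ be the solution of $f''(x)=f(x)S_c(\vartheta)-af(x)-\mathcal L(x)f(0)$, $f'(0)=0$, $f(0)=\gamma_c$ (with $f'$ the $x$-derivative). The controller consists of: the state observer $\hat\epsilon_t=\hat\epsilon_{xx}+a\hat\epsilon+\mathcal L(x)(\hat\epsilon(0,t)-y_e(t))$, $\hat\epsilon_x(0,t)=0$, $\hat\epsilon_x(1,t)=U(t-\tau)$; the signal $y_d(t)=y_e(t)-\hat\epsilon(0,t)$; the adaptive observer $\dot\xi=-\iota\xi-y_d$, $\dot{\hat\chi}_1=\hat\varphi+\iota y_d+\hat\theta\xi+\mu_0(y_d-\hat\chi_1)$, $\dot{\hat\varphi}=-\iota\hat\varphi-\iota^2y_d$, $\dot{\hat\theta}=\mu_1\xi(y_d-\hat\chi_1)$, $\hat d(t)=(\hat d_1,\hat d_2)^\top$ with $\hat d_1=\hat\chi_1$, $\hat d_2=\hat\varphi+\xi\hat\theta+\iota\hat\chi_1$, where $\iota>0$, $\mu_0>\frac{1}{4\iota}$, $\mu_1>0$; and the control $$U(t)=\sum_{n=0}^Nk_n\langle\hat\epsilon(\cdot,t),\phi_n\rangle+\sum_{n=0}^Nk_n\langle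 f(\cdot,\hat\theta(t)),\phi_n\rangle\hat d(t)-f'(1,\hat\theta(t))e^{S_c(\hat\theta(t))\tau}\hat d(t).$$ *)

theory Defs
  imports "HOL-Analysis.Analysis"
begin

text \<open>Eigenfunctions of the Neumann Laplacian on (0,1): phi 0 = 1, phi n = sqrt 2 cos (n pi x).\<close>
definition phi :: "nat \<Rightarrow> real \<Rightarrow> real" where
  "phi n x = (if n = 0 then 1 else sqrt 2 * cos (real n * pi * x))"

definition ip01 :: "(real \<Rightarrow> real) \<Rightarrow> (real \<Rightarrow> real) \<Rightarrow> real" where
  "ip01 g h = integral {0..1} (\<lambda>x. g x * h x)"

definition ipv01 :: "(real \<Rightarrow> real^2) \<Rightarrow> (real \<Rightarrow> real) \<Rightarrow> real^2" where
  "ipv01 g h = integral {0..1} (\<lambda>x. h x *\<^sub>R g x)"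

definition L2_01 :: "(real \<Rightarrow> real) \<Rightarrow> bool" where
  "L2_01 g \<longleftrightarrow> g measurable_on {0..1} \<and> (\<lambda>x. (g x)\<^sup>2) integrable_on {0..1}"

text \<open>Membership in L-infinity(0,1;R^{1x2}) (a bounded measurable representative).\<close>
definition Linf_01 :: "(real \<Rightarrow> real^2) \<Rightarrow> bool" where
  "Linf_01 g \<longleftrightarrow> g measurable_on {0..1} \<and> (\<exists>B. \<forall>x\<in>{0..1}. norm (g x) \<le> B)"

definition cspectrum :: "real^2^2 \<Rightarrow> complex set" where
  "cspectrum G = {lam. \<exists>v::complex^2. v \<noteq> 0 \<and>
      (\<chi> i j. complex_of_real (G $ i $ j)) *v v = lam *s v}"

primrec mpow :: "real^2^2 \<Rightarrow> nat \<Rightarrow> real^2^2" where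
  "mpow M 0 = mat 1"
| "mpow M (Suc k) = M ** mpow M k"

definition mexp :: "real^2^2 \<Rightarrow> real^2^2" where
  "mexp M = (\<Sum>k. (1 / fact k) *\<^sub>R mpow M k)"

definition Sc :: "real \<Rightarrow> real^2^2" where
  "Sc th = vector [vector [0, 1], vector [- th, 0]]"

definition gamma_c :: "real^2" where
  "gamma_c = vector [1, 0]"

text \<open>Finite-dimensional matrices of size m x m as functions nat => nat => real
  (only indices < m matter).\<close>
definition mmul :: "nat \<Rightarrow> (nat \<Rightarrow> nat \<Rightarrow> real) \<Rightarrow> (nat \<Rightarrow> nat \<Rightarrow> real) \<Rightarrow> nat \<Rightarrow> nat \<Rightarrow> real" where
  "mmul m X Y = (\<lambda>i j. \<Sum>k<m. X i k * Y k j)"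

definition mtr :: "(nat \<Rightarrow> nat \<Rightarrow> real) \<Rightarrow> nat \<Rightarrow> nat \<Rightarrow> real" where
  "mtr X = (\<lambda>i j. X j i)"

definition posdef :: "nat \<Rightarrow> (nat \<Rightarrow> nat \<Rightarrow> real) \<Rightarrow> bool" where
  "posdef m X \<longleftrightarrow> (\<forall>i<m. \<forall>j<m. X i j = X j i) \<and>
     (\<forall>x::nat \<Rightarrow> real. (\<exists>i<m. x i \<noteq> 0) \<longrightarrow> (\<Sum>i<m. \<Sum>j<m. x i * X i j * x j) > 0)"

definition negdef :: "nat \<Rightarrow> (nat \<Rightarrow> nat \<Rightarrow> real) \<Rightarrow> bool" where
  "negdef m X \<longleftrightarrow> posdef m (\<lambda>i j. - X i j)"

definition Amat :: "real \<Rightarrow> nat \<Rightarrow> nat \<Rightarrow> real" where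
  "Amat a i j = (if i = j then a - (real i * pi)\<^sup>2 else 0)"

definition Bvec :: "nat \<Rightarrow> real" where "Bvec i = phi i 1"
definition Cvec :: "nat \<Rightarrow> real" where "Cvec i = phi i 0"

definition Phi :: "real \<Rightarrow> nat \<Rightarrow> (nat \<Rightarrow> real) \<Rightarrow> real \<Rightarrow> real \<Rightarrow>
    (nat \<Rightarrow> nat \<Rightarrow> real) \<Rightarrow> (nat \<Rightarrow> nat \<Rightarrow> real) \<Rightarrow> (nat \<Rightarrow> nat \<Rightarrow> real) \<Rightarrow>
    (nat \<Rightarrow> nat \<Rightarrow> real) \<Rightarrow> (nat \<Rightarrow> nat \<Rightarrow> real) \<Rightarrow> nat \<Rightarrow> nat \<Rightarrow> real" where
  "Phi a N k \<delta> \<tau> P1 P2 P3 S R =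
    (let m = N + 1; A = Amat a; BK = (\<lambda>i j. Bvec i * k j); e = exp (-2 * \<delta> * \<tau>);
         F11 = (\<lambda>i j. mmul m (mtr A) P2 i j + mmul m (mtr P2) A i j + 2 * \<delta> * P1 i j + S i j - e * R i j);
         F12 = (\<lambda>i j. P1 i j - mtr P2 i j + mmul m (mtr A) P3 i j);
         F13 = (\<lambda>i j. e * R i j + mmul m (mtr P2) BK i j);
         F22 = (\<lambda>i j. - P3 i j - mtr P3 i j + \<tau>\<^sup>2 * R i j);
         F23 = (\<lambda>i j. mmul m (mtr P3) BK i j);
         F33 = (\<lambda>i j. - e * (S i j + R i j));
         blk = (\<lambda>(r::nat) (c::nat).
           if r = 0 \<and> c = 0 then F11 else if r = 0 \<and> c = 1 then F12 else if r = 0 \<and> c = 2 then F13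
           else if r = 1 \<and> c = 0 then mtr F12 else if r = 1 \<and> c = 1 then F22 else if r = 1 \<and> c = 2 then F23
           else if r = 2 \<and> c = 0 then mtr F13 else if r = 2 \<and> c = 1 then mtr F23 else F33)
     in (\<lambda>i j. blk (i div m) (j div m) (i mod m) (j mod m)))"

end

theory Submission
  imports Defs
begin

text \<open>
  Everything is done on the cosine modes. In the observer error \<open>w - \<epsilon>\<close> (with \<open>\<epsilon>\<close> the observer state) the
  delayed input cancels, so its modes are driven by the exosystem only; since \<open>A + L C\<close> is Hurwitz, a
  Sylvester equation gives \<open>y\<^sub>d = q p + (exponentially decaying)\<close>, that is, \<open>y\<^sub>d\<close> is asymptotically a
  sinusoid \<open>d\<^sub>1\<close> of unknown frequency. The adaptive observer recovers \<open>d = (d\<^sub>1, d\<^sub>1')\<close> exponentially, and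
  the parameter \<open>\<theta> = \<omega>\<^sup>2\<close> too unless \<open>d = 0\<close>, in which case \<open>\<theta>\<close> is irrelevant. The modes of
  \<open>z = \<epsilon> + f(\<cdot>,\<theta>) d\<close> then obey the delayed closed loop with exponentially decaying perturbations; the first
  \<open>N + 1\<close> of them decay by the Lyapunov-Krasovskii functional encoded in \<open>\<Phi> < 0\<close>, the others by
  themselves. As the modes are summable, \<open>y\<^sub>e\<close> agrees with \<open>z(0,\<cdot>)\<close> up to a decaying term.
\<close>

section \<open>Exponential decay and differential inequalities\<close>

definition expdecay :: "(real \<Rightarrow> real) \<Rightarrow> bool" where
  "expdecay f \<longleftrightarrow> (\<exists>\<alpha>>0. f \<in> O(\<lambda>t. exp (- \<alpha> * t)))"

lemma exp_bigo_exp: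
  fixes \<alpha> \<beta> :: real
  assumes "\<beta> \<le> \<alpha>"
  shows "(\<lambda>t. exp (- \<alpha> * t)) \<in> O(\<lambda>t. exp (- \<beta> * t))"
  by (rule bigoI[of _ 1], rule eventually_mono[OF eventually_ge_at_top[of 0]])
     (use assms in \<open>auto intro: mult_right_mono\<close>)

lemma expdecayI:
  assumes "\<alpha> > 0" "\<And>t. t \<ge> T \<Longrightarrow> \<bar>f t\<bar> \<le> M * exp (- \<alpha> * t)"
  shows "expdecay f"
proof -
  have "f \<in> O(\<lambda>t. exp (- \<alpha> * t))"
    by (rule bigoI[of _ M], rule eventually_mono[OF eventually_ge_at_top[of T]]) (use assms in auto)
  then show ?thesis using \<open>\<alpha> > 0\<close> by (auto simp: expdecay_def)
qed

lemma expdecayE: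
  assumes "expdecay f" "\<beta> > 0"
  obtains \<alpha> M T where "0 < \<alpha>" "\<alpha> < \<beta>" "M \<ge> 0" "T \<ge> Tmin"
    "\<And>t. t \<ge> T \<Longrightarrow> \<bar>f t\<bar> \<le> M * exp (- \<alpha> * t)"
proof -
  obtain \<gamma> where \<gamma>: "\<gamma> > 0" "f \<in> O(\<lambda>t. exp (- \<gamma> * t))"
    using assms(1) by (auto simp: expdecay_def)
  define \<alpha> where "\<alpha> = min \<gamma> (\<beta> / 2)"
  have "f \<in> O(\<lambda>t. exp (- \<alpha> * t))"
    by (rule landau_o.big.trans[OF \<gamma>(2) exp_bigo_exp]) (simp add: \<alpha>_def)
  then obtain M where "M > 0" "\<forall>\<^sub>F t in at_top. norm (f t) \<le> M * norm (exp (- \<alpha> * t))"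
    by (rule landau_o.bigE)
  then obtain T where "\<And>t. t \<ge> T \<Longrightarrow> \<bar>f t\<bar> \<le> M * exp (- \<alpha> * t)"
    by (auto simp: eventually_at_top_linorder)
  then show thesis
    by (intro that[of \<alpha> M "max T Tmin"]) (use \<open>M > 0\<close> \<gamma>(1) \<open>\<beta> > 0\<close> in \<open>auto simp: \<alpha>_def\<close>)
qed

lemma bigo_const_1E:
  fixes f :: "real \<Rightarrow> real"
  assumes "f \<in> O(\<lambda>_. 1)"
  obtains B T where "B > 0" "T \<ge> Tmin" "\<And>t. t \<ge> T \<Longrightarrow> \<bar>f t\<bar> \<le> B"
proof -
  obtain B where "B > 0" "\<forall>\<^sub>F t in at_top. \<bar>f t\<bar> \<le> B"
    using landau_o.bigE[OF assms] by auto
  moreover from this obtain T where "\<And>t. t \<ge> T \<Longrightarrow> \<bar>f t\<bar> \<le> B"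
    by (auto simp: eventually_at_top_linorder)
  ultimately show thesis using that[of B "max T Tmin"] by auto
qed

lemma bigo_geI:
  fixes f g :: "real \<Rightarrow> real"
  assumes "\<And>t. t \<ge> T \<Longrightarrow> \<bar>f t\<bar> \<le> C * \<bar>g t\<bar>"
  shows "f \<in> O(g)"
  by (rule bigoI[of _ C], rule eventually_mono[OF eventually_ge_at_top[of T]]) (use assms in auto)

lemma bigo_of_square:
  fixes f g :: "'a \<Rightarrow> real"
  assumes "(\<lambda>t. (f t)\<^sup>2) \<in> O[F](\<lambda>t. (g t)\<^sup>2)"
  shows "f \<in> O[F](g)"
proof -
  obtain c where "c > 0" "\<forall>\<^sub>F t in F. norm ((f t)\<^sup>2) \<le> c * norm ((g t)\<^sup>2)"
    using assms by (rule landau_o.bigE)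
  then have "\<forall>\<^sub>F t in F. \<bar>f t\<bar> \<le> sqrt c * \<bar>g t\<bar>"
    by (auto elim!: eventually_mono dest: real_sqrt_le_mono simp: real_sqrt_mult)
  then show ?thesis by (auto intro: bigoI)
qed

lemma bigo_1_of_square: "(\<lambda>t. (f t)\<^sup>2) \<in> O[F](\<lambda>_. 1) \<Longrightarrow> f \<in> O[F](\<lambda>_. 1)"
  for f :: "'a \<Rightarrow> real"
  using bigo_of_square[of f F "\<lambda>_. 1"] by simp

lemma expdecay_bigo:
  assumes "f \<in> O(g)" "expdecay g"
  shows "expdecay f"
proof -
  obtain \<alpha> where "\<alpha> > 0" "g \<in> O(\<lambda>t. exp (- \<alpha> * t))" using assms(2) by (auto simp: expdecay_def)
  then show ?thesis using landau_o.big.trans[OF assms(1)] by (auto simp: expdecay_def)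
qed

lemma expdecay_cong:
  assumes "expdecay g" "\<And>t. t \<ge> T \<Longrightarrow> f t = g t"
  shows "expdecay f"
  by (rule expdecay_bigo[OF bigo_geI[of T _ 1] assms(1)]) (simp add: assms(2))

lemma expdecay_0 [intro, simp]: "expdecay (\<lambda>t. 0)"
  unfolding expdecay_def by (intro exI[of _ 1]) simp

lemma expdecay_cmult [intro]: "expdecay f \<Longrightarrow> expdecay (\<lambda>t. c * f t)"
  by (rule expdecay_bigo[of _ f]) simp_all

lemma expdecay_abs: "expdecay f \<Longrightarrow> expdecay (\<lambda>t. \<bar>f t\<bar>)"
  by (rule expdecay_bigo[of _ f]) simp_all

lemma expdecay_minus [intro]: "expdecay f \<Longrightarrow> expdecay (\<lambda>t. - f t)"
  using expdecay_cmult[of f "-1"] by simp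

lemma expdecay_add [intro]:
  assumes "expdecay f" "expdecay g"
  shows "expdecay (\<lambda>t. f t + g t)"
proof -
  obtain \<alpha> \<beta> where \<alpha>: "\<alpha> > 0" "f \<in> O(\<lambda>t. exp (- \<alpha> * t))" and \<beta>: "\<beta> > 0" "g \<in> O(\<lambda>t. exp (- \<beta> * t))"
    using assms by (auto simp: expdecay_def)
  have "(\<lambda>t. f t + g t) \<in> O(\<lambda>t. exp (- min \<alpha> \<beta> * t))"
    by (intro sum_in_bigo landau_o.big.trans[OF \<alpha>(2) exp_bigo_exp] landau_o.big.trans[OF \<beta>(2) exp_bigo_exp]) auto
  then show ?thesis using \<alpha>(1) \<beta>(1) by (auto simp: expdecay_def intro!: exI[of _ "min \<alpha> \<beta>"])
qed

lemma expdecay_diff [intro]: "expdecay f \<Longrightarrow> expdecay g \<Longrightarrow> expdecay (\<lambda>t. f t - g t)"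
  using expdecay_add[of f "\<lambda>t. - g t"] by auto

lemma expdecay_sum [intro]:
  "(\<And>i. i \<in> I \<Longrightarrow> expdecay (f i)) \<Longrightarrow> expdecay (\<lambda>t. \<Sum>i\<in>I. f i t)"
  by (induction I rule: infinite_finite_induct) auto

lemma expdecay_mult_bounded:
  assumes "expdecay f" "g \<in> O(\<lambda>_. 1)"
  shows "expdecay (\<lambda>t. f t * g t)"
  by (rule expdecay_bigo[OF landau_o.big_1_mult[OF landau_o.big_refl assms(2)] assms(1)])

lemma expdecay_imp_bigo_1:
  assumes "expdecay f"
  shows "f \<in> O(\<lambda>_. 1)"
proof -
  obtain \<alpha> where "\<alpha> > 0" "f \<in> O(\<lambda>t. exp (- \<alpha> * t))" using assms by (auto simp: expdecay_def)
  then show ?thesis using landau_o.big.trans[OF _ exp_bigo_exp[of 0 \<alpha>]] by simp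
qed

lemma expdecay_of_square:
  assumes "(\<lambda>t. (x t)\<^sup>2) \<in> O(V)" "expdecay V"
  shows "expdecay x"
proof -
  obtain \<alpha> where \<alpha>: "\<alpha> > 0" "(\<lambda>t. (x t)\<^sup>2) \<in> O(\<lambda>t. exp (- \<alpha> * t))"
    using assms by (auto simp: expdecay_def intro: landau_o.big.trans)
  from \<alpha>(2) have "(\<lambda>t. (x t)\<^sup>2) \<in> O(\<lambda>t. (exp (- (\<alpha> / 2) * t))\<^sup>2)"
    by (simp add: exp_double[symmetric])
  then have "x \<in> O(\<lambda>t. exp (- (\<alpha> / 2) * t))" by (rule bigo_of_square)
  then show ?thesis using \<alpha>(1) by (auto simp: expdecay_def intro!: exI[of _ "\<alpha> / 2"])
qed

lemma expdecay_shift: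
  assumes "expdecay f"
  shows "expdecay (\<lambda>t. f (t - \<tau>))"
proof -
  obtain \<alpha> M T where f: "0 < \<alpha>" "\<And>t. t \<ge> T \<Longrightarrow> \<bar>f t\<bar> \<le> M * exp (- \<alpha> * t)"
    by (rule expdecayE[OF assms zero_less_one]) blast
  show ?thesis
  proof (rule expdecayI[OF f(1), of "T + \<tau>" _ "M * exp (\<alpha> * \<tau>)"])
    fix t assume "T + \<tau> \<le> t"
    then have "\<bar>f (t - \<tau>)\<bar> \<le> M * exp (- \<alpha> * (t - \<tau>))" by (intro f(2)) simp
    also have "\<dots> = M * exp (\<alpha> * \<tau>) * exp (- \<alpha> * t)"
      by (simp add: exp_add[symmetric] algebra_simps)
    finally show "\<bar>f (t - \<tau>)\<bar> \<le> M * exp (\<alpha> * \<tau>) * exp (- \<alpha> * t)" .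
  qed
qed

lemma expdecay_imp_tendsto_0:
  assumes "expdecay f"
  shows "(f \<longlongrightarrow> 0) at_top"
proof -
  obtain \<alpha> where \<alpha>: "\<alpha> > 0" "f \<in> O(\<lambda>t. exp (- \<alpha> * t))" using assms by (auto simp: expdecay_def)
  have "(\<lambda>t. exp (- \<alpha> * t)) \<in> o(\<lambda>_. 1 :: real)" using \<alpha>(1) by real_asymp
  with \<alpha>(2) have "f \<in> o(\<lambda>_. 1)" by (rule landau_o.big_small_trans)
  then show ?thesis using smalloD_tendsto by fastforce
qed

lemma gronwall:
  fixes U K :: "real \<Rightarrow> real"
  assumes "a \<le> b" "continuous_on {a..b} U" "continuous_on {a..b} K"
    and U: "\<And>t. a < t \<Longrightarrow> t < b \<Longrightarrow> (U has_real_derivative U' t) (at t)"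
    and K: "\<And>t. a < t \<Longrightarrow> t < b \<Longrightarrow> (K has_real_derivative k t) (at t)"
    and ineq: "\<And>t. a < t \<Longrightarrow> t < b \<Longrightarrow> U' t \<le> k t * U t"
  shows "U b \<le> exp (K b - K a) * U a"
proof -
  define W where "W t = exp (- K t) * U t" for t
  have "W b \<le> W a"
  proof (rule DERIV_nonpos_imp_decreasing_open[OF \<open>a \<le> b\<close>])
    show "continuous_on {a..b} W" unfolding W_def by (intro continuous_intros assms)
    fix t assume t: "a < t" "t < b"
    have "(W has_real_derivative exp (- K t) * (U' t - k t * U t)) (at t)"
      unfolding W_def using U[OF t] K[OF t] by (auto intro!: derivative_eq_intros simp: algebra_simps)
    moreover have "exp (- K t) * (U' t - k t * U t) \<le> 0"
      using ineq[OF t] by (simp add: mult_nonneg_nonpos)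
    ultimately show "\<exists>y. (W has_real_derivative y) (at t) \<and> y \<le> 0" by blast
  qed
  then have "exp (K b) * W b \<le> exp (K b) * W a" by simp
  then show ?thesis by (simp add: W_def mult.assoc[symmetric] exp_add[symmetric])
qed

lemma gronwall_at_top:
  fixes U K :: "real \<Rightarrow> real"
  assumes U: "\<And>t. t \<ge> T \<Longrightarrow> (U has_real_derivative U' t) (at t)"
    and K: "\<And>t. t \<ge> T \<Longrightarrow> (K has_real_derivative k t) (at t)"
    and ineq: "\<And>t. t \<ge> T \<Longrightarrow> U' t \<le> k t * U t" and "t \<ge> T"
  shows "U t \<le> exp (K t - K T) * U T"
proof (rule gronwall[where U'=U' and k=k, OF \<open>t \<ge> T\<close>])
  show "continuous_on {T..t} U" by (rule DERIV_continuous_on[OF has_field_derivative_at_within[OF U]]) simp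
  show "continuous_on {T..t} K" by (rule DERIV_continuous_on[OF has_field_derivative_at_within[OF K]]) simp
qed (use U K ineq in auto)

lemma exp_forced_diff_ineq_bound:
  fixes V :: "real \<Rightarrow> real"
  assumes V: "\<And>t. t \<ge> T \<Longrightarrow> (V has_real_derivative V' t) (at t)"
    and ineq: "\<And>t. t \<ge> T \<Longrightarrow> V' t \<le> - \<kappa> * V t + M * exp (- \<alpha> * t)"
    and "\<alpha> < \<kappa>" "M \<ge> 0" "t \<ge> T"
  shows "V t \<le> exp (- \<kappa> * (t - T)) * V T + M / (\<kappa> - \<alpha>) * exp (- \<alpha> * t)"
proof -
  define C where "C = M / (\<kappa> - \<alpha>)"
  have C: "C \<ge> 0" "M = C * (\<kappa> - \<alpha>)" using assms by (auto simp: C_def)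
  \<comment> \<open>\<open>C exp (-\<alpha> t)\<close> solves the equation with equality.\<close>
  have "V t - C * exp (- \<alpha> * t) \<le> exp (- \<kappa> * t - - \<kappa> * T) * (V T - C * exp (- \<alpha> * T))"
  proof (rule gronwall_at_top[OF _ _ _ \<open>t \<ge> T\<close>])
    fix s assume s: "s \<ge> T"
    show "((\<lambda>t. V t - C * exp (- \<alpha> * t)) has_real_derivative V' s + C * \<alpha> * exp (- \<alpha> * s)) (at s)"
      using V[OF s] by (auto intro!: derivative_eq_intros)
    show "((*) (- \<kappa>) has_real_derivative - \<kappa>) (at s)" by (auto intro!: derivative_eq_intros)
    show "V' s + C * \<alpha> * exp (- \<alpha> * s) \<le> - \<kappa> * (V s - C * exp (- \<alpha> * s))"
      using ineq[OF s] unfolding C(2) by (simp add: algebra_simps)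
  qed
  also have "\<dots> \<le> exp (- \<kappa> * (t - T)) * V T"
    using C(1) by (simp add: right_diff_distrib)
  finally show ?thesis by (simp add: C_def)
qed

lemma abs_exp_forced_ode_bound:
  fixes x g :: "real \<Rightarrow> real"
  assumes x: "\<And>t. t \<ge> T \<Longrightarrow> (x has_real_derivative - \<kappa> * x t + g t) (at t)"
    and g: "\<And>t. t \<ge> T \<Longrightarrow> \<bar>g t\<bar> \<le> M * exp (- \<alpha> * t)"
    and "\<alpha> < \<kappa>" "M \<ge> 0" "t \<ge> T"
  shows "\<bar>x t\<bar> \<le> exp (- \<kappa> * (t - T)) * \<bar>x T\<bar> + M / (\<kappa> - \<alpha>) * exp (- \<alpha> * t)"
proof -
  have "\<sigma> * x t \<le> exp (- \<kappa> * (t - T)) * \<bar>x T\<bar> + M / (\<kappa> - \<alpha>) * exp (- \<alpha> * t)" if "\<bar>\<sigma>\<bar> = 1" for \<sigma>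
  proof -
    have \<sigma>: "\<sigma> * y \<le> \<bar>y\<bar>" for y using that by (metis abs_ge_self abs_mult mult_1)
    have "\<sigma> * x t \<le> exp (- \<kappa> * (t - T)) * (\<sigma> * x T) + M / (\<kappa> - \<alpha>) * exp (- \<alpha> * t)"
    proof (rule exp_forced_diff_ineq_bound[where V="\<lambda>t. \<sigma> * x t", OF _ _ assms(3-5)])
      fix s assume s: "s \<ge> T"
      show "((\<lambda>t. \<sigma> * x t) has_real_derivative \<sigma> * (- \<kappa> * x s + g s)) (at s)"
        by (rule DERIV_cmult[OF x[OF s]])
      show "\<sigma> * (- \<kappa> * x s + g s) \<le> - \<kappa> * (\<sigma> * x s) + M * exp (- \<alpha> * s)"
        using \<sigma>[of "g s"] g[OF s] by (simp add: algebra_simps)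
    qed
    also have "\<dots> \<le> exp (- \<kappa> * (t - T)) * \<bar>x T\<bar> + M / (\<kappa> - \<alpha>) * exp (- \<alpha> * t)"
      by (intro add_right_mono mult_left_mono \<sigma>) simp
    finally show ?thesis .
  qed
  from this[of 1] this[of "-1"] show ?thesis by (simp add: abs_le_iff)
qed

lemma exp_decay_bounds_imp_expdecay:
  assumes "0 < \<alpha>" "\<alpha> < \<kappa>" "\<And>t. t \<ge> T \<Longrightarrow> \<bar>x t\<bar> \<le> exp (- \<kappa> * (t - T)) * A + C * exp (- \<alpha> * t)"
  shows "expdecay x"
proof (rule expdecay_bigo[OF bigo_geI])
  show "expdecay (\<lambda>t. exp (\<kappa> * T) * A * exp (- \<kappa> * t) + C * exp (- \<alpha> * t))"
    using assms(1,2) by (intro expdecay_add expdecay_cmult expdecayI[of \<kappa> 0 _ 1] expdecayI[of \<alpha> 0 _ 1]) auto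
  fix t assume "t \<ge> T"
  have "exp (- \<kappa> * (t - T)) * A = exp (\<kappa> * T) * A * exp (- \<kappa> * t)"
    by (simp add: exp_add[symmetric] algebra_simps)
  then show "\<bar>x t\<bar> \<le> 1 * \<bar>exp (\<kappa> * T) * A * exp (- \<kappa> * t) + C * exp (- \<alpha> * t)\<bar>"
    unfolding mult_1 using assms(3)[OF \<open>t \<ge> T\<close>] by linarith
qed

lemma lyapunov_expdecay:
  fixes V g :: "real \<Rightarrow> real"
  assumes V: "\<And>t. t \<ge> T \<Longrightarrow> (V has_real_derivative V' t) (at t)"
    and ineq: "\<And>t. t \<ge> T \<Longrightarrow> V' t \<le> - \<kappa> * V t + g t"
    and nonneg: "\<And>t. t \<ge> T \<Longrightarrow> V t \<ge> 0" and "\<kappa> > 0" and g: "expdecay g"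
  shows "expdecay V"
proof -
  obtain \<alpha> M S where S: "0 < \<alpha>" "\<alpha> < \<kappa>" "M \<ge> 0" "S \<ge> T" "\<And>t. t \<ge> S \<Longrightarrow> \<bar>g t\<bar> \<le> M * exp (- \<alpha> * t)"
    by (rule expdecayE[OF g \<open>\<kappa> > 0\<close>, where Tmin=T]) blast
  show ?thesis
  proof (rule exp_decay_bounds_imp_expdecay[OF S(1,2)])
    fix t assume t: "t \<ge> S"
    have "V t \<le> exp (- \<kappa> * (t - S)) * V S + M / (\<kappa> - \<alpha>) * exp (- \<alpha> * t)"
    proof (rule exp_forced_diff_ineq_bound[OF V _ S(2,3) t])
      fix s assume "s \<ge> S"
      then show "V' s \<le> - \<kappa> * V s + M * exp (- \<alpha> * s)"
        using ineq[of s] S(5)[of s] S(4) by linarith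
    qed (use S(4) in auto)
    then show "\<bar>V t\<bar> \<le> exp (- \<kappa> * (t - S)) * V S + M / (\<kappa> - \<alpha>) * exp (- \<alpha> * t)"
      using nonneg[of t] t S(4) by simp
  qed
qed

lemma linear_ode_expdecay:
  fixes x g :: "real \<Rightarrow> real"
  assumes x: "\<And>t. t \<ge> T \<Longrightarrow> (x has_real_derivative - \<kappa> * x t + g t) (at t)"
    and "\<kappa> > 0" "expdecay g"
  shows "expdecay x"
proof -
  obtain \<alpha> M S where S: "0 < \<alpha>" "\<alpha> < \<kappa>" "M \<ge> 0" "S \<ge> T" "\<And>t. t \<ge> S \<Longrightarrow> \<bar>g t\<bar> \<le> M * exp (- \<alpha> * t)"
    by (rule expdecayE[OF \<open>expdecay g\<close> \<open>\<kappa> > 0\<close>, where Tmin=T]) blast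
  show ?thesis
    by (rule exp_decay_bounds_imp_expdecay[OF S(1,2)], rule abs_exp_forced_ode_bound[OF x S(5) S(2,3)])
       (use S(4) in auto)
qed

lemma gronwall_bounded:
  fixes V g :: "real \<Rightarrow> real"
  assumes V: "\<And>t. t \<ge> T \<Longrightarrow> (V has_real_derivative V' t) (at t)"
    and ineq: "\<And>t. t \<ge> T \<Longrightarrow> V' t \<le> g t * (1 + V t)"
    and nonneg: "\<And>t. t \<ge> T \<Longrightarrow> V t \<ge> 0" and g: "expdecay g"
  shows "V \<in> O(\<lambda>_. 1)"
proof -
  obtain \<alpha> M S where S: "0 < \<alpha>" "M \<ge> 0" "S \<ge> T" "\<And>t. t \<ge> S \<Longrightarrow> \<bar>g t\<bar> \<le> M * exp (- \<alpha> * t)"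
    by (rule expdecayE[OF g zero_less_one, where Tmin=T]) blast
  define K where "K t = - (M / \<alpha>) * exp (- \<alpha> * t)" for t
  have bound: "1 + V t \<le> exp (K t - K S) * (1 + V S)" if "t \<ge> S" for t
  proof (rule gronwall_at_top[OF _ _ _ that])
    fix s assume s: "s \<ge> S"
    show "((\<lambda>t. 1 + V t) has_real_derivative V' s) (at s)"
      using V[of s] s S(3) by (auto intro!: derivative_eq_intros)
    show "(K has_real_derivative M * exp (- \<alpha> * s)) (at s)"
      unfolding K_def using S(1) by (auto intro!: derivative_eq_intros)
    have "g s * (1 + V s) \<le> M * exp (- \<alpha> * s) * (1 + V s)"
      using S(4)[OF s] nonneg[of s] s S(3) by (intro mult_right_mono) auto
    then show "V' s \<le> M * exp (- \<alpha> * s) * (1 + V s)" using ineq[of s] s S(3) by linarith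
  qed
  show ?thesis
  proof (rule bigo_geI[of S])
    fix t assume t: "t \<ge> S"
    have "K t \<le> 0" using S(1,2) by (simp add: K_def)
    then have "exp (K t - K S) * (1 + V S) \<le> exp (- K S) * (1 + V S)"
      using nonneg[OF S(3)] by (intro mult_right_mono) auto
    then show "\<bar>V t\<bar> \<le> exp (- K S) * (1 + V S) * \<bar>1\<bar>"
      using bound[OF t] nonneg[of t] t S(3) by simp
  qed
qed

lemma DERIV_integral_upper:
  fixes g :: "real \<Rightarrow> real"
  assumes "continuous_on {T..} g" "T < t"
  shows "((\<lambda>s. integral {T..s} g) has_real_derivative g t) (at t)"
proof -
  have "((\<lambda>s. integral {T..s} g) has_real_derivative g t) (at t within {T..t+1})"
    by (rule integral_has_real_derivative) (use assms in \<open>auto intro: continuous_on_subset\<close>)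
  then show ?thesis using \<open>T < t\<close> by (simp add: at_within_Icc_at)
qed

lemma has_integral_imp_DERIV:
  fixes x g :: "real \<Rightarrow> real"
  assumes int: "\<And>t. t \<ge> 0 \<Longrightarrow> (g has_integral x t - x 0) {0..t}"
    and cont: "continuous_on {T..} g" and "0 \<le> T" "T < t"
  shows "(x has_real_derivative g t) (at t)"
proof -
  have x_eq: "x T + integral {T..s} g = x s" if "s \<ge> T" for s
  proof -
    have "integral {0..T} g + integral {T..s} g = integral {0..s} g"
      by (rule Henstock_Kurzweil_Integration.integral_combine)
         (use int[of s] that \<open>0 \<le> T\<close> in \<open>auto simp: integrable_on_def\<close>)
    then show ?thesis
      using int[of T] int[of s] that \<open>0 \<le> T\<close> by (simp add: integral_unique)
  qed
  have "((\<lambda>s. x T + integral {T..s} g) has_real_derivative g t) (at t)"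
    by (auto intro!: derivative_eq_intros DERIV_integral_upper cont \<open>T < t\<close>)
  then show ?thesis
    by (rule has_field_derivative_transform_within_open[where S="{T<..}"]) (use x_eq \<open>T < t\<close> in auto)
qed

lemma has_integral_imp_continuous_on:
  fixes x g :: "real \<Rightarrow> real"
  assumes int: "\<And>t. t \<ge> 0 \<Longrightarrow> (g has_integral x t - x 0) {0..t}"
  shows "continuous_on {0..} x"
  unfolding continuous_on_eq_continuous_within
proof
  fix t :: real assume t: "t \<in> {0..}"
  have "g integrable_on {0..t+1}" using int[of "t+1"] t by (auto simp: integrable_on_def)
  then have "continuous_on {0..t+1} (\<lambda>s. x 0 + integral {0..s} g)"
    by (intro continuous_intros indefinite_integral_continuous_1)
  then have "continuous_on {0..t+1} x"
    by (rule continuous_on_eq) (simp add: integral_unique[OF int])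
  then have "continuous (at t within {0..t+1}) x"
    using t by (auto simp: continuous_on_eq_continuous_within)
  moreover have "at t within {0..} = at t within {0..t+1}"
    by (rule at_within_nhd[of _ "{..<t+1}"]) auto
  ultimately show "continuous (at t within {0..}) x" by simp
qed

section \<open>Cosine expansions\<close>

lemma phi_alt: "phi n x = (if n = 0 then 1 else sqrt 2) * cos (real n * pi * x)"
  by (simp add: phi_def)

lemma abs_phi_le: "\<bar>phi n x\<bar> \<le> sqrt 2"
  using abs_cos_le_one[of "real n * pi * x"] by (simp add: phi_def abs_mult)

lemma continuous_on_phi [continuous_intros]: "continuous_on A (phi n)"
  unfolding phi_def by (cases "n = 0") (auto intro!: continuous_intros)

lemma has_integral_cos_int_pi:
  fixes k :: int
  shows "((\<lambda>x. cos (of_int k * pi * x)) has_integral (if k = 0 then 1 else 0)) {0..1}"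
proof (cases "k = 0")
  case True
  then show ?thesis using has_integral_const_real[of "1::real" 0 1] by simp
next
  case False
  have "((\<lambda>x. cos (of_int k * pi * x)) has_integral
      (sin (of_int k * pi * 1) / (of_int k * pi) - sin (of_int k * pi * 0) / (of_int k * pi))) {0..1}"
    by (rule fundamental_theorem_of_calculus)
       (use False in \<open>auto intro!: derivative_eq_intros simp flip: has_real_derivative_iff_has_vector_derivative\<close>)
  then show ?thesis using False by (simp add: sin_integer_2pi mult.commute[of _ pi] sin_zero_iff_int2)
qed

lemma ip01_phi: "ip01 (phi m) (phi n) = (if m = n then 1 else 0)"
proof -
  define c where "c n = (if n = 0 then 1 else sqrt 2)" for n :: nat
  let ?d = "int m - int n" and ?s = "int m + int n"
  have "phi m x * phi n x = c m * c n / 2 * (cos (of_int ?d * pi * x) + cos (of_int ?s * pi * x))" for x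
    by (simp add: phi_alt c_def[symmetric] cos_times_cos algebra_simps)
  then have "((\<lambda>x. phi m x * phi n x) has_integral
      (c m * c n / 2 * ((if ?d = 0 then 1 else 0) + (if ?s = 0 then 1 else 0)))) {0..1}"
    by (simp only:) (intro has_integral_mult_right has_integral_add has_integral_cos_int_pi)
  then have "ip01 (phi m) (phi n) = c m * c n / 2 * ((if ?d = 0 then 1 else 0) + (if ?s = 0 then 1 else 0))"
    unfolding ip01_def by (rule integral_unique)
  also have "\<dots> = (if m = n then 1 else 0)"
    by (auto simp: c_def)
  finally show ?thesis .
qed

lemma ip01_commute: "ip01 g h = ip01 h g"
  by (simp add: ip01_def mult.commute)

lemma ip01_integrable:
  "continuous_on {0..1} g \<Longrightarrow> continuous_on {0..1} h \<Longrightarrow> (\<lambda>x. g x * h x) integrable_on {0..1::real}"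
  for g h :: "real \<Rightarrow> real"
  by (intro integrable_continuous_real continuous_intros)

lemma ip01_add_left:
  "continuous_on {0..1} g \<Longrightarrow> continuous_on {0..1} h \<Longrightarrow> continuous_on {0..1} u \<Longrightarrow>
   ip01 (\<lambda>x. g x + h x) u = ip01 g u + ip01 h u"
  unfolding ip01_def distrib_right by (intro integral_add ip01_integrable)

lemma ip01_diff_left:
  "continuous_on {0..1} g \<Longrightarrow> continuous_on {0..1} h \<Longrightarrow> continuous_on {0..1} u \<Longrightarrow>
   ip01 (\<lambda>x. g x - h x) u = ip01 g u - ip01 h u"
  unfolding ip01_def left_diff_distrib by (intro integral_diff ip01_integrable)

lemma abs_ip01_le:
  assumes "continuous_on {0..1} g" "continuous_on {0..1} h"
    and "\<And>x. x \<in> {0..1} \<Longrightarrow> \<bar>g x\<bar> \<le> A" "\<And>x. x \<in> {0..1} \<Longrightarrow> \<bar>h x\<bar> \<le> B"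
  shows "\<bar>ip01 g h\<bar> \<le> A * B"
proof -
  have "norm (integral {0..1} (\<lambda>x. g x * h x)) \<le> A * B * (1 - 0)"
  proof (rule integral_bound)
    show "continuous_on {0..1} (\<lambda>x. g x * h x)" by (intro continuous_intros assms)
    show "norm (g x * h x) \<le> A * B" if "x \<in> {0..1}" for x
      unfolding norm_mult using assms(3,4)[OF that] by (intro mult_mono) auto
  qed simp
  then show ?thesis by (simp add: ip01_def)
qed

lemma ip01_phi_bounded:
  assumes "continuous_on {0..1} g"
  obtains B where "B \<ge> 0" "\<And>n. \<bar>ip01 g (phi n)\<bar> \<le> B"
proof -
  have "bounded (g ` {0..1})" by (intro compact_imp_bounded compact_continuous_image assms) auto
  then obtain B where "B > 0" "\<And>x. x \<in> {0..1} \<Longrightarrow> \<bar>g x\<bar> \<le> B" by (auto simp: bounded_pos)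
  then show thesis
    by (intro that[of "B * sqrt 2"] abs_ip01_le assms continuous_on_phi abs_phi_le) auto
qed

lemma ip01_sum_phi:
  assumes "finite J"
  shows "ip01 (\<lambda>x. \<Sum>j\<in>J. l j * phi j x) (phi n) = (if n \<in> J then l n else 0)"
proof -
  have "ip01 (\<lambda>x. \<Sum>j\<in>J. l j * phi j x) (phi n) = (\<Sum>j\<in>J. l j * ip01 (phi j) (phi n))"
    unfolding ip01_def sum_distrib_right
    by (subst integral_sum)
       (auto simp: assms mult.assoc intro!: integrable_continuous_real continuous_intros)
  then show ?thesis using assms by (simp add: ip01_phi if_distrib[of "(*) _"] sum.delta' cong: if_cong)
qed

inductive_set cospoly :: "(real \<Rightarrow> real) set" where
  single: "(\<lambda>x. c * cos (of_int k * pi * x)) \<in> cospoly"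
| add: "f \<in> cospoly \<Longrightarrow> g \<in> cospoly \<Longrightarrow> (\<lambda>x. f x + g x) \<in> cospoly"

lemma cospoly_mult:
  assumes "f \<in> cospoly" "g \<in> cospoly"
  shows "(\<lambda>x. f x * g x) \<in> cospoly"
  using assms(1)
proof (induction rule: cospoly.induct)
  case (single c k)
  show ?case using assms(2)
  proof (induction rule: cospoly.induct)
    case (single d j)
    have "(\<lambda>x. c * cos (of_int k * pi * x) * (d * cos (of_int j * pi * x))) =
        (\<lambda>x. c * d / 2 * cos (of_int (k - j) * pi * x) + c * d / 2 * cos (of_int (k + j) * pi * x))"
      by (simp add: fun_eq_iff cos_times_cos algebra_simps)
        (simp add: cos_add cos_diff algebra_simps)
    then show ?case by (simp only:) (intro cospoly.intros)
  next
    case (add f g)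
    then show ?case by (simp only: distrib_left) (intro cospoly.intros)
  qed
next
  case (add f h)
  then show ?case by (simp only: distrib_right) (intro cospoly.intros)
qed

lemma continuous_on_cospoly: "f \<in> cospoly \<Longrightarrow> continuous_on A f"
  by (induction rule: cospoly.induct) (auto intro!: continuous_intros)

lemma function_ring_cospoly: "function_ring_on cospoly {0..1}"
proof
  show "(\<lambda>_. c) \<in> cospoly" for c using cospoly.single[of c 0] by simp
  fix x y :: real assume xy: "x \<in> {0..1}" "y \<in> {0..1}" "x \<noteq> y"
  have "cos (pi * x) \<noteq> cos (pi * y)"
    using xy cos_inj_pi[of "pi * x" "pi * y"] by (auto simp: mult_le_cancel_left1)
  then show "\<exists>f\<in>cospoly. f x \<noteq> f y"
    using cospoly.single[of 1 1] by (intro bexI[of _ "\<lambda>x. 1 * cos (of_int 1 * pi * x)"]) auto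
qed (auto simp: cospoly_mult continuous_on_cospoly cospoly.add)

lemma ip01_cospoly_eq_0:
  assumes "continuous_on {0..1} g" "\<And>n. ip01 (phi n) g = 0" "r \<in> cospoly"
  shows "ip01 r g = 0"
  using assms(3)
proof (induction rule: cospoly.induct)
  case (single c k)
  define m where "m = nat \<bar>k\<bar>"
  have "cos (of_int k * pi * x) = cos (real m * pi * x)" for x
    by (cases "k \<ge> 0") (auto simp: m_def)
  then have "c * cos (of_int k * pi * x) * g x = c / (if m = 0 then 1 else sqrt 2) * (phi m x * g x)" for x
    by (simp add: phi_alt)
  then have "ip01 (\<lambda>x. c * cos (of_int k * pi * x)) g = c / (if m = 0 then 1 else sqrt 2) * ip01 (phi m) g"
    unfolding ip01_def by (simp only: integral_mult_right)
  then show ?case by (simp add: assms(2))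
next
  case (add f h)
  then show ?case by (simp add: ip01_add_left continuous_on_cospoly assms(1))
qed

lemma ip01_self_eq_0_imp:
  assumes "continuous_on {0..1} g" "ip01 g g = 0" "x \<in> {0..1}"
  shows "g x = 0"
proof -
  have "\<forall>y\<in>{0..1}. (g y)\<^sup>2 = 0"
    by (subst integral_eq_0_iff[symmetric])
       (use assms in \<open>auto intro!: continuous_intros simp: ip01_def power2_eq_square\<close>)
  then show ?thesis using assms(3) by simp
qed

lemma phi_complete:
  assumes cont: "continuous_on {0..1} g" and orth: "\<And>n. ip01 (phi n) g = 0" and "x \<in> {0..1}"
  shows "g x = 0"
proof (rule ip01_self_eq_0_imp[OF cont _ \<open>x \<in> {0..1}\<close>])
  interpret function_ring_on cospoly "{0..1}" by (rule function_ring_cospoly)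
  have "bounded (g ` {0..1})" by (intro compact_imp_bounded compact_continuous_image cont) auto
  then obtain B where B: "B > 0" "\<And>x. x \<in> {0..1} \<Longrightarrow> \<bar>g x\<bar> \<le> B"
    by (auto simp: bounded_pos)
  have "\<bar>ip01 g g\<bar> \<le> 0 + e" if "e > 0" for e
  proof -
    obtain r where r: "r \<in> cospoly" "\<And>x. x \<in> {0..1} \<Longrightarrow> \<bar>g x - r x\<bar> < e / B"
      using Stone_Weierstrass_basic[OF cont divide_pos_pos[OF \<open>e > 0\<close> B(1)]] by blast
    note cont_r = continuous_on_cospoly[OF r(1)]
    have "ip01 g g = ip01 (\<lambda>x. g x - r x) g"
      by (simp add: ip01_diff_left[OF cont cont_r cont] ip01_cospoly_eq_0[OF cont orth r(1)])
    also have "\<bar>\<dots>\<bar> \<le> e / B * B"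
      by (intro abs_ip01_le continuous_intros cont cont_r B less_imp_le[OF r(2)])
    finally show ?thesis using B(1) by simp
  qed
  then show "ip01 g g = 0" using field_le_epsilon[of "\<bar>ip01 g g\<bar>" 0] by simp
qed

lemma uniform_limit_phi_series:
  assumes "summable (\<lambda>n. \<bar>c n\<bar>)"
  shows "uniform_limit {0..1} (\<lambda>n x. \<Sum>i<n. c i * phi i x) (\<lambda>x. \<Sum>i. c i * phi i x) sequentially"
proof (rule Weierstrass_m_test)
  show "summable (\<lambda>n. \<bar>c n\<bar> * sqrt 2)" using assms by (rule summable_mult2)
  show "norm (c n * phi n x) \<le> \<bar>c n\<bar> * sqrt 2" for n x
    unfolding norm_mult by (intro mult_mono) (auto simp: abs_phi_le)
qed

lemma continuous_on_phi_series:
  assumes "summable (\<lambda>n. \<bar>c n\<bar>)"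
  shows "continuous_on {0..1} (\<lambda>x. \<Sum>i. c i * phi i x)"
  by (rule uniform_limit_theorem[OF _ uniform_limit_phi_series[OF assms]])
     (auto intro!: continuous_intros always_eventually)

lemma ip01_phi_series:
  assumes c: "summable (\<lambda>n. \<bar>c n\<bar>)"
  shows "ip01 (\<lambda>x. \<Sum>i. c i * phi i x) (phi m) = c m"
proof -
  let ?h = "\<lambda>x. \<Sum>i. c i * phi i x" and ?S = "\<lambda>n x. \<Sum>i<n. c i * phi i x"
  have "uniform_limit {0..1} (\<lambda>n x. ?S n x * phi m x) (\<lambda>x. ?h x * phi m x) sequentially"
    by (intro uniform_lim_mult uniform_limit_phi_series c uniform_limit_const compact_imp_bounded
        compact_continuous_image continuous_on_phi_series continuous_on_phi) auto
  then obtain I J where IJ: "\<And>n. ((\<lambda>x. ?S n x * phi m x) has_integral I n) {0..1}"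
    "((\<lambda>x. ?h x * phi m x) has_integral J) {0..1}" "(I \<longlongrightarrow> J) sequentially"
    by (rule uniform_limit_integral) (auto intro!: continuous_intros)
  have "I n = ip01 (?S n) (phi m)" for n
    using IJ(1)[of n] by (simp add: ip01_def integral_unique)
  then have "I n = (if m < n then c m else 0)" for n by (simp add: ip01_sum_phi)
  then have "I \<longlonglongrightarrow> c m"
    by (intro tendsto_eventually eventually_mono[OF eventually_gt_at_top[of m]]) simp
  then have "J = c m" using IJ(3) LIMSEQ_unique by blast
  then show ?thesis using IJ(2) by (simp add: ip01_def integral_unique)
qed

lemma phi_series_sums:
  assumes cont: "continuous_on {0..1} g" and summ: "summable (\<lambda>n. \<bar>ip01 g (phi n)\<bar>)" and x: "x \<in> {0..1}"
  shows "(\<lambda>n. ip01 g (phi n) * phi n x) sums g x"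
proof -
  define h where "h x = (\<Sum>n. ip01 g (phi n) * phi n x)" for x
  have h: "continuous_on {0..1} h" "\<And>m. ip01 h (phi m) = ip01 g (phi m)"
    unfolding h_def by (intro continuous_on_phi_series ip01_phi_series summ)+
  have "g x - h x = 0"
    by (rule phi_complete[OF _ _ x])
       (auto intro!: continuous_intros cont h(1)
         simp: ip01_commute[of "phi _"] ip01_diff_left[OF cont h(1)] continuous_on_phi h(2))
  moreover have "summable (\<lambda>n. ip01 g (phi n) * phi n x)"
    by (rule summable_comparison_test'[OF summable_mult2[OF summ, of "sqrt 2"]])
       (auto simp: abs_mult intro!: mult_left_mono abs_phi_le)
  ultimately show ?thesis by (simp add: h_def summable_sums)
qed

lemma norm_ipv01_phi_le:
  assumes "\<And>x. x \<in> {0..1} \<Longrightarrow> norm (g x) \<le> B"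
  shows "norm (ipv01 g (phi n)) \<le> sqrt 2 * B"
proof (cases "(\<lambda>x. phi n x *\<^sub>R g x) integrable_on {0..1}")
  case True
  have "norm (integral {0..1} (\<lambda>x. phi n x *\<^sub>R g x)) \<le> integral {0..1} (\<lambda>x::real. sqrt 2 * B)"
  proof (rule Henstock_Kurzweil_Integration.integral_norm_bound_integral[OF True])
    fix x :: real assume "x \<in> {0..1}"
    then show "norm (phi n x *\<^sub>R g x) \<le> sqrt 2 * B"
      unfolding norm_scaleR using assms by (intro mult_mono) (auto simp: abs_phi_le)
  qed auto
  then show ?thesis by (simp add: ipv01_def)
next
  case False
  have "B \<ge> 0" using order_trans[OF norm_ge_zero assms[of 0]] by simp
  then show ?thesis using False by (simp add: ipv01_def not_integrable_integral)
qed

section \<open>Quadratic forms and Sylvester equations\<close>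

definition mvec :: "nat \<Rightarrow> (nat \<Rightarrow> nat \<Rightarrow> real) \<Rightarrow> (nat \<Rightarrow> 'a::real_vector) \<Rightarrow> nat \<Rightarrow> 'a" where
  "mvec m X x = (\<lambda>i. \<Sum>j<m. X i j *\<^sub>R x j)"

definition bform :: "nat \<Rightarrow> (nat \<Rightarrow> nat \<Rightarrow> real) \<Rightarrow> (nat \<Rightarrow> real) \<Rightarrow> (nat \<Rightarrow> real) \<Rightarrow> real" where
  "bform m X x y = (\<Sum>i<m. \<Sum>j<m. x i * X i j * y j)"

definition sqnorm :: "nat \<Rightarrow> (nat \<Rightarrow> real) \<Rightarrow> real" where
  "sqnorm m x = (\<Sum>i<m. (x i)\<^sup>2)"

lemma mvec_cong: "(\<And>i. i < m \<Longrightarrow> x i = y i) \<Longrightarrow> mvec m X x i = mvec m X y i"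
  by (simp add: mvec_def)

lemma mvec_diff: "mvec m X (\<lambda>j. x j - y j) i = mvec m X x i - mvec m X y i"
  by (simp add: mvec_def scaleR_right_diff_distrib sum_subtractf)

lemma linear_mvec:
  assumes "linear h"
  shows "h (mvec m X x i) = mvec m X (\<lambda>j. h (x j)) i"
  by (simp add: mvec_def linear_sum[OF assms] linear_scale[OF assms])

lemma mvec_mmul: "mvec m (mmul m X Y) x = mvec m X (mvec m Y x)"
  unfolding mvec_def mmul_def scaleR_sum_left scaleR_sum_right by (subst sum.swap) simp

lemma mvec_Amat: "i < m \<Longrightarrow> mvec m (Amat a) x i = (a - (real i * pi)\<^sup>2) *\<^sub>R x i"
  by (simp add: mvec_def Amat_def if_distrib[of "\<lambda>u. u *\<^sub>R _"] cong: if_cong)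

lemma sqnorm_nonneg [simp]: "sqnorm m x \<ge> 0"
  by (simp add: sqnorm_def sum_nonneg)

lemma square_le_sqnorm: "i < m \<Longrightarrow> (x i)\<^sup>2 \<le> sqnorm m x"
  unfolding sqnorm_def by (rule member_le_sum) auto

lemma bform_mvec: "bform m X x y = (\<Sum>i<m. x i * mvec m X y i)"
  by (simp add: bform_def mvec_def sum_distrib_left mult.assoc)

lemma bform_cong:
  "(\<And>i. i < m \<Longrightarrow> x i = x' i) \<Longrightarrow> (\<And>i. i < m \<Longrightarrow> y i = y' i) \<Longrightarrow> bform m X x y = bform m X x' y'"
  by (simp add: bform_def)

lemma bform_mtr: "bform m (mtr X) x y = bform m X y x"
  unfolding bform_def mtr_def by (subst sum.swap) (simp add: mult_ac)

lemma bform_mmul: "bform m (mmul m X Y) x y = bform m X x (mvec m Y y)"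
  by (simp add: bform_mvec mvec_mmul)

lemma bform_mmul_mtr: "bform m (mmul m (mtr X) Y) x y = bform m Y (mvec m X x) y"
proof -
  have "bform m (mmul m (mtr X) Y) x y = bform m (mtr (mmul m (mtr Y) X)) x y"
    by (simp add: mtr_def mmul_def mult.commute)
  then show ?thesis by (simp add: bform_mtr bform_mmul)
qed

lemma bform_matrix_add: "bform m (\<lambda>i j. X i j + Y i j) x y = bform m X x y + bform m Y x y"
  by (simp add: bform_def sum.distrib algebra_simps)

lemma bform_matrix_diff: "bform m (\<lambda>i j. X i j - Y i j) x y = bform m X x y - bform m Y x y"
  by (simp add: bform_def sum_subtractf algebra_simps)

lemma bform_matrix_minus: "bform m (\<lambda>i j. - X i j) x y = - bform m X x y"
  by (simp add: bform_def sum_negf)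

lemma bform_matrix_scale: "bform m (\<lambda>i j. c * X i j) x y = c * bform m X x y"
  by (simp add: bform_def sum_distrib_left mult_ac)

lemma bform_add_right: "bform m X x (\<lambda>i. y i + z i) = bform m X x y + bform m X x z"
  by (simp add: bform_def sum.distrib algebra_simps)

lemma bform_diff_right: "bform m X x (\<lambda>i. y i - z i) = bform m X x y - bform m X x z"
  by (simp add: bform_def sum_subtractf algebra_simps)

lemma bform_diff_left: "bform m X (\<lambda>i. y i - z i) x = bform m X y x - bform m X z x"
  by (simp add: bform_def sum_subtractf algebra_simps)

lemma bform_scale_right: "bform m X x (\<lambda>i. c * y i) = c * bform m X x y"
  by (simp add: bform_def sum_distrib_left mult_ac)

lemma bform_scale_left: "bform m X (\<lambda>i. c * x i) y = c * bform m X x y"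
  by (simp add: bform_def sum_distrib_left mult_ac)

lemma bform_0_left: "(\<And>i. i < m \<Longrightarrow> x i = 0) \<Longrightarrow> bform m X x y = 0"
  by (simp add: bform_def)

lemma posdef_bform_commute: "posdef m X \<Longrightarrow> bform m X x y = bform m X y x"
  unfolding bform_def posdef_def by (subst sum.swap) (simp add: mult_ac)

lemma posdef_bform_pos: "posdef m X \<Longrightarrow> i < m \<Longrightarrow> x i \<noteq> 0 \<Longrightarrow> bform m X x x > 0"
  unfolding posdef_def bform_def by blast

lemma posdef_bform_nonneg:
  assumes "posdef m X"
  shows "bform m X x x \<ge> 0"
  using posdef_bform_pos[OF assms, of _ x] bform_0_left[of m x X x] by fastforce

lemma compact_unit_sphere: "compact {x :: nat \<Rightarrow> real. (\<forall>i\<ge>m. x i = 0) \<and> sqnorm m x = 1}"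
proof -
  define P where "P = (\<Pi>\<^sub>E i\<in>(UNIV :: nat set). if i < m then {-1..1 :: real} else {0})"
  have "compactin (product_topology (\<lambda>i. euclidean) UNIV) P"
    unfolding P_def compactin_PiE by auto
  then have "compact P" by (simp add: euclidean_product_topology)
  moreover have "closed {x :: nat \<Rightarrow> real. sqnorm m x = 1}"
    unfolding sqnorm_def by (intro closed_Collect_eq continuous_intros continuous_on_product_coordinates)
  ultimately have "compact (P \<inter> {x. sqnorm m x = 1})" by (rule compact_Int_closed)
  moreover have "{x. (\<forall>i\<ge>m. x i = 0) \<and> sqnorm m x = 1} = P \<inter> {x. sqnorm m x = 1}"
  proof (intro set_eqI iffI)
    fix x assume x: "x \<in> {x. (\<forall>i\<ge>m. x i = 0) \<and> sqnorm m x = 1}"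
    then have "\<bar>x i\<bar> \<le> 1" if "i < m" for i
      using square_le_sqnorm[OF that, of x] by (simp add: abs_square_le_1)
    with x show "x \<in> P \<inter> {x. sqnorm m x = 1}" by (auto simp: P_def PiE_def abs_le_iff minus_le_iff)
  next
    fix x assume x: "x \<in> P \<inter> {x. sqnorm m x = 1}"
    then have "x i \<in> (if i < m then {-1..1} else {0})" for i unfolding P_def by (blast dest: PiE_mem)
    then have "x i = 0" if "i \<ge> m" for i using that by (metis not_le singletonD)
    with x show "x \<in> {x. (\<forall>i\<ge>m. x i = 0) \<and> sqnorm m x = 1}" by simp
  qed
  ultimately show ?thesis by simp
qed

lemma bform_ge_of_unit_sphere:
  assumes sphere: "\<And>x. \<forall>i\<ge>m. x i = 0 \<Longrightarrow> sqnorm m x = 1 \<Longrightarrow> \<kappa> \<le> bform m X x x"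
  shows "\<kappa> * sqnorm m x \<le> bform m X x x"
proof (cases "sqnorm m x = 0")
  case True
  then have "x i = 0" if "i < m" for i using square_le_sqnorm[OF that, of x] by simp
  then show ?thesis using True by (simp add: bform_0_left)
next
  case False
  define r where "r = sqrt (sqnorm m x)"
  have r: "r > 0" "r\<^sup>2 = sqnorm m x" using False sqnorm_nonneg[of m x] by (auto simp: r_def less_le)
  define y where "y i = (if i < m then 1 / r * x i else 0)" for i
  have "sqnorm m y = (\<Sum>i<m. (x i)\<^sup>2) / r\<^sup>2"
    by (simp add: sqnorm_def y_def power_divide sum_divide_distrib)
  also have "\<dots> = 1" using r False by (simp add: sqnorm_def[symmetric])
  finally have "\<kappa> \<le> bform m X y y" by (intro sphere) (auto simp: y_def)
  also have "\<dots> = bform m X (\<lambda>i. 1 / r * x i) (\<lambda>i. 1 / r * x i)"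
    by (rule bform_cong) (auto simp: y_def)
  also have "\<dots> = bform m X x x / r\<^sup>2"
    by (simp only: bform_scale_left bform_scale_right) (simp add: power2_eq_square)
  finally show ?thesis using r(1) by (simp add: r(2)[symmetric] field_simps)
qed

lemma posdef_coercive:
  assumes "posdef m X"
  obtains \<kappa> where "\<kappa> > 0" "\<And>x. \<kappa> * sqnorm m x \<le> bform m X x x"
proof (cases "m = 0")
  case True
  then show thesis using that[of 1] by (simp add: sqnorm_def bform_def)
next
  case False
  define K where "K = {x :: nat \<Rightarrow> real. (\<forall>i\<ge>m. x i = 0) \<and> sqnorm m x = 1}"
  have "compact K" unfolding K_def by (rule compact_unit_sphere)
  moreover have "(\<lambda>i. if i = 0 then 1 else 0) \<in> K"
    using False by (auto simp: K_def sqnorm_def if_distrib[of "\<lambda>x. x ^ 2"] cong: if_cong)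
  moreover have "continuous_on K (\<lambda>x. bform m X x x)"
    unfolding bform_def
    by (intro continuous_intros; rule continuous_on_subset[OF continuous_on_product_coordinates subset_UNIV])
  ultimately obtain x where x: "x \<in> K" "\<And>y. y \<in> K \<Longrightarrow> bform m X x x \<le> bform m X y y"
    using continuous_attains_inf[of K "\<lambda>x. bform m X x x"] by blast
  have "\<exists>i<m. x i \<noteq> 0"
  proof (rule ccontr)
    assume "\<not> ?thesis"
    then have "sqnorm m x = 0" by (simp add: sqnorm_def)
    then show False using x(1) by (simp add: K_def)
  qed
  then have "bform m X x x > 0" using posdef_bform_pos[OF assms] by blast
  then show thesis by (rule that) (rule bform_ge_of_unit_sphere, rule x, simp add: K_def)
qed

lemma square_le_posdef_bform:
  assumes "posdef m X"
  obtains C where "\<And>i x. i < m \<Longrightarrow> (x i)\<^sup>2 \<le> C * bform m X x x"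
proof -
  obtain \<kappa> where \<kappa>: "\<kappa> > 0" "\<And>x. \<kappa> * sqnorm m x \<le> bform m X x x"
    by (rule posdef_coercive[OF assms]) blast
  show thesis
  proof (rule that[of "1 / \<kappa>"])
    fix i and x :: "nat \<Rightarrow> real" assume "i < m"
    then have "\<kappa> * (x i)\<^sup>2 \<le> \<kappa> * sqnorm m x" using \<kappa>(1) square_le_sqnorm by simp
    also have "\<dots> \<le> bform m X x x" by (rule \<kappa>(2))
    finally show "(x i)\<^sup>2 \<le> 1 / \<kappa> * bform m X x x" using \<kappa>(1) by (simp add: field_simps)
  qed
qed

lemma bform_young:
  assumes "\<epsilon> > 0"
  obtains C where "C \<ge> 0" "\<And>x y. 2 * bform m X x y \<le> \<epsilon> * sqnorm m x + C * sqnorm m y"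
proof -
  define e where "e = \<epsilon> / real (m + 1)"
  have e: "e > 0" "e * real m \<le> \<epsilon>" using assms by (auto simp: e_def field_simps)
  define D where "D = (\<Sum>i<m. \<Sum>j<m. (X i j)\<^sup>2) / e"
  have D: "D \<ge> 0" using e by (auto simp: D_def intro!: divide_nonneg_pos sum_nonneg)
  have entry: "2 * (u * X i j * v) \<le> e * u\<^sup>2 + D * v\<^sup>2" if "i < m" "j < m" for i j u v
  proof -
    have "(X i j)\<^sup>2 \<le> (\<Sum>j<m. (X i j)\<^sup>2)" by (rule member_le_sum) (use that in auto)
    also have "\<dots> \<le> (\<Sum>i<m. \<Sum>j<m. (X i j)\<^sup>2)"
      by (rule member_le_sum) (use that in \<open>auto intro: sum_nonneg\<close>)
    finally have "(X i j)\<^sup>2 / e * v\<^sup>2 \<le> D * v\<^sup>2"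
      using e by (intro mult_right_mono) (auto simp: D_def divide_right_mono)
    moreover have "0 \<le> (e * u - X i j * v)\<^sup>2 / e" using e by simp
    then have "2 * (u * X i j * v) \<le> e * u\<^sup>2 + (X i j)\<^sup>2 / e * v\<^sup>2"
      using e by (simp add: field_simps power2_eq_square)
    ultimately show ?thesis by linarith
  qed
  show thesis
  proof (rule that[of "real m * D"])
    fix x y :: "nat \<Rightarrow> real"
    have "2 * bform m X x y \<le> (\<Sum>i<m. \<Sum>j<m. e * (x i)\<^sup>2 + D * (y j)\<^sup>2)"
      unfolding bform_def sum_distrib_left by (intro sum_mono entry) auto
    also have "\<dots> = e * real m * sqnorm m x + real m * D * sqnorm m y"
      by (simp add: sum.distrib sqnorm_def sum_distrib_left[symmetric] sum_distrib_right[symmetric])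
    also have "\<dots> \<le> \<epsilon> * sqnorm m x + real m * D * sqnorm m y"
      using e by (intro add_right_mono mult_right_mono) auto
    finally show "2 * bform m X x y \<le> \<epsilon> * sqnorm m x + real m * D * sqnorm m y" .
  qed (use D in auto)
qed

lemma has_real_derivative_bform:
  assumes "\<And>i. i < m \<Longrightarrow> (x i has_real_derivative x' i) (at t)"
    and "\<And>i. i < m \<Longrightarrow> (y i has_real_derivative y' i) (at t)"
  shows "((\<lambda>t. bform m X (\<lambda>i. x i t) (\<lambda>i. y i t)) has_real_derivative
      (bform m X x' (\<lambda>i. y i t) + bform m X (\<lambda>i. x i t) y')) (at t)"
  unfolding bform_def sum.distrib[symmetric]
proof (intro DERIV_sum)
  fix i j assume "i \<in> {..<m}" "j \<in> {..<m}"
  then show "((\<lambda>t. x i t * X i j * y j t) has_real_derivative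
      (x' i * X i j * y j t + x i t * X i j * y' j)) (at t)"
    using assms by (auto intro!: derivative_eq_intros)
qed

lemma has_real_derivative_posdef_bform:
  assumes "posdef m X" "\<And>i. i < m \<Longrightarrow> (x i has_real_derivative x' i) (at t)"
  shows "((\<lambda>t. bform m X (\<lambda>i. x i t) (\<lambda>i. x i t)) has_real_derivative
      2 * bform m X (\<lambda>i. x i t) x') (at t)"
  using has_real_derivative_bform[of m x x' t x x' X, OF assms(2) assms(2)]
    posdef_bform_commute[OF assms(1), of x'] by simp

lemma expdecay_sqnorm:
  assumes "\<And>i. i < m \<Longrightarrow> expdecay (g i)"
  shows "expdecay (\<lambda>t. sqnorm m (\<lambda>i. g i t))"
  unfolding sqnorm_def power2_eq_square
  by (intro expdecay_sum expdecay_mult_bounded expdecay_imp_bigo_1 assms) auto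

locale lyapunov_matrix =
  fixes m :: nat and Q M :: "nat \<Rightarrow> nat \<Rightarrow> real" and \<delta> :: real
  assumes Q: "posdef m Q"
    and decay: "negdef m (\<lambda>i j. mmul m Q M i j + mmul m (mtr M) Q i j + 2 * \<delta> * Q i j)"
    and \<delta>_pos: "\<delta> > 0"
begin

lemma bform_lyapunov:
  "bform m (\<lambda>i j. - (mmul m Q M i j + mmul m (mtr M) Q i j + 2 * \<delta> * Q i j)) x x
    = - (2 * bform m Q x (mvec m M x) + 2 * \<delta> * bform m Q x x)"
  unfolding bform_matrix_minus
  by (simp only: bform_matrix_add bform_matrix_scale bform_mmul_mtr)
     (simp add: bform_mmul posdef_bform_commute[OF Q, of "mvec m M x"])

lemma bform_mvec_neg:
  assumes "i < m" "x i \<noteq> 0"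
  shows "bform m Q x (mvec m M x) < 0"
proof -
  have "2 * bform m Q x (mvec m M x) + 2 * \<delta> * bform m Q x x < 0"
    using posdef_bform_pos[where x=x, OF decay[unfolded negdef_def] assms] unfolding bform_lyapunov by simp
  moreover have "2 * \<delta> * bform m Q x x \<ge> 0" using posdef_bform_nonneg[OF Q] \<delta>_pos by simp
  ultimately show ?thesis by linarith
qed

lemma bform_mvec_nonpos: "bform m Q x (mvec m M x) \<le> 0"
  using bform_mvec_neg[of _ x] bform_0_left[of m x] by fastforce

lemma linear_system_expdecay:
  fixes x g :: "nat \<Rightarrow> real \<Rightarrow> real"
  assumes x: "\<And>i t. i < m \<Longrightarrow> t \<ge> T \<Longrightarrow> (x i has_real_derivative mvec m M (\<lambda>j. x j t) i + g i t) (at t)"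
    and g: "\<And>i. i < m \<Longrightarrow> expdecay (g i)" and "i < m"
  shows "expdecay (x i)"
proof -
  obtain \<kappa> where \<kappa>: "\<kappa> > 0"
    "\<And>x. \<kappa> * sqnorm m x \<le> - (2 * bform m Q x (mvec m M x) + 2 * \<delta> * bform m Q x x)"
    using posdef_coercive[OF decay[unfolded negdef_def]] unfolding bform_lyapunov by blast
  obtain C where C: "C \<ge> 0" "\<And>x y. 2 * bform m Q x y \<le> \<kappa> * sqnorm m x + C * sqnorm m y"
    by (rule bform_young[OF \<kappa>(1)]) blast
  define V where "V t = bform m Q (\<lambda>i. x i t) (\<lambda>i. x i t)" for t
  have "expdecay V"
  proof (rule lyapunov_expdecay[of T _ _ "2 * \<delta>" "\<lambda>t. C * sqnorm m (\<lambda>i. g i t)"])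
    fix t assume t: "t \<ge> T"
    let ?x = "\<lambda>i. x i t" and ?g = "\<lambda>i. g i t"
    show "(V has_real_derivative 2 * bform m Q ?x (\<lambda>i. mvec m M ?x i + ?g i)) (at t)"
      unfolding V_def by (rule has_real_derivative_posdef_bform[OF Q]) (rule x[OF _ t])
    show "2 * bform m Q ?x (\<lambda>i. mvec m M ?x i + ?g i) \<le> - (2 * \<delta>) * V t + C * sqnorm m ?g"
      unfolding bform_add_right using \<kappa>(2)[of ?x] C(2)[of ?x ?g] by (simp add: V_def)
  qed (use \<delta>_pos in \<open>auto simp: V_def posdef_bform_nonneg[OF Q] intro!: expdecay_cmult expdecay_sqnorm g\<close>)
  moreover obtain c where "\<And>x. (x i)\<^sup>2 \<le> c * bform m Q x x"
    by (rule square_le_posdef_bform[OF Q]) (use \<open>i < m\<close> in blast)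
  then have "(\<lambda>t. (x i t)\<^sup>2) \<in> O(V)"
    by (intro bigo_geI[of T _ c]) (auto simp: V_def posdef_bform_nonneg[OF Q])
  ultimately show ?thesis by (rule expdecay_of_square[rotated])
qed

lemma positive_plus_square_injective:
  fixes x :: "nat \<Rightarrow> real"
  assumes "\<theta> > 0" and x: "\<And>i. i < m \<Longrightarrow> \<theta> * x i + mvec m M (mvec m M x) i = 0" and "i < m"
  shows "x i = 0"
proof (rule ccontr)
  assume "x i \<noteq> 0"
  let ?y = "mvec m M x"
  have "bform m Q x ?y < 0" using \<open>i < m\<close> \<open>x i \<noteq> 0\<close> by (rule bform_mvec_neg)
  moreover have "bform m Q ?y (mvec m M ?y) = bform m Q ?y (\<lambda>i. - \<theta> * x i)"
    by (rule bform_cong) (use x in \<open>auto simp: algebra_simps add_eq_0_iff2\<close>)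
  then have "bform m Q ?y (mvec m M ?y) = - \<theta> * bform m Q x ?y"
    by (simp only: bform_scale_right posdef_bform_commute[OF Q, of ?y])
  ultimately have "bform m Q ?y (mvec m M ?y) > 0" using \<open>\<theta> > 0\<close> by (simp add: mult_pos_neg)
  then show False using bform_mvec_nonpos[of ?y] by simp
qed

end

lemma injective_imp_solvable:
  fixes A :: "'i \<Rightarrow> 'j \<Rightarrow> real"
  assumes "finite J" "finite I" "card I = card J"
    and "\<And>x. \<forall>i\<in>I. (\<Sum>j\<in>J. A i j * x j) = 0 \<Longrightarrow> \<forall>j\<in>J. x j = 0"
  shows "\<exists>x. \<forall>i\<in>I. (\<Sum>j\<in>J. A i j * x j) = b i"
  using assms
proof (induction J arbitrary: I A b rule: finite_induct)
  case (insert c J)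
  note inj = insert.prems(3)
  have sum_upd: "(\<Sum>j\<in>insert c J. A i j * (x(c := s)) j) = A i c * s + (\<Sum>j\<in>J. A i j * x j)" for x s i
    using insert.hyps by (simp add: sum.insert) (rule sum.cong, auto)
  have "\<exists>i\<in>I. A i c \<noteq> 0"
    using inj[of "(\<lambda>_. 0)(c := 1)"] unfolding sum_upd by auto
  then obtain r where r: "r \<in> I" "A r c \<noteq> 0" by blast
  \<comment> \<open>one step of Gaussian elimination with pivot \<open>A r c\<close>\<close>
  define A' where "A' i j = A i j - A i c / A r c * A r j" for i j
  define s where "s \<beta> x = (\<beta> - (\<Sum>j\<in>J. A r j * x j)) / A r c" for \<beta> x
  have elim: "(\<Sum>j\<in>insert c J. A i j * (x(c := s \<beta> x)) j) = (\<Sum>j\<in>J. A' i j * x j) + A i c / A r c * \<beta>" for x i \<beta>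
    using r(2) unfolding sum_upd
    by (simp add: s_def A'_def left_diff_distrib right_diff_distrib sum_subtractf sum_distrib_left
        sum_divide_distrib mult.assoc diff_divide_distrib)
  have "\<exists>x. \<forall>i\<in>I - {r}. (\<Sum>j\<in>J. A' i j * x j) = b i - A i c / A r c * b r"
  proof (rule insert.IH)
    show "card (I - {r}) = card J" using insert.prems insert.hyps r(1) by simp
    fix x assume x: "\<forall>i\<in>I - {r}. (\<Sum>j\<in>J. A' i j * x j) = 0"
    have "\<forall>i\<in>I. (\<Sum>j\<in>insert c J. A i j * (x(c := s 0 x)) j) = 0"
    proof
      fix i assume "i \<in> I"
      then show "(\<Sum>j\<in>insert c J. A i j * (x(c := s 0 x)) j) = 0"
        using x unfolding elim by (cases "i = r") (simp_all add: A'_def r(2))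
    qed
    then have "\<forall>j\<in>insert c J. (x(c := s 0 x)) j = 0" by (rule inj)
    then show "\<forall>j\<in>J. x j = 0" using insert.hyps by (auto split: if_splits)
  qed (use insert.prems in simp)
  then obtain x where x: "\<forall>i\<in>I - {r}. (\<Sum>j\<in>J. A' i j * x j) = b i - A i c / A r c * b r" by blast
  have "(\<Sum>j\<in>insert c J. A i j * (x(c := s (b r) x)) j) = b i" if "i \<in> I" for i
    using x that r(2) unfolding elim by (cases "i = r") (simp_all add: A'_def)
  then show ?case by blast
qed simp

lemma bounded_linear_vector_matrix_mult: "bounded_linear (\<lambda>x. x v* M)" for M :: "real^'n^'m"
proof -
  have "(\<lambda>x. x v* M) = (*v) (transpose M)" by (simp add: fun_eq_iff transpose_matrix_vector)
  then show ?thesis by simp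
qed

context lyapunov_matrix
begin

lemma positive_plus_square_solvable:
  fixes b :: "nat \<Rightarrow> real^2"
  assumes "\<theta> > 0"
  obtains c where "\<And>i. i < m \<Longrightarrow> \<theta> *\<^sub>R c i + mvec m M (mvec m M c) i = b i"
proof -
  define A where "A i j = (if i = j then \<theta> else 0) + mmul m M M i j" for i j
  have A: "(\<Sum>j<m. A i j * x j) = \<theta> * x i + mvec m M (mvec m M x) i" if "i < m" for i and x :: "nat \<Rightarrow> real"
    unfolding mvec_mmul[symmetric] using that
    by (simp add: A_def mvec_def distrib_right sum.distrib if_distrib[of "\<lambda>u. u * _"] cong: if_cong)
  have "\<exists>x. \<forall>i\<in>{..<m}. (\<Sum>j<m. A i j * x j) = b i $ k" for k
    by (rule injective_imp_solvable) (auto simp: A intro: positive_plus_square_injective[OF \<open>\<theta> > 0\<close>])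
  then obtain x where x: "\<And>k i. i < m \<Longrightarrow> (\<Sum>j<m. A i j * x k j) = b i $ k"
    by (metis lessThan_iff)
  have "linear (\<lambda>v :: real^2. v $ k)" for k
    by (rule bounded_linear.linear[OF bounded_linear_vec_nth])
  note component = linear_mvec[OF this]
  show thesis
    by (rule that[of "\<lambda>i. \<chi> k. x k i"]) (simp add: vec_eq_iff component A[symmetric] x)
qed

lemma sylvester_solvable:
  fixes G :: "real^2^2" and Y :: "nat \<Rightarrow> real^2"
  assumes "\<theta> > 0" and G: "\<And>v. v v* G v* G = - \<theta> *\<^sub>R v"
  obtains c where "\<And>i. i < m \<Longrightarrow> c i v* G - mvec m M c i = Y i"
proof -
  have linG: "linear (\<lambda>v. v v* G)" by (rule bounded_linear.linear[OF bounded_linear_vector_matrix_mult])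
  obtain c where c: "\<And>i. i < m \<Longrightarrow> \<theta> *\<^sub>R c i + mvec m M (mvec m M c) i = - (Y i v* G + mvec m M Y i)"
    by (rule positive_plus_square_solvable[OF \<open>\<theta> > 0\<close>, of "\<lambda>i. - (Y i v* G + mvec m M Y i)"]) blast
  define Z where "Z i = c i v* G - mvec m M c i - Y i" for i
  have ZG: "Z i v* G = - mvec m M Z i" if "i < m" for i
  proof -
    have "Z i v* G = - \<theta> *\<^sub>R c i - mvec m M (\<lambda>j. c j v* G) i - Y i v* G"
      by (simp add: Z_def linear_diff[OF linG] G linear_mvec[OF linG])
    also have "\<dots> = - mvec m M Z i"
      using c[OF that] unfolding Z_def mvec_diff by (simp add: algebra_simps)
    finally show ?thesis .
  qed
  have "\<theta> * Z i $ k + mvec m M (mvec m M (\<lambda>i. Z i $ k)) i = 0" if "i < m" for i k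
  proof -
    have "- \<theta> *\<^sub>R Z i = - mvec m M (\<lambda>j. Z j v* G) i"
      using arg_cong[OF ZG[OF that], of "\<lambda>v. v v* G"] by (simp only: G linear_neg[OF linG] linear_mvec[OF linG])
    also have "mvec m M (\<lambda>j. Z j v* G) i = mvec m M (\<lambda>j. - mvec m M Z j) i"
      by (rule mvec_cong) (rule ZG)
    finally have "\<theta> *\<^sub>R Z i + mvec m M (mvec m M Z) i = 0"
      by (simp add: mvec_def sum_negf eq_neg_iff_add_eq_0 neg_eq_iff_add_eq_0)
    from arg_cong[OF this, of "\<lambda>v. v $ k"] show ?thesis by (simp add: mvec_def)
  qed
  then have "Z i $ k = 0" if "i < m" for i k
    by (rule positive_plus_square_injective[OF \<open>\<theta> > 0\<close> _ that])
  then have "Z i = 0" if "i < m" for i using that by (simp add: vec_eq_iff)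
  then show thesis by (intro that[of c]) (simp add: Z_def)
qed

end

section \<open>The Lyapunov-Krasovskii functional\<close>

definition stack :: "nat \<Rightarrow> (nat \<Rightarrow> nat \<Rightarrow> 'a) \<Rightarrow> nat \<Rightarrow> 'a" where
  "stack m v i = v (i div m) (i mod m)"

lemma sum_blocks: "(\<Sum>i<n * m. f i) = (\<Sum>r<n. \<Sum>i<m. f (r * m + i))"
  for f :: "nat \<Rightarrow> 'a::comm_monoid_add"
proof -
  have "sum f {r * m..<r * m + m} = (\<Sum>i<m. f (r * m + i))" for r
    using sum.atLeastLessThan_shift_0[of f "r * m" "r * m + m"] by (simp add: o_def lessThan_atLeast0)
  then show ?thesis by (simp flip: sum.nat_group)
qed

lemma sqnorm_stack: "sqnorm (n * m) (stack m v) = (\<Sum>r<n. sqnorm m (v r))"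
  by (simp add: sqnorm_def sum_blocks stack_def)

lemma bform_stack:
  assumes "\<And>r c i j. r < n \<Longrightarrow> c < n \<Longrightarrow> i < m \<Longrightarrow> j < m \<Longrightarrow> X (r * m + i) (c * m + j) = F r c i j"
  shows "bform (n * m) X (stack m v) (stack m u) = (\<Sum>r<n. \<Sum>c<n. bform m (F r c) (v r) (u c))"
proof -
  have "bform (n * m) X (stack m v) (stack m u)
      = (\<Sum>r<n. \<Sum>i<m. \<Sum>c<n. \<Sum>j<m. v r i * F r c i j * u c j)"
    by (simp add: bform_def sum_blocks stack_def assms)
  also have "\<dots> = (\<Sum>r<n. \<Sum>c<n. bform m (F r c) (v r) (u c))"
    unfolding bform_def by (intro sum.cong refl sum.swap)
  finally show ?thesis .
qed

lemma bform_Phi: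
  fixes P1 P2 P3 S R :: "nat \<Rightarrow> nat \<Rightarrow> real" and x y z k :: "nat \<Rightarrow> real" and a \<delta> \<tau> :: real and N :: nat
  assumes R: "posdef (N + 1) R"
  defines "m \<equiv> N + 1" and "e \<equiv> exp (- 2 * \<delta> * \<tau>)"
  defines "F \<equiv> \<lambda>i. mvec m (Amat a) x i + mvec m (\<lambda>i j. Bvec i * k j) z i - y i"
  shows "bform (3 * m) (Phi a N k \<delta> \<tau> P1 P2 P3 S R) (stack m ((!) [x, y, z])) (stack m ((!) [x, y, z])) =
    2 * bform m P1 x y + 2 * \<delta> * bform m P1 x x + bform m S x x + \<tau>\<^sup>2 * bform m R y y - e * bform m S z z
    - e * bform m R (\<lambda>i. x i - z i) (\<lambda>i. x i - z i)
    + 2 * bform m (mtr P2) x F + 2 * bform m (mtr P3) y F"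
proof -
  let ?A = "Amat a" and ?BK = "\<lambda>i j. Bvec i * k j"
  let ?F11 = "\<lambda>i j. mmul m (mtr ?A) P2 i j + mmul m (mtr P2) ?A i j + 2 * \<delta> * P1 i j + S i j - e * R i j"
    and ?F12 = "\<lambda>i j. P1 i j - mtr P2 i j + mmul m (mtr ?A) P3 i j"
    and ?F13 = "\<lambda>i j. e * R i j + mmul m (mtr P2) ?BK i j"
    and ?F22 = "\<lambda>i j. - P3 i j - mtr P3 i j + \<tau>\<^sup>2 * R i j"
    and ?F23 = "\<lambda>i j. mmul m (mtr P3) ?BK i j"
    and ?F33 = "\<lambda>i j. - e * (S i j + R i j)"
  let ?F = "[[?F11, ?F12, ?F13], [mtr ?F12, ?F22, ?F23], [mtr ?F13, mtr ?F23, ?F33]]"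
  have "bform (3 * m) (Phi a N k \<delta> \<tau> P1 P2 P3 S R) (stack m ((!) [x, y, z])) (stack m ((!) [x, y, z]))
      = (\<Sum>r<3. \<Sum>c<3. bform m (?F ! r ! c) ([x, y, z] ! r) ([x, y, z] ! c))"
  proof (rule bform_stack)
    fix r c i j :: nat assume r: "r < 3" and c: "c < 3" and ij: "i < m" "j < m"
    have "r \<in> {0, 1, 2}" "c \<in> {0, 1, 2}" using r c by auto
    moreover have "(r * m + i) div m = r" "(r * m + i) mod m = i" "(c * m + j) div m = c" "(c * m + j) mod m = j"
      using ij by simp_all
    ultimately show "Phi a N k \<delta> \<tau> P1 P2 P3 S R (r * m + i) (c * m + j) = (?F ! r ! c) i j"
      unfolding Phi_def Let_def m_def[symmetric] by (elim insertE emptyE) (simp_all add: e_def mtr_def)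
  qed
  moreover have "bform m R z x = bform m R x z"
    by (rule posdef_bform_commute) (use R in \<open>simp add: m_def\<close>)
  ultimately show ?thesis
    by (simp add: F_def eval_nat_numeral bform_mtr bform_matrix_add bform_matrix_diff bform_matrix_minus
        bform_matrix_scale bform_mmul_mtr[where X="?A"] bform_mmul[where X="mtr P2"]
        bform_mmul[where X="mtr P3"] bform_matrix_scale[where c="- e"]
        bform_add_right bform_diff_right bform_diff_left algebra_simps)
qed

definition exp_window :: "real \<Rightarrow> real \<Rightarrow> (real \<Rightarrow> real) \<Rightarrow> real \<Rightarrow> real" where
  "exp_window \<kappa> \<tau> h t = integral {t - \<tau>..t} (\<lambda>s. exp (- \<kappa> * (t - s)) * h s)"

definition exp_ramp_window :: "real \<Rightarrow> real \<Rightarrow> (real \<Rightarrow> real) \<Rightarrow> real \<Rightarrow> real" where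
  "exp_ramp_window \<kappa> \<tau> h t = exp_window \<kappa> \<tau> (\<lambda>s. (s - (t - \<tau>)) * h s) t"

lemma integrable_on_window:
  fixes h :: "real \<Rightarrow> real"
  shows "continuous_on {T..} h \<Longrightarrow> T \<le> t - \<tau> \<Longrightarrow> h integrable_on {t - \<tau>..t}"
  by (rule integrable_continuous_real) (auto intro: continuous_on_subset)

lemma DERIV_window_integral:
  fixes h :: "real \<Rightarrow> real"
  assumes cont: "continuous_on {T..} h" and "\<tau> \<ge> 0" "t > T + \<tau>"
  shows "((\<lambda>t. integral {t - \<tau>..t} h) has_real_derivative h t - h (t - \<tau>)) (at t)"
proof (rule has_field_derivative_transform_within_open[where S="{T + \<tau><..}"])
  have shift: "((\<lambda>s. s - \<tau>) has_real_derivative 1) (at t)" by (auto intro!: derivative_eq_intros)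
  have "((\<lambda>s. integral {T..s - \<tau>} h) has_real_derivative h (t - \<tau>) * 1) (at t)"
    by (rule DERIV_chain2[OF DERIV_integral_upper[OF cont] shift]) (use assms in simp)
  then show "((\<lambda>s. integral {T..s} h - integral {T..s - \<tau>} h) has_real_derivative h t - h (t - \<tau>)) (at t)"
    by (intro DERIV_diff DERIV_integral_upper[OF cont]) (use assms in auto)
  fix s assume s: "s \<in> {T + \<tau><..}"
  have "integral {T..s - \<tau>} h + integral {s - \<tau>..s} h = integral {T..s} h"
    by (rule Henstock_Kurzweil_Integration.integral_combine)
       (use s \<open>\<tau> \<ge> 0\<close> cont in \<open>auto intro!: integrable_continuous_real intro: continuous_on_subset\<close>)
  then show "integral {T..s} h - integral {T..s - \<tau>} h = integral {s - \<tau>..s} h" by simp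
qed (use assms in auto)

lemma exp_window_eq: "exp_window \<kappa> \<tau> h t = exp (- \<kappa> * t) * integral {t - \<tau>..t} (\<lambda>s. exp (\<kappa> * s) * h s)"
proof -
  have "exp (- \<kappa> * (t - s)) = exp (- \<kappa> * t) * exp (\<kappa> * s)" for s
    by (simp add: exp_add[symmetric] algebra_simps)
  then show ?thesis by (simp only: exp_window_def mult.assoc integral_mult_right)
qed

lemma DERIV_exp_window:
  assumes cont: "continuous_on {T..} h" and "\<tau> \<ge> 0" "t > T + \<tau>"
  shows "(exp_window \<kappa> \<tau> h has_real_derivative h t - exp (- \<kappa> * \<tau>) * h (t - \<tau>) - \<kappa> * exp_window \<kappa> \<tau> h t) (at t)"
proof -
  let ?H = "\<lambda>s. exp (\<kappa> * s) * h s"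
  have "((\<lambda>t. exp (- \<kappa> * t) * integral {t - \<tau>..t} ?H) has_real_derivative
      exp (- \<kappa> * t) * (?H t - ?H (t - \<tau>)) - \<kappa> * (exp (- \<kappa> * t) * integral {t - \<tau>..t} ?H)) (at t)"
    by (rule derivative_eq_intros DERIV_window_integral[where T=T] continuous_intros cont assms refl)+
       (simp add: algebra_simps)
  moreover have "exp (- \<kappa> * t) * (?H t - ?H (t - \<tau>)) = h t - exp (- \<kappa> * \<tau>) * h (t - \<tau>)"
    by (simp add: right_diff_distrib mult.assoc[symmetric] exp_add[symmetric])
  ultimately show ?thesis by (simp add: exp_window_eq[abs_def])
qed

lemma exp_ramp_window_eq:
  assumes cont: "continuous_on {T..} h" and "T \<le> t - \<tau>"
  shows "exp_ramp_window \<kappa> \<tau> h t = exp_window \<kappa> \<tau> (\<lambda>s. s * h s) t - (t - \<tau>) * exp_window \<kappa> \<tau> h t"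
proof -
  have "exp_ramp_window \<kappa> \<tau> h t
      = integral {t - \<tau>..t} (\<lambda>s. exp (- \<kappa> * (t - s)) * (s * h s) - (t - \<tau>) * (exp (- \<kappa> * (t - s)) * h s))"
    unfolding exp_ramp_window_def exp_window_def by (simp add: algebra_simps)
  also have "\<dots> = exp_window \<kappa> \<tau> (\<lambda>s. s * h s) t - (t - \<tau>) * exp_window \<kappa> \<tau> h t"
    unfolding exp_window_def integral_mult_right[symmetric]
    by (intro integral_diff integrable_on_window[where T=T] continuous_intros assms)
  finally show ?thesis .
qed

lemma DERIV_exp_ramp_window:
  assumes cont: "continuous_on {T..} h" and "\<tau> \<ge> 0" "t > T + \<tau>"
  shows "(exp_ramp_window \<kappa> \<tau> h has_real_derivative
    \<tau> * h t - exp_window \<kappa> \<tau> h t - \<kappa> * exp_ramp_window \<kappa> \<tau> h t) (at t)"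
proof (rule has_field_derivative_transform_within_open[where S="{T + \<tau><..}"])
  let ?W = "exp_window \<kappa> \<tau>"
  have "continuous_on {T..} (\<lambda>s. s * h s)" by (intro continuous_intros cont)
  from DERIV_diff[OF DERIV_exp_window[OF this assms(2,3)]
      DERIV_mult[OF DERIV_diff[OF DERIV_ident DERIV_const] DERIV_exp_window[OF assms]]]
  have "((\<lambda>t. ?W (\<lambda>s. s * h s) t - (t - \<tau>) * ?W h t) has_real_derivative
      \<tau> * h t - ?W h t - \<kappa> * (?W (\<lambda>s. s * h s) t - (t - \<tau>) * ?W h t)) (at t)"
    by (rule DERIV_cong) (simp add: algebra_simps)
  then show "((\<lambda>t. ?W (\<lambda>s. s * h s) t - (t - \<tau>) * ?W h t) has_real_derivative
      \<tau> * h t - ?W h t - \<kappa> * exp_ramp_window \<kappa> \<tau> h t) (at t)"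
    using assms by (simp add: exp_ramp_window_eq[OF cont])
qed (use assms in \<open>auto simp: exp_ramp_window_eq[OF cont]\<close>)

lemma exp_window_nonneg:
  assumes "\<And>s. s \<in> {t - \<tau>..t} \<Longrightarrow> h s \<ge> 0"
  shows "exp_window \<kappa> \<tau> h t \<ge> 0"
  unfolding exp_window_def
proof (cases "(\<lambda>s. exp (- \<kappa> * (t - s)) * h s) integrable_on {t - \<tau>..t}")
  case True
  then show "integral {t - \<tau>..t} (\<lambda>s. exp (- \<kappa> * (t - s)) * h s) \<ge> 0"
    by (rule integral_nonneg) (use assms in auto)
qed (simp add: not_integrable_integral)

lemma exp_ramp_window_nonneg:
  assumes "\<And>s. h s \<ge> 0"
  shows "exp_ramp_window \<kappa> \<tau> h t \<ge> 0"
  unfolding exp_ramp_window_def by (rule exp_window_nonneg) (use assms in auto)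

lemma exp_window_ge:
  assumes cont: "continuous_on {T..} h" and "T \<le> t - \<tau>" and "\<kappa> \<ge> 0" and nonneg: "\<And>s. h s \<ge> 0"
  shows "exp (- \<kappa> * \<tau>) * integral {t - \<tau>..t} h \<le> exp_window \<kappa> \<tau> h t"
  unfolding exp_window_def integral_mult_right[symmetric]
proof (rule integral_le)
  fix s assume "s \<in> {t - \<tau>..t}"
  then have "exp (- \<kappa> * \<tau>) \<le> exp (- \<kappa> * (t - s))" using \<open>\<kappa> \<ge> 0\<close> by (auto intro: mult_left_mono)
  then show "exp (- \<kappa> * \<tau>) * h s \<le> exp (- \<kappa> * (t - s)) * h s" using nonneg by (rule mult_right_mono)
qed (intro integrable_on_window[where T=T] continuous_intros assms)+

lemma bform_jensen:
  assumes R: "posdef m R" and "\<tau> > 0"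
    and cont: "\<And>i. i < m \<Longrightarrow> continuous_on {b - \<tau>..b} (v i)"
  shows "bform m R (\<lambda>i. integral {b - \<tau>..b} (v i)) (\<lambda>i. integral {b - \<tau>..b} (v i))
    \<le> \<tau> * integral {b - \<tau>..b} (\<lambda>s. bform m R (\<lambda>i. v i s) (\<lambda>i. v i s))"
proof -
  define w where "w i = integral {b - \<tau>..b} (v i)" for i
  let ?E = "\<lambda>s. bform m R (\<lambda>i. v i s) (\<lambda>i. v i s)" and ?q = "bform m R w w"
  have "(v i has_integral w i) {b - \<tau>..b}" if "i < m" for i
    unfolding w_def using cont[OF that] by (intro integrable_integral integrable_continuous_real)
  then have "((\<lambda>s. bform m R w (\<lambda>i. v i s)) has_integral ?q) {b - \<tau>..b}"
    unfolding bform_def by (intro has_integral_sum has_integral_mult_right) auto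
  moreover have "?E integrable_on {b - \<tau>..b}"
    unfolding bform_def by (intro integrable_continuous_real continuous_intros cont) auto
  moreover have "((\<lambda>s. ?q / \<tau>\<^sup>2) has_integral \<tau> * (?q / \<tau>\<^sup>2)) {b - \<tau>..b}"
    using has_integral_const_real[of "?q / \<tau>\<^sup>2" "b - \<tau>" b] \<open>\<tau> > 0\<close> by simp
  ultimately have "((\<lambda>s. ?E s - 2 / \<tau> * bform m R w (\<lambda>i. v i s) + ?q / \<tau>\<^sup>2) has_integral
      (integral {b - \<tau>..b} ?E - 2 / \<tau> * ?q + \<tau> * (?q / \<tau>\<^sup>2))) {b - \<tau>..b}"
    by (intro has_integral_add has_integral_diff has_integral_mult_right integrable_integral)
  then have "0 \<le> integral {b - \<tau>..b} ?E - 2 / \<tau> * ?q + \<tau> * (?q / \<tau>\<^sup>2)"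
  proof (rule has_integral_nonneg)
    fix s
    have "0 \<le> bform m R (\<lambda>i. v i s - 1 / \<tau> * w i) (\<lambda>i. v i s - 1 / \<tau> * w i)"
      by (rule posdef_bform_nonneg[OF R])
    also have "\<dots> = ?E s - 2 / \<tau> * bform m R w (\<lambda>i. v i s) + ?q / \<tau>\<^sup>2"
      unfolding bform_diff_left bform_diff_right bform_scale_left bform_scale_right
      using posdef_bform_commute[OF R, of w "\<lambda>i. v i s"] \<open>\<tau> > 0\<close>
      by (simp add: field_simps power2_eq_square)
    finally show "0 \<le> ?E s - 2 / \<tau> * bform m R w (\<lambda>i. v i s) + ?q / \<tau>\<^sup>2" .
  qed
  then show ?thesis
    unfolding w_def[symmetric] using \<open>\<tau> > 0\<close> by (simp add: power2_eq_square field_simps)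
qed

locale delay_lmi =
  fixes a \<delta> \<tau> :: real and N :: nat and k :: "nat \<Rightarrow> real" and P1 P2 P3 S R :: "nat \<Rightarrow> nat \<Rightarrow> real"
  assumes P1: "posdef (N + 1) P1" and S: "posdef (N + 1) S" and R: "posdef (N + 1) R"
    and Phi_neg: "negdef (3 * (N + 1)) (Phi a N k \<delta> \<tau> P1 P2 P3 S R)"
    and \<delta>_pos: "\<delta> > 0" and \<tau>_pos: "\<tau> > 0"
begin

definition delay_rhs :: "(nat \<Rightarrow> real) \<Rightarrow> (nat \<Rightarrow> real) \<Rightarrow> nat \<Rightarrow> real" where
  "delay_rhs x z i = mvec (N + 1) (Amat a) x i + mvec (N + 1) (\<lambda>i j. Bvec i * k j) z i"

definition dissipation :: "(nat \<Rightarrow> real) \<Rightarrow> (nat \<Rightarrow> real) \<Rightarrow> (nat \<Rightarrow> real) \<Rightarrow> real" where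
  "dissipation x y z = 2 * bform (N + 1) P1 x y + 2 * \<delta> * bform (N + 1) P1 x x + bform (N + 1) S x x
    + \<tau>\<^sup>2 * bform (N + 1) R y y - exp (- 2 * \<delta> * \<tau>) * bform (N + 1) S z z
    - exp (- 2 * \<delta> * \<tau>) * bform (N + 1) R (\<lambda>i. x i - z i) (\<lambda>i. x i - z i)"

lemma dissipation_le:
  obtains C where "C \<ge> 0"
    "\<And>x y z g. (\<And>i. i < N + 1 \<Longrightarrow> y i = delay_rhs x z i + g i) \<Longrightarrow> dissipation x y z \<le> C * sqnorm (N + 1) g"
proof -
  define m where "m = N + 1"
  obtain \<kappa> where \<kappa>: "\<kappa> > 0"
    "\<And>v. \<kappa> * sqnorm (3 * m) v \<le> - bform (3 * m) (Phi a N k \<delta> \<tau> P1 P2 P3 S R) v v"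
    using posdef_coercive[OF Phi_neg[unfolded negdef_def]] unfolding bform_matrix_minus m_def by blast
  obtain C2 where young_P2: "C2 \<ge> 0" "\<And>x y. 2 * bform m (mtr P2) x y \<le> \<kappa> * sqnorm m x + C2 * sqnorm m y"
    by (rule bform_young[OF \<kappa>(1)]) blast
  obtain C3 where young_P3: "C3 \<ge> 0" "\<And>x y. 2 * bform m (mtr P3) x y \<le> \<kappa> * sqnorm m x + C3 * sqnorm m y"
    by (rule bform_young[OF \<kappa>(1)]) blast
  show thesis
  proof (rule that[of "C2 + C3"])
    fix x y z g :: "nat \<Rightarrow> real" assume y: "\<And>i. i < N + 1 \<Longrightarrow> y i = delay_rhs x z i + g i"
    let ?v = "stack m ((!) [x, y, z])"
    have residual: "bform m P u (\<lambda>i. mvec m (Amat a) x i + mvec m (\<lambda>i j. Bvec i * k j) z i - y i)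
        = - bform m P u g" for P u
    proof -
      have "bform m P u (\<lambda>i. mvec m (Amat a) x i + mvec m (\<lambda>i j. Bvec i * k j) z i - y i)
          = bform m P u (\<lambda>i. - 1 * g i)"
        by (rule bform_cong) (simp_all add: m_def y delay_rhs_def)
      then show ?thesis by (simp only: bform_scale_right)
    qed
    have "\<kappa> * (sqnorm m x + sqnorm m y + sqnorm m z) \<le> - bform (3 * m) (Phi a N k \<delta> \<tau> P1 P2 P3 S R) ?v ?v"
      using \<kappa>(2)[of ?v] unfolding sqnorm_stack by (simp add: eval_nat_numeral)
    moreover have "0 \<le> \<kappa> * sqnorm m z" using \<kappa>(1) by simp
    ultimately show "dissipation x y z \<le> (C2 + C3) * sqnorm (N + 1) g"
      unfolding dissipation_def m_def[symmetric] bform_Phi[OF R, folded m_def] residual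
      using young_P2(2)[of x g] young_P3(2)[of y g] by (simp add: distrib_left distrib_right)
  qed (use young_P2(1) young_P3(1) in simp)
qed

end

locale delay_system = delay_lmi +
  fixes X X' g :: "nat \<Rightarrow> real \<Rightarrow> real" and T :: real
  assumes X: "\<And>i t. i < N + 1 \<Longrightarrow> t \<ge> T \<Longrightarrow> (X i has_real_derivative X' i t) (at t)"
    and X': "\<And>i t. i < N + 1 \<Longrightarrow> t \<ge> T \<Longrightarrow> X' i t = delay_rhs (\<lambda>j. X j t) (\<lambda>j. X j (t - \<tau>)) i + g i t"
    and cont_X': "\<And>i. i < N + 1 \<Longrightarrow> continuous_on {T..} (X' i)"
    and g: "\<And>i. i < N + 1 \<Longrightarrow> expdecay (g i)"
begin

definition state_energy :: "real \<Rightarrow> real" where "state_energy s = bform (N + 1) S (\<lambda>i. X i s) (\<lambda>i. X i s)"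

definition rate_energy :: "real \<Rightarrow> real" where "rate_energy s = bform (N + 1) R (\<lambda>i. X' i s) (\<lambda>i. X' i s)"

definition krasovskii :: "real \<Rightarrow> real" where
  "krasovskii t = bform (N + 1) P1 (\<lambda>i. X i t) (\<lambda>i. X i t)
    + exp_window (2 * \<delta>) \<tau> state_energy t + \<tau> * exp_ramp_window (2 * \<delta>) \<tau> rate_energy t"

definition krasovskii' :: "real \<Rightarrow> real" where
  "krasovskii' t = 2 * bform (N + 1) P1 (\<lambda>i. X i t) (\<lambda>i. X' i t)
    + (state_energy t - exp (- (2 * \<delta>) * \<tau>) * state_energy (t - \<tau>) - 2 * \<delta> * exp_window (2 * \<delta>) \<tau> state_energy t)
    + \<tau> * (\<tau> * rate_energy t - exp_window (2 * \<delta>) \<tau> rate_energy t - 2 * \<delta> * exp_ramp_window (2 * \<delta>) \<tau> rate_energy t)"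

lemma continuous_on_state_energy: "continuous_on {T..} state_energy"
  unfolding state_energy_def bform_def
  by (intro continuous_intros DERIV_continuous_on[OF has_field_derivative_at_within[OF X]]) auto

lemma continuous_on_rate_energy: "continuous_on {T..} rate_energy"
  unfolding rate_energy_def bform_def by (intro continuous_intros cont_X') auto

lemma state_energy_nonneg: "state_energy s \<ge> 0"
  unfolding state_energy_def by (rule posdef_bform_nonneg[OF S])

lemma rate_energy_nonneg: "rate_energy s \<ge> 0"
  unfolding rate_energy_def by (rule posdef_bform_nonneg[OF R])

lemma krasovskii_ge: "bform (N + 1) P1 (\<lambda>i. X i t) (\<lambda>i. X i t) \<le> krasovskii t"
  using exp_window_nonneg[of t \<tau> state_energy "2 * \<delta>"] exp_ramp_window_nonneg[of rate_energy "2 * \<delta>" \<tau> t]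
    state_energy_nonneg rate_energy_nonneg \<tau>_pos
  by (simp add: krasovskii_def)

lemma DERIV_krasovskii:
  assumes "t > T + \<tau>"
  shows "(krasovskii has_real_derivative krasovskii' t) (at t)"
  unfolding krasovskii_def[abs_def] krasovskii'_def
  using assms \<tau>_pos
  by (intro DERIV_add DERIV_cmult has_real_derivative_posdef_bform[OF P1] X
      DERIV_exp_window[OF continuous_on_state_energy] DERIV_exp_ramp_window[OF continuous_on_rate_energy]) auto

lemma jensen_increment:
  assumes "t \<ge> T + \<tau>"
  shows "exp (- (2 * \<delta>) * \<tau>) * bform (N + 1) R (\<lambda>i. X i t - X i (t - \<tau>)) (\<lambda>i. X i t - X i (t - \<tau>))
    \<le> \<tau> * exp_window (2 * \<delta>) \<tau> rate_energy t"
proof -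
  have incr: "integral {t - \<tau>..t} (X' i) = X i t - X i (t - \<tau>)" if "i < N + 1" for i
  proof (rule integral_unique, rule fundamental_theorem_of_calculus)
    fix s assume "s \<in> {t - \<tau>..t}"
    then show "(X i has_vector_derivative X' i s) (at s within {t - \<tau>..t})"
      using X[OF that, of s] assms
      by (simp add: has_real_derivative_iff_has_vector_derivative has_vector_derivative_at_within)
  qed (use \<tau>_pos in simp)
  have "bform (N + 1) R (\<lambda>i. X i t - X i (t - \<tau>)) (\<lambda>i. X i t - X i (t - \<tau>))
      = bform (N + 1) R (\<lambda>i. integral {t - \<tau>..t} (X' i)) (\<lambda>i. integral {t - \<tau>..t} (X' i))"
    by (rule bform_cong) (simp_all add: incr)
  also have "\<dots> \<le> \<tau> * integral {t - \<tau>..t} rate_energy"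
    unfolding rate_energy_def
    by (rule bform_jensen[OF R \<tau>_pos]) (use assms in \<open>auto intro: continuous_on_subset[OF cont_X']\<close>)
  finally have "exp (- (2 * \<delta>) * \<tau>) * bform (N + 1) R (\<lambda>i. X i t - X i (t - \<tau>)) (\<lambda>i. X i t - X i (t - \<tau>))
      \<le> \<tau> * (exp (- (2 * \<delta>) * \<tau>) * integral {t - \<tau>..t} rate_energy)"
    by (simp add: mult.left_commute)
  also have "\<dots> \<le> \<tau> * exp_window (2 * \<delta>) \<tau> rate_energy t"
    using exp_window_ge[OF continuous_on_rate_energy, of t \<tau> "2 * \<delta>"] assms \<delta>_pos \<tau>_pos rate_energy_nonneg by simp
  finally show ?thesis .
qed

lemma expdecay_krasovskii: "expdecay krasovskii"
proof -
  obtain C where C: "C \<ge> 0"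
    "\<And>x y z g. (\<And>i. i < N + 1 \<Longrightarrow> y i = delay_rhs x z i + g i) \<Longrightarrow> dissipation x y z \<le> C * sqnorm (N + 1) g"
    by (rule dissipation_le) blast
  show ?thesis
  proof (rule lyapunov_expdecay[of "T + \<tau> + 1" _ krasovskii' "2 * \<delta>" "\<lambda>t. C * sqnorm (N + 1) (\<lambda>i. g i t)"])
    fix t assume t: "t \<ge> T + \<tau> + 1"
    show "(krasovskii has_real_derivative krasovskii' t) (at t)" by (rule DERIV_krasovskii) (use t in simp)
    show "krasovskii' t \<le> - (2 * \<delta>) * krasovskii t + C * sqnorm (N + 1) (\<lambda>i. g i t)"
      using C(2)[of "\<lambda>i. X' i t" "\<lambda>i. X i t" "\<lambda>i. X i (t - \<tau>)" "\<lambda>i. g i t"] X'[of _ t]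
        jensen_increment[of t] t \<tau>_pos
      unfolding dissipation_def krasovskii_def krasovskii'_def state_energy_def rate_energy_def
      by (simp add: algebra_simps power2_eq_square)
    show "krasovskii t \<ge> 0" using krasovskii_ge[of t] posdef_bform_nonneg[OF P1] by (rule order_trans[rotated])
  qed (use \<delta>_pos in \<open>auto intro!: expdecay_cmult expdecay_sqnorm g\<close>)
qed

lemma state_expdecay:
  assumes "i < N + 1"
  shows "expdecay (X i)"
proof (rule expdecay_of_square[OF _ expdecay_krasovskii])
  obtain c where c: "\<And>x. (x i)\<^sup>2 \<le> c * bform (N + 1) P1 x x"
    by (rule square_le_posdef_bform[OF P1]) (use assms in blast)
  show "(\<lambda>t. (X i t)\<^sup>2) \<in> O(krasovskii)"
  proof (rule bigo_geI)
    fix t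
    have "(X i t)\<^sup>2 \<le> c * bform (N + 1) P1 (\<lambda>i. X i t) (\<lambda>i. X i t)" by (rule c)
    also have "\<dots> \<le> \<bar>c\<bar> * \<bar>krasovskii t\<bar>"
      using krasovskii_ge[of t] posdef_bform_nonneg[OF P1, of "\<lambda>i. X i t"] by (intro mult_mono) auto
    finally show "\<bar>(X i t)\<^sup>2\<bar> \<le> \<bar>c\<bar> * \<bar>krasovskii t\<bar>" by simp
  qed
qed

end

section \<open>The adaptive observer\<close>

locale oscillator =
  fixes \<theta> T :: real and u v :: "real \<Rightarrow> real"
  assumes \<theta>_pos: "\<theta> > 0"
    and DERIV_u: "\<And>t. t \<ge> T \<Longrightarrow> (u has_real_derivative v t) (at t)"
    and DERIV_v: "\<And>t. t \<ge> T \<Longrightarrow> (v has_real_derivative - \<theta> * u t) (at t)"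
begin

definition energy :: real where
  "energy = (v T)\<^sup>2 + \<theta> * (u T)\<^sup>2"

lemma energy_conserved:
  assumes "t \<ge> T"
  shows "(v t)\<^sup>2 + \<theta> * (u t)\<^sup>2 = energy"
proof -
  have "((\<lambda>t. (v t)\<^sup>2 + \<theta> * (u t)\<^sup>2) has_real_derivative 0) (at s)" if "s \<ge> T" for s
    using DERIV_u[OF that] DERIV_v[OF that] by (auto intro!: derivative_eq_intros simp: algebra_simps)
  then have "\<exists>c. \<forall>s\<in>{T..}. (v s)\<^sup>2 + \<theta> * (u s)\<^sup>2 = c"
    by (intro has_field_derivative_zero_constant convex_real_interval) (auto intro: has_field_derivative_at_within)
  then show ?thesis using assms by (auto simp: energy_def)
qed

lemma energy_nonneg: "energy \<ge> 0"
  using \<theta>_pos by (simp add: energy_def)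

lemma square_le_energy:
  assumes "t \<ge> T"
  shows "\<theta> * (u t)\<^sup>2 \<le> energy" "(v t)\<^sup>2 \<le> energy"
proof -
  have "0 \<le> \<theta> * (u t)\<^sup>2" using \<theta>_pos by simp
  then show "\<theta> * (u t)\<^sup>2 \<le> energy" "(v t)\<^sup>2 \<le> energy"
    using energy_conserved[OF assms] zero_le_power2[of "v t"] by linarith+
qed

lemma vanishes_if_energy_0: "energy = 0 \<Longrightarrow> t \<ge> T \<Longrightarrow> u t = 0 \<and> v t = 0"
  using square_le_energy[of t] \<theta>_pos by (auto simp: mult_le_0_iff)

lemma bounded: "u \<in> O(\<lambda>_. 1)" "v \<in> O(\<lambda>_. 1)"
proof -
  have "(\<lambda>t. (u t)\<^sup>2) \<in> O(\<lambda>_. 1)"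
    by (rule bigo_geI[of T _ "energy / \<theta>"]) (use square_le_energy(1) \<theta>_pos in \<open>auto simp: field_simps\<close>)
  then show "u \<in> O(\<lambda>_. 1)" by (rule bigo_1_of_square)
  have "(\<lambda>t. (v t)\<^sup>2) \<in> O(\<lambda>_. 1)"
    by (rule bigo_geI[of T _ energy]) (use square_le_energy(2) in auto)
  then show "v \<in> O(\<lambda>_. 1)" by (rule bigo_1_of_square)
qed

end

lemma DERIV_gradient_energy:
  fixes e q :: "real \<Rightarrow> real"
  assumes "(e has_real_derivative - \<mu>0 * e t + s * q t + r1) (at t)"
    and "(q has_real_derivative - \<mu>1 * s * e t + r2) (at t)" and "\<mu>1 > 0"
  shows "((\<lambda>t. (e t)\<^sup>2 + (q t)\<^sup>2 / \<mu>1) has_real_derivative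
    - 2 * \<mu>0 * (e t)\<^sup>2 + (2 * (r1 * e t) + 2 / \<mu>1 * (r2 * q t))) (at t)"
  using assms by (auto intro!: derivative_eq_intros simp: field_simps power2_eq_square)

lemma lyapunov_equivalent_expdecay:
  fixes n W :: "real \<Rightarrow> real"
  assumes "\<kappa> > 0" "K > 0" "c > 0"
    and W: "\<And>t. t \<ge> T \<Longrightarrow> (W has_real_derivative W' t) (at t)"
    and W_ge: "\<And>t. t \<ge> T \<Longrightarrow> \<kappa> * n t \<le> W t" and W_le: "\<And>t. t \<ge> T \<Longrightarrow> W t \<le> K * n t"
    and W'_le: "\<And>t. t \<ge> T \<Longrightarrow> W' t \<le> - (c * n t) + g t"
    and g: "expdecay g" and n: "\<And>t. n t \<ge> 0"
  shows "expdecay n"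
proof -
  have "expdecay W"
  proof (rule lyapunov_expdecay[OF W _ _ _ g])
    show "c / K > 0" using assms(2,3) by simp
    fix t assume t: "t \<ge> T"
    have "c / K * W t \<le> c * n t"
      using mult_left_mono[OF W_le[OF t], of "c / K"] assms(2,3) by simp
    then show "W' t \<le> - (c / K) * W t + g t" using W'_le[OF t] by simp
    have "0 \<le> \<kappa> * n t" using n assms(1) by simp
    also have "\<dots> \<le> W t" by (rule W_ge[OF t])
    finally show "W t \<ge> 0" .
  qed
  then show ?thesis
  proof (rule expdecay_bigo[OF bigo_geI, rotated])
    fix t assume "t \<ge> T"
    then have "\<kappa> * n t \<le> \<bar>W t\<bar>" by (rule order_trans[OF W_ge abs_ge_self])
    then show "\<bar>n t\<bar> \<le> 1 / \<kappa> * \<bar>W t\<bar>" using n assms(1) by (simp add: field_simps)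
  qed
qed

text \<open>When \<open>E\<close> only dissipates \<open>e\<close>, subtracting a small multiple of a function \<open>X\<close> that grows with \<open>q\<close>
  makes it dissipate both.\<close>
lemma auxiliary_lyapunov_expdecay:
  fixes e q E X :: "real \<Rightarrow> real"
  assumes "\<kappa> > 0" "\<alpha> > 0" "\<beta> > 0" "\<gamma> \<ge> 0" "D \<ge> 0" "K \<ge> 0"
    and dE: "\<And>t. t \<ge> T \<Longrightarrow> (E has_real_derivative E' t) (at t)"
    and dX: "\<And>t. t \<ge> T \<Longrightarrow> (X has_real_derivative X' t) (at t)"
    and E_ge: "\<And>t. t \<ge> T \<Longrightarrow> \<kappa> * ((e t)\<^sup>2 + (q t)\<^sup>2) \<le> E t"
    and E_le: "\<And>t. t \<ge> T \<Longrightarrow> E t \<le> K * ((e t)\<^sup>2 + (q t)\<^sup>2)"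
    and X_le: "\<And>t. t \<ge> T \<Longrightarrow> \<bar>X t\<bar> \<le> D * ((e t)\<^sup>2 + (q t)\<^sup>2)"
    and E'_le: "\<And>t. t \<ge> T \<Longrightarrow> E' t \<le> - \<alpha> * (e t)\<^sup>2 + g t"
    and X'_ge: "\<And>t. t \<ge> T \<Longrightarrow> X' t \<ge> \<beta> * (q t)\<^sup>2 - \<gamma> * (e t)\<^sup>2 - h t"
    and g: "expdecay g" and h: "expdecay h"
  shows "expdecay (\<lambda>t. (e t)\<^sup>2 + (q t)\<^sup>2)"
proof -
  define \<epsilon> where "\<epsilon> = min (\<alpha> / (2 * (\<gamma> + 1))) (\<kappa> / (2 * (D + 1)))"
  have \<epsilon>: "\<epsilon> > 0" using assms(1-5) by (simp add: \<epsilon>_def)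
  have "\<epsilon> * (2 * (\<gamma> + 1)) \<le> \<alpha>" "\<epsilon> * (2 * (D + 1)) \<le> \<kappa>"
    using assms(4,5) by (simp_all add: \<epsilon>_def min_le_iff_disj flip: pos_le_divide_eq)
  then have \<epsilon>_small: "\<epsilon> * \<gamma> \<le> \<alpha> / 2" "\<epsilon> * D \<le> \<kappa> / 2" using \<epsilon> by (simp_all add: algebra_simps)
  define n where "n t = (e t)\<^sup>2 + (q t)\<^sup>2" for t
  define W where "W t = E t - \<epsilon> * X t" for t
  define c where "c = min (\<alpha> / 2) (\<epsilon> * \<beta>)"
  have c: "c > 0" "c \<le> \<alpha> / 2" "c \<le> \<epsilon> * \<beta>" using assms(2,3) \<epsilon> by (auto simp: c_def)
  have n: "n t \<ge> 0" "(e t)\<^sup>2 \<le> n t" "(q t)\<^sup>2 \<le> n t" for t by (simp_all add: n_def)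
  have \<epsilon>X: "\<bar>\<epsilon> * X t\<bar> \<le> \<kappa> / 2 * n t" if "t \<ge> T" for t
  proof -
    have "\<bar>\<epsilon> * X t\<bar> \<le> \<epsilon> * D * n t"
      using mult_left_mono[OF X_le[OF that], of \<epsilon>] \<epsilon> by (simp add: abs_mult n_def mult.assoc)
    also have "\<dots> \<le> \<kappa> / 2 * n t" using \<epsilon>_small(2) n by (intro mult_right_mono)
    finally show ?thesis .
  qed
  have W_ge: "\<kappa> / 2 * n t \<le> W t" and W_le: "W t \<le> (K + \<kappa> / 2) * n t" if "t \<ge> T" for t
    using \<epsilon>X[OF that] E_ge[OF that] E_le[OF that] unfolding W_def n_def[symmetric] distrib_right by linarith+
  have "expdecay n"
  proof (rule lyapunov_equivalent_expdecay[where W=W and g="\<lambda>t. g t + \<epsilon> * h t", OF _ _ c(1) _ W_ge W_le])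
    fix t assume t: "t \<ge> T"
    show "(W has_real_derivative E' t - \<epsilon> * X' t) (at t)"
      unfolding W_def by (intro DERIV_diff DERIV_cmult dE dX t)
    have "E' t - \<epsilon> * X' t \<le> - \<alpha> * (e t)\<^sup>2 + g t - \<epsilon> * (\<beta> * (q t)\<^sup>2 - \<gamma> * (e t)\<^sup>2 - h t)"
      using E'_le[OF t] mult_left_mono[OF X'_ge[OF t], of \<epsilon>] \<epsilon> by linarith
    also have "\<dots> \<le> - (\<alpha> / 2 * (e t)\<^sup>2 + \<epsilon> * \<beta> * (q t)\<^sup>2) + (g t + \<epsilon> * h t)"
      using mult_right_mono[OF \<epsilon>_small(1), of "(e t)\<^sup>2"] by (simp add: algebra_simps)
    also have "\<dots> \<le> - (c * n t) + (g t + \<epsilon> * h t)"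
      using mult_right_mono[OF c(2), of "(e t)\<^sup>2"] mult_right_mono[OF c(3), of "(q t)\<^sup>2"]
      by (simp add: n_def distrib_left)
    finally show "E' t - \<epsilon> * X' t \<le> - (c * n t) + (g t + \<epsilon> * h t)" .
  qed (use assms(1,6) n(1) g h in \<open>auto intro!: expdecay_add expdecay_cmult\<close>)
  then show ?thesis by (simp add: n_def[abs_def])
qed

lemma cross_term_ge:
  fixes c k x y A :: real
  assumes "c > 0" "\<bar>k\<bar> \<le> A"
  shows "- (c / 2 * y\<^sup>2 + A\<^sup>2 / (2 * c) * x\<^sup>2) \<le> k * (x * y)"
proof -
  have "\<bar>k * (x * y)\<bar> \<le> A * (\<bar>x\<bar> * \<bar>y\<bar>)"
    unfolding abs_mult using assms(2) by (intro mult_right_mono) auto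
  moreover have "0 \<le> (c * \<bar>y\<bar> - A * \<bar>x\<bar>)\<^sup>2 / (2 * c)" using assms(1) by simp
  then have "A * (\<bar>x\<bar> * \<bar>y\<bar>) \<le> c / 2 * y\<^sup>2 + A\<^sup>2 / (2 * c) * x\<^sup>2"
    using assms(1) by (simp add: power2_diff power_mult_distrib) (simp add: field_simps power2_eq_square)
  ultimately show ?thesis by linarith
qed

lemma expdecay_of_sum_squares:
  assumes "expdecay (\<lambda>t. (x t)\<^sup>2 + (y t)\<^sup>2)"
  shows "expdecay x" "expdecay y"
  by (rule expdecay_of_square[OF bigo_geI[of 0 _ 1] assms]; simp)+

locale excited_error_system = oscillator \<theta> T s s' for \<theta> T s s' +
  fixes \<mu>0 \<mu>1 :: real and e q \<rho>1 \<rho>2 :: "real \<Rightarrow> real"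
  assumes \<mu>0_pos: "\<mu>0 > 0" and \<mu>1_pos: "\<mu>1 > 0" and excited: "energy > 0"
    and DERIV_e: "\<And>t. t \<ge> T \<Longrightarrow> (e has_real_derivative - \<mu>0 * e t + s t * q t + \<rho>1 t) (at t)"
    and DERIV_q: "\<And>t. t \<ge> T \<Longrightarrow> (q has_real_derivative - \<mu>1 * s t * e t + \<rho>2 t) (at t)"
    and \<rho>1: "expdecay \<rho>1" and \<rho>2: "expdecay \<rho>2"
    and e_bounded: "e \<in> O(\<lambda>_. 1)" and q_bounded: "q \<in> O(\<lambda>_. 1)"
begin

text \<open>Since \<open>s\<^sup>2 + (s s')' / (2 \<theta>)\<close> is the positive constant \<open>energy / (2 \<theta>)\<close>, the derivative of the
  following function is positive definite in \<open>q\<close>.\<close>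
definition excitation :: "real \<Rightarrow> real" where
  "excitation t = s t * e t * q t + s t * s' t * (q t)\<^sup>2 / (2 * \<theta>)"

definition cross_coeff :: "real \<Rightarrow> real" where
  "cross_coeff t = s' t - \<mu>0 * s t - \<mu>1 / \<theta> * (s t)\<^sup>2 * s' t"

definition perturbation :: "real \<Rightarrow> real" where
  "perturbation t = \<rho>1 t * (s t * q t) + \<rho>2 t * (s t * e t + s t * s' t * q t / \<theta>)"

definition excitation_rate :: "real \<Rightarrow> real" where
  "excitation_rate t = energy / (2 * \<theta>) * (q t)\<^sup>2 + cross_coeff t * (e t * q t)
    - \<mu>1 * (s t)\<^sup>2 * (e t)\<^sup>2 + perturbation t"

lemma DERIV_excitation:
  assumes "t \<ge> T"
  shows "(excitation has_real_derivative excitation_rate t) (at t)"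
proof -
  define h where "h = 1 / (2 * \<theta>)"
  have h: "2 * \<theta> * h = 1" and divide_\<theta>: "x / \<theta> = 2 * h * x" "x / (2 * \<theta>) = h * x" for x
    using \<theta>_pos by (simp_all add: h_def)
  let ?e' = "- \<mu>0 * e t + s t * q t + \<rho>1 t" and ?q' = "- \<mu>1 * s t * e t + \<rho>2 t"
  have "(excitation has_real_derivative (s' t * e t + s t * ?e') * q t + s t * e t * ?q'
      + h * ((s' t * s' t + s t * (- \<theta> * s t)) * (q t)\<^sup>2 + s t * s' t * (2 * q t * ?q'))) (at t)"
    unfolding excitation_def[abs_def] divide_\<theta>
    by (rule derivative_eq_intros DERIV_u[OF assms] DERIV_v[OF assms] DERIV_e[OF assms] DERIV_q[OF assms] refl)+
       (simp add: algebra_simps)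
  moreover have "(s' t * e t + s t * ?e') * q t + s t * e t * ?q'
      + h * ((s' t * s' t + s t * (- \<theta> * s t)) * (q t)\<^sup>2 + s t * s' t * (2 * q t * ?q'))
    = excitation_rate t"
    unfolding excitation_rate_def cross_coeff_def perturbation_def energy_conserved[OF assms, symmetric] divide_\<theta>
    using h by algebra
  ultimately show ?thesis by simp
qed

lemma expdecay_perturbation: "expdecay perturbation"
proof -
  note mult_bounded = landau_o.big.mult_in_1
  have "(\<lambda>t. s t * e t + s t * s' t * q t / \<theta>) \<in> O(\<lambda>_. 1)"
    using sum_in_bigo(1)[OF mult_bounded[OF bounded(1) e_bounded]
        mult_bounded[OF mult_bounded[OF bounded] mult_bounded[OF q_bounded bigo_const[of "1 / \<theta>"]]]]
    by simp
  then show ?thesis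
    unfolding perturbation_def[abs_def]
    by (intro expdecay_add expdecay_mult_bounded[OF \<rho>1] expdecay_mult_bounded[OF \<rho>2]
        mult_bounded[OF bounded(1) q_bounded])
qed

lemma excitation_bounded_by_square:
  assumes "\<bar>s t\<bar> \<le> B" "\<bar>s' t\<bar> \<le> B"
  shows "\<bar>excitation t\<bar> \<le> (B + B * B / (2 * \<theta>)) * ((e t)\<^sup>2 + (q t)\<^sup>2)"
proof -
  have B: "B \<ge> 0" using assms(1) by linarith
  have "2 * (\<bar>e t\<bar> * \<bar>q t\<bar>) \<le> (e t)\<^sup>2 + (q t)\<^sup>2"
    using sum_squares_bound[of "\<bar>e t\<bar>" "\<bar>q t\<bar>"] by simp
  moreover have "0 \<le> \<bar>e t\<bar> * \<bar>q t\<bar>" by simp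
  ultimately have "\<bar>e t\<bar> * \<bar>q t\<bar> \<le> (e t)\<^sup>2 + (q t)\<^sup>2" by linarith
  then have "\<bar>s t\<bar> * (\<bar>e t\<bar> * \<bar>q t\<bar>) \<le> B * ((e t)\<^sup>2 + (q t)\<^sup>2)"
    using assms(1) B by (intro mult_mono) auto
  moreover have "\<bar>s t\<bar> * \<bar>s' t\<bar> * (q t)\<^sup>2 / (2 * \<theta>) \<le> B * B * ((e t)\<^sup>2 + (q t)\<^sup>2) / (2 * \<theta>)"
    using assms B \<theta>_pos by (intro divide_right_mono mult_mono) auto
  moreover have "\<bar>excitation t\<bar> \<le> \<bar>s t\<bar> * (\<bar>e t\<bar> * \<bar>q t\<bar>) + \<bar>s t\<bar> * \<bar>s' t\<bar> * (q t)\<^sup>2 / (2 * \<theta>)"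
    using abs_triangle_ineq[of "s t * e t * q t" "s t * s' t * (q t)\<^sup>2 / (2 * \<theta>)"] \<theta>_pos
    by (simp add: excitation_def abs_mult mult.assoc)
  ultimately show ?thesis by (simp add: distrib_right)
qed

lemma excitation_rate_ge:
  assumes "\<bar>cross_coeff t\<bar> \<le> A" "\<bar>s t\<bar> \<le> B"
  shows "energy / (4 * \<theta>) * (q t)\<^sup>2 - (A\<^sup>2 * \<theta> / energy + \<mu>1 * B\<^sup>2) * (e t)\<^sup>2 + perturbation t \<le> excitation_rate t"
proof -
  define c where "c = energy / (2 * \<theta>)"
  have c: "c > 0" "energy / (4 * \<theta>) = c / 2" "A\<^sup>2 * \<theta> / energy = A\<^sup>2 / (2 * c)"
    using excited \<theta>_pos by (auto simp: c_def)
  have "\<mu>1 * (s t)\<^sup>2 * (e t)\<^sup>2 \<le> \<mu>1 * B\<^sup>2 * (e t)\<^sup>2"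
    using assms(2) \<mu>1_pos by (intro mult_right_mono mult_left_mono) (auto simp: abs_le_square_iff[symmetric])
  then show ?thesis
    unfolding excitation_rate_def c(2,3) c_def[symmetric]
    using cross_term_ge[OF c(1) assms(1), of "q t" "e t"] by (simp add: distrib_right field_simps)
qed

lemma error_expdecay: "expdecay e" "expdecay q"
proof -
  have "cross_coeff \<in> O(\<lambda>_. 1)"
    unfolding cross_coeff_def[abs_def] power2_eq_square
    by (intro sum_in_bigo(2) landau_o.big.mult_in_1 bounded bigo_const)
  then obtain A Ta where A: "Ta \<ge> T" "\<And>t. t \<ge> Ta \<Longrightarrow> \<bar>cross_coeff t\<bar> \<le> A"
    by (rule bigo_const_1E[where Tmin=T]) blast
  have "(\<lambda>t. \<bar>s t\<bar> + \<bar>s' t\<bar>) \<in> O(\<lambda>_. 1)" using bounded by (intro sum_in_bigo(1)) simp_all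
  then obtain B Tb where Tb: "Tb \<ge> Ta" "\<And>t. t \<ge> Tb \<Longrightarrow> \<bar>\<bar>s t\<bar> + \<bar>s' t\<bar>\<bar> \<le> B"
    by (rule bigo_const_1E[where Tmin=Ta]) blast
  then have B: "\<bar>s t\<bar> \<le> B" "\<bar>s' t\<bar> \<le> B" if "t \<ge> Tb" for t using that by force+
  let ?E = "\<lambda>t. (e t)\<^sup>2 + (q t)\<^sup>2 / \<mu>1"
    and ?g = "\<lambda>t. 2 * (\<rho>1 t * e t) + 2 / \<mu>1 * (\<rho>2 t * q t)"
  have "expdecay (\<lambda>t. (e t)\<^sup>2 + (q t)\<^sup>2)"
  proof (rule auxiliary_lyapunov_expdecay[where E="?E" and X=excitation and T=Tb and g="?g"
        and h="\<lambda>t. - perturbation t" and \<kappa>="min 1 (1 / \<mu>1)" and K="1 + 1 / \<mu>1" and D="B + B * B / (2 * \<theta>)"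
        and \<alpha>="2 * \<mu>0" and \<beta>="energy / (4 * \<theta>)" and \<gamma>="A\<^sup>2 * \<theta> / energy + \<mu>1 * B\<^sup>2"])
    show "expdecay ?g"
      by (intro expdecay_add expdecay_cmult expdecay_mult_bounded \<rho>1 \<rho>2 e_bounded q_bounded)
    show "expdecay (\<lambda>t. - perturbation t)" by (rule expdecay_minus[OF expdecay_perturbation])
    fix t assume t: "t \<ge> Tb"
    have tT: "t \<ge> T" "t \<ge> Ta" using t A(1) Tb by auto
    show "(?E has_real_derivative - 2 * \<mu>0 * (e t)\<^sup>2 + ?g t) (at t)"
      by (rule DERIV_gradient_energy[OF DERIV_e[OF tT(1)] DERIV_q[OF tT(1)] \<mu>1_pos])
    show "- 2 * \<mu>0 * (e t)\<^sup>2 + ?g t \<le> - (2 * \<mu>0) * (e t)\<^sup>2 + ?g t" by simp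
    show "(excitation has_real_derivative excitation_rate t) (at t)" by (rule DERIV_excitation[OF tT(1)])
    show "energy / (4 * \<theta>) * (q t)\<^sup>2 - (A\<^sup>2 * \<theta> / energy + \<mu>1 * B\<^sup>2) * (e t)\<^sup>2 - - perturbation t \<le> excitation_rate t"
      using excitation_rate_ge[OF A(2)[OF tT(2)] B(1)[OF t]] by simp
    show "\<bar>excitation t\<bar> \<le> (B + B * B / (2 * \<theta>)) * ((e t)\<^sup>2 + (q t)\<^sup>2)"
      by (rule excitation_bounded_by_square[OF B[OF t]])
    show "min 1 (1 / \<mu>1) * ((e t)\<^sup>2 + (q t)\<^sup>2) \<le> ?E t"
      using mult_right_mono[of "min 1 (1 / \<mu>1)" 1 "(e t)\<^sup>2"] mult_right_mono[of "min 1 (1 / \<mu>1)" "1 / \<mu>1" "(q t)\<^sup>2"]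
      by (simp add: distrib_left)
    show "?E t \<le> (1 + 1 / \<mu>1) * ((e t)\<^sup>2 + (q t)\<^sup>2)"
      using \<mu>1_pos by (simp add: field_simps)
  qed (use excited \<mu>0_pos \<mu>1_pos \<theta>_pos B(1)[of Tb] in auto)
  then show "expdecay e" "expdecay q" by (rule expdecay_of_sum_squares)+
qed

end

lemma two_mult_le_abs_mult: "2 * (r * x) \<le> \<bar>r\<bar> * (1 + x\<^sup>2)" for r x :: real
proof -
  have "r * x \<le> \<bar>r\<bar> * \<bar>x\<bar>" by (metis abs_ge_self abs_mult)
  moreover have "2 * \<bar>x\<bar> \<le> 1 + x\<^sup>2" using sum_squares_bound[of 1 "\<bar>x\<bar>"] by simp
  then have "\<bar>r\<bar> * (2 * \<bar>x\<bar>) \<le> \<bar>r\<bar> * (1 + x\<^sup>2)" by (rule mult_left_mono) simp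
  ultimately show ?thesis by linarith
qed

locale adaptive_observer = oscillator \<theta> T d1 d2 for \<theta> T d1 d2 +
  fixes \<iota> \<mu>0 \<mu>1 :: real and y \<xi> \<chi>1 \<phi> \<theta>h :: "real \<Rightarrow> real"
  assumes \<iota>_pos: "\<iota> > 0" and \<mu>0_pos: "\<mu>0 > 0" and \<mu>1_pos: "\<mu>1 > 0"
    and y_tracks_d1: "expdecay (\<lambda>t. y t - d1 t)"
    and DERIV_\<xi>: "\<And>t. t \<ge> T \<Longrightarrow> (\<xi> has_real_derivative - \<iota> * \<xi> t - y t) (at t)"
    and DERIV_\<chi>1: "\<And>t. t \<ge> T \<Longrightarrow>
      (\<chi>1 has_real_derivative \<phi> t + \<iota> * y t + \<theta>h t * \<xi> t + \<mu>0 * (y t - \<chi>1 t)) (at t)"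
    and DERIV_\<phi>: "\<And>t. t \<ge> T \<Longrightarrow> (\<phi> has_real_derivative - \<iota> * \<phi> t - \<iota>\<^sup>2 * y t) (at t)"
    and DERIV_\<theta>h: "\<And>t. t \<ge> T \<Longrightarrow> (\<theta>h has_real_derivative \<mu>1 * \<xi> t * (y t - \<chi>1 t)) (at t)"
begin

text \<open>The periodic response of the filter \<open>response' = -\<iota> response - d1\<close> that generates \<open>\<xi>\<close>.\<close>
definition response :: "real \<Rightarrow> real" where
  "response t = (d2 t - \<iota> * d1 t) / (\<iota>\<^sup>2 + \<theta>)"

definition response' :: "real \<Rightarrow> real" where
  "response' t = (- \<theta> * d1 t - \<iota> * d2 t) / (\<iota>\<^sup>2 + \<theta>)"

definition output_error :: "real \<Rightarrow> real" where "output_error t = d1 t - \<chi>1 t"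

definition parameter_error :: "real \<Rightarrow> real" where "parameter_error t = \<theta> - \<theta>h t"

lemma filter_gain_pos: "\<iota>\<^sup>2 + \<theta> > 0"
  using \<theta>_pos by (simp add: add_nonneg_pos)

lemma d2_eq: "d2 t = (\<iota>\<^sup>2 + \<theta>) * response t + \<iota> * d1 t"
  using filter_gain_pos by (simp add: response_def)

lemma response'_eq: "response' t = - \<iota> * response t - d1 t"
  using filter_gain_pos by (simp add: response_def response'_def field_simps power2_eq_square)

sublocale filtered: oscillator \<theta> T response response'
proof
  fix t assume t: "t \<ge> T"
  show "(response has_real_derivative response' t) (at t)"
    unfolding response_def[abs_def] response'_def using DERIV_u[OF t] DERIV_v[OF t] filter_gain_pos
    by (auto intro!: derivative_eq_intros)
  show "(response' has_real_derivative - \<theta> * response t) (at t)"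
    unfolding response'_def[abs_def] response_def
    by (rule DERIV_cong[OF DERIV_cdivide[OF DERIV_diff[OF DERIV_cmult[OF DERIV_u[OF t]]
            DERIV_cmult[OF DERIV_v[OF t]]]]]) (simp add: algebra_simps)
qed (rule \<theta>_pos)

lemma \<xi>_tracks_response: "expdecay (\<lambda>t. \<xi> t - response t)"
proof (rule linear_ode_expdecay[OF _ \<iota>_pos expdecay_minus[OF y_tracks_d1]])
  fix t assume t: "t \<ge> T"
  show "((\<lambda>t. \<xi> t - response t) has_real_derivative - \<iota> * (\<xi> t - response t) + - (y t - d1 t)) (at t)"
    using DERIV_diff[OF DERIV_\<xi>[OF t] filtered.DERIV_u[OF t]] by (simp add: response'_eq algebra_simps)
qed

lemma \<phi>_tracks_\<xi>: "expdecay (\<lambda>t. \<phi> t - \<iota>\<^sup>2 * \<xi> t)"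
proof (rule linear_ode_expdecay[OF _ \<iota>_pos expdecay_0])
  fix t assume t: "t \<ge> T"
  show "((\<lambda>t. \<phi> t - \<iota>\<^sup>2 * \<xi> t) has_real_derivative - \<iota> * (\<phi> t - \<iota>\<^sup>2 * \<xi> t) + 0) (at t)"
    using DERIV_diff[OF DERIV_\<phi>[OF t] DERIV_cmult[OF DERIV_\<xi>[OF t], of "\<iota>\<^sup>2"]]
    by (simp add: algebra_simps)
qed

lemma \<xi>_bounded: "\<xi> \<in> O(\<lambda>_. 1)"
  using sum_in_bigo(1)[OF expdecay_imp_bigo_1[OF \<xi>_tracks_response] filtered.bounded(1)] by simp

definition output_perturbation :: "real \<Rightarrow> real" where
  "output_perturbation t = - (\<iota>\<^sup>2 + \<theta>) * (\<xi> t - response t) - (\<phi> t - \<iota>\<^sup>2 * \<xi> t) - (\<iota> + \<mu>0) * (y t - d1 t)"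

definition parameter_perturbation :: "real \<Rightarrow> real" where
  "parameter_perturbation t = - \<mu>1 * ((y t - d1 t) * \<xi> t)"

lemma expdecay_output_perturbation: "expdecay output_perturbation"
  unfolding output_perturbation_def[abs_def]
  by (intro expdecay_diff expdecay_cmult \<xi>_tracks_response \<phi>_tracks_\<xi> y_tracks_d1)

lemma expdecay_parameter_perturbation: "expdecay parameter_perturbation"
  unfolding parameter_perturbation_def[abs_def]
  by (intro expdecay_cmult expdecay_mult_bounded y_tracks_d1 \<xi>_bounded)

lemma DERIV_output_error:
  assumes "t \<ge> T"
  shows "(output_error has_real_derivative
    - \<mu>0 * output_error t + \<xi> t * parameter_error t + output_perturbation t) (at t)"
proof -
  have "(output_error has_real_derivative d2 t - (\<phi> t + \<iota> * y t + \<theta>h t * \<xi> t + \<mu>0 * (y t - \<chi>1 t))) (at t)"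
    unfolding output_error_def[abs_def] by (rule DERIV_diff[OF DERIV_u[OF assms] DERIV_\<chi>1[OF assms]])
  then show ?thesis
    by (rule DERIV_cong) (simp add: d2_eq output_error_def parameter_error_def output_perturbation_def algebra_simps)
qed

lemma DERIV_parameter_error:
  assumes "t \<ge> T"
  shows "(parameter_error has_real_derivative - \<mu>1 * \<xi> t * output_error t + parameter_perturbation t) (at t)"
  unfolding parameter_error_def[abs_def] using DERIV_\<theta>h[OF assms]
  by (auto intro!: derivative_eq_intros simp: output_error_def parameter_perturbation_def algebra_simps)

lemma energy_bounded: "(\<lambda>t. (output_error t)\<^sup>2 + (parameter_error t)\<^sup>2 / \<mu>1) \<in> O(\<lambda>_. 1)"
proof (rule gronwall_bounded[of T _ _ "\<lambda>t. \<bar>output_perturbation t\<bar> + (1 / \<mu>1 + 1) * \<bar>parameter_perturbation t\<bar>"])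
  let ?V = "\<lambda>t. (output_error t)\<^sup>2 + (parameter_error t)\<^sup>2 / \<mu>1"
  let ?V' = "\<lambda>t. - 2 * \<mu>0 * (output_error t)\<^sup>2 + (2 * (output_perturbation t * output_error t)
    + 2 / \<mu>1 * (parameter_perturbation t * parameter_error t))"
  fix t assume t: "t \<ge> T"
  show "(?V has_real_derivative ?V' t) (at t)"
    by (rule DERIV_gradient_energy[OF DERIV_output_error[OF t] DERIV_parameter_error[OF t] \<mu>1_pos])
  have "2 * (output_perturbation t * output_error t) \<le> \<bar>output_perturbation t\<bar> * (1 + ?V t)"
    by (rule order_trans[OF two_mult_le_abs_mult]) (use \<mu>1_pos in \<open>auto intro!: mult_left_mono\<close>)
  moreover have "2 / \<mu>1 * (parameter_perturbation t * parameter_error t)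
      \<le> (1 / \<mu>1 + 1) * \<bar>parameter_perturbation t\<bar> * (1 + ?V t)"
  proof -
    have "2 / \<mu>1 * (parameter_perturbation t * parameter_error t)
        \<le> \<bar>parameter_perturbation t\<bar> * ((1 + (parameter_error t)\<^sup>2) / \<mu>1)"
      using divide_right_mono[OF two_mult_le_abs_mult[of "parameter_perturbation t" "parameter_error t"], of \<mu>1]
        \<mu>1_pos by simp
    also have "\<dots> \<le> \<bar>parameter_perturbation t\<bar> * ((1 / \<mu>1 + 1) * (1 + ?V t))"
      using \<mu>1_pos by (intro mult_left_mono) (simp_all add: field_simps)
    finally show ?thesis by (simp only: mult_ac)
  qed
  moreover have "0 \<le> 2 * \<mu>0 * (output_error t)\<^sup>2" using \<mu>0_pos by simp
  ultimately show "?V' t \<le> (\<bar>output_perturbation t\<bar> + (1 / \<mu>1 + 1) * \<bar>parameter_perturbation t\<bar>) * (1 + ?V t)"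
    unfolding distrib_right[of "\<bar>output_perturbation t\<bar>"] by linarith
qed (use \<mu>1_pos expdecay_output_perturbation expdecay_parameter_perturbation in
    \<open>auto intro!: expdecay_add expdecay_cmult expdecay_abs\<close>)

lemma output_error_bounded: "output_error \<in> O(\<lambda>_. 1)"
  and parameter_error_bounded: "parameter_error \<in> O(\<lambda>_. 1)"
proof -
  let ?V = "\<lambda>t. (output_error t)\<^sup>2 + (parameter_error t)\<^sup>2 / \<mu>1"
  have "(\<lambda>t. (output_error t)\<^sup>2) \<in> O(?V)" "(\<lambda>t. (parameter_error t)\<^sup>2) \<in> O(?V)"
    by (rule bigo_geI[of 0 _ 1] bigo_geI[of 0 _ \<mu>1]; use \<mu>1_pos in \<open>simp add: field_simps\<close>)+
  then show "output_error \<in> O(\<lambda>_. 1)" "parameter_error \<in> O(\<lambda>_. 1)"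
    by (auto intro: bigo_1_of_square landau_o.big.trans[OF _ energy_bounded])
qed

lemma \<theta>h_bounded: "\<theta>h \<in> O(\<lambda>_. 1)"
  using sum_in_bigo(2)[OF bigo_const[of \<theta>] parameter_error_bounded] by (simp add: parameter_error_def)

lemma excited_error_system:
  assumes "filtered.energy > 0"
  shows "excited_error_system \<theta> T response response' \<mu>0 \<mu>1 output_error parameter_error
    (\<lambda>t. (\<xi> t - response t) * parameter_error t + output_perturbation t)
    (\<lambda>t. - \<mu>1 * ((\<xi> t - response t) * output_error t) + parameter_perturbation t)"
proof
  fix t assume t: "t \<ge> T"
  show "(output_error has_real_derivative - \<mu>0 * output_error t + response t * parameter_error t
      + ((\<xi> t - response t) * parameter_error t + output_perturbation t)) (at t)"
    using DERIV_output_error[OF t] by (simp add: algebra_simps)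
  show "(parameter_error has_real_derivative - \<mu>1 * response t * output_error t
      + (- \<mu>1 * ((\<xi> t - response t) * output_error t) + parameter_perturbation t)) (at t)"
    using DERIV_parameter_error[OF t] by (simp add: algebra_simps)
next
  show "expdecay (\<lambda>t. (\<xi> t - response t) * parameter_error t + output_perturbation t)"
    by (intro expdecay_add expdecay_mult_bounded \<xi>_tracks_response parameter_error_bounded
        expdecay_output_perturbation)
  show "expdecay (\<lambda>t. - \<mu>1 * ((\<xi> t - response t) * output_error t) + parameter_perturbation t)"
    by (intro expdecay_add expdecay_cmult expdecay_mult_bounded \<xi>_tracks_response output_error_bounded
        expdecay_parameter_perturbation)
qed (rule assms \<mu>0_pos \<mu>1_pos output_error_bounded parameter_error_bounded)+

lemma error_expdecay:
  "expdecay output_error \<and> expdecay (\<lambda>t. \<xi> t * parameter_error t)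
    \<and> (expdecay parameter_error \<or> (\<forall>t\<ge>T. d1 t = 0 \<and> d2 t = 0))"
proof (cases "filtered.energy = 0")
  case True
  then have rest: "response t = 0" "response' t = 0" if "t \<ge> T" for t
    using filtered.vanishes_if_energy_0 that by auto
  have filtered_parameter_error: "expdecay (\<lambda>t. \<xi> t * parameter_error t)"
    by (rule expdecay_cong[OF expdecay_mult_bounded[OF \<xi>_tracks_response parameter_error_bounded], of T])
       (simp add: rest)
  moreover have "expdecay output_error"
    by (rule linear_ode_expdecay[OF _ \<mu>0_pos expdecay_add[OF filtered_parameter_error
          expdecay_output_perturbation], of T])
       (use DERIV_output_error in \<open>simp add: algebra_simps\<close>)
  moreover have "d1 t = 0 \<and> d2 t = 0" if "t \<ge> T" for t
    using response'_eq[of t] d2_eq[of t] rest[OF that] by simp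
  ultimately show ?thesis by blast
next
  case False
  with filtered.energy_nonneg have "filtered.energy > 0" by simp
  then interpret excited_error_system \<theta> T response response' \<mu>0 \<mu>1 output_error parameter_error
      "\<lambda>t. (\<xi> t - response t) * parameter_error t + output_perturbation t"
      "\<lambda>t. - \<mu>1 * ((\<xi> t - response t) * output_error t) + parameter_perturbation t"
    by (rule excited_error_system)
  show ?thesis
    using error_expdecay expdecay_mult_bounded[OF error_expdecay(2) \<xi>_bounded] by (simp add: mult.commute)
qed

lemma \<chi>1_tracks_d1: "expdecay (\<lambda>t. \<chi>1 t - d1 t)"
  using error_expdecay expdecay_minus[of output_error] by (simp add: output_error_def)

lemma second_estimate_tracks_d2: "expdecay (\<lambda>t. \<phi> t + \<xi> t * \<theta>h t + \<iota> * \<chi>1 t - d2 t)"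
proof -
  have "\<phi> t + \<xi> t * \<theta>h t + \<iota> * \<chi>1 t - d2 t
      = (\<phi> t - \<iota>\<^sup>2 * \<xi> t) + (\<iota>\<^sup>2 + \<theta>) * (\<xi> t - response t) - \<xi> t * parameter_error t
        - \<iota> * output_error t" for t
    by (simp add: d2_eq parameter_error_def output_error_def algebra_simps)
  then show ?thesis
    by (simp only:) (intro expdecay_diff expdecay_add expdecay_cmult \<phi>_tracks_\<xi> \<xi>_tracks_response
        error_expdecay[THEN conjunct1] error_expdecay[THEN conjunct2, THEN conjunct1])
qed

lemma \<theta>h_converges_or_trivial: "expdecay (\<lambda>t. \<theta>h t - \<theta>) \<or> (\<forall>t\<ge>T. d1 t = 0 \<and> d2 t = 0)"
  using error_expdecay expdecay_minus[of parameter_error] by (auto simp: parameter_error_def)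

end

section \<open>Functions that are Lipschitz on bounded sets, and the matrix exponential\<close>

definition lipschitz_on_cballs :: "('a::real_normed_vector \<Rightarrow> 'b::real_normed_vector) \<Rightarrow> bool" where
  "lipschitz_on_cballs f \<longleftrightarrow> (\<forall>B. \<exists>L. L-lipschitz_on (cball 0 B) f)"

lemma lipschitz_on_cballsI:
  assumes "\<And>B. \<exists>L. \<forall>x y. norm x \<le> B \<longrightarrow> norm y \<le> B \<longrightarrow> norm (f x - f y) \<le> L * norm (x - y)"
  shows "lipschitz_on_cballs f"
  unfolding lipschitz_on_cballs_def
proof
  fix B
  obtain L where L: "\<And>x y. norm x \<le> B \<Longrightarrow> norm y \<le> B \<Longrightarrow> norm (f x - f y) \<le> L * norm (x - y)"
    using assms by blast
  have "norm (f x - f y) \<le> \<bar>L\<bar> * norm (x - y)" if "norm x \<le> B" "norm y \<le> B" for x y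
    using L[OF that] mult_right_mono[OF abs_ge_self[of L], of "norm (x - y)"] by simp
  then have "\<bar>L\<bar>-lipschitz_on (cball 0 B) f" by (intro lipschitz_onI) (auto simp: dist_norm)
  then show "\<exists>L. L-lipschitz_on (cball 0 B) f" by blast
qed

lemma lipschitz_on_cballsE:
  assumes "lipschitz_on_cballs f"
  obtains L where "L-lipschitz_on (cball 0 B) f"
  using assms unfolding lipschitz_on_cballs_def by blast

lemma lipschitz_on_cballs_bounded:
  assumes "lipschitz_on_cballs f"
  obtains C where "\<And>x. norm x \<le> B \<Longrightarrow> norm (f x) \<le> C"
proof -
  obtain L where L: "L-lipschitz_on (cball 0 B) f" by (rule lipschitz_on_cballsE[OF assms])
  show thesis
  proof (rule that[of "norm (f 0) + L * B"])
    fix x :: 'a assume x: "norm x \<le> B"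
    have "0 \<le> B" using norm_ge_zero x by (rule order_trans)
    then have "norm (f x - f 0) \<le> L * norm (x - 0)" using x by (intro lipschitz_on_normD[OF L]) auto
    also have "\<dots> \<le> L * B" using x lipschitz_on_nonneg[OF L] by (intro mult_left_mono) auto
    finally show "norm (f x) \<le> norm (f 0) + L * B" using norm_triangle_sub[of "f x" "f 0"] by linarith
  qed
qed

lemma lipschitz_on_cballs_imp_continuous_on:
  assumes "lipschitz_on_cballs f"
  shows "continuous_on UNIV f"
proof -
  have "continuous_on (ball 0 B) f" for B
    using assms lipschitz_on_continuous_on continuous_on_subset[OF _ ball_subset_cball]
    unfolding lipschitz_on_cballs_def by blast
  then have "continuous_on (\<Union>n. ball 0 (real n)) f" by (intro continuous_on_open_UN) auto
  moreover have "(\<Union>n. ball 0 (real n)) = (UNIV :: 'a set)" using reals_Archimedean2 by auto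
  ultimately show ?thesis by simp
qed

lemma lipschitz_on_cballs_const: "lipschitz_on_cballs (\<lambda>x. c)"
  unfolding lipschitz_on_cballs_def using lipschitz_on_constant by blast

lemma lipschitz_on_cballs_ident: "lipschitz_on_cballs (\<lambda>x. x)"
  unfolding lipschitz_on_cballs_def using lipschitz_on_id by blast

lemma lipschitz_on_cballs_add:
  "lipschitz_on_cballs f \<Longrightarrow> lipschitz_on_cballs g \<Longrightarrow> lipschitz_on_cballs (\<lambda>x. f x + g x)"
  unfolding lipschitz_on_cballs_def by (blast intro: lipschitz_on_add)

lemma lipschitz_on_cballs_diff:
  "lipschitz_on_cballs f \<Longrightarrow> lipschitz_on_cballs g \<Longrightarrow> lipschitz_on_cballs (\<lambda>x. f x - g x)"
  unfolding lipschitz_on_cballs_def by (blast intro: lipschitz_on_diff)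

lemma lipschitz_on_cballs_sum:
  "(\<And>i. i \<in> I \<Longrightarrow> lipschitz_on_cballs (f i)) \<Longrightarrow> lipschitz_on_cballs (\<lambda>x. \<Sum>i\<in>I. f i x)"
  by (induction I rule: infinite_finite_induct)
     (auto intro: lipschitz_on_cballs_const lipschitz_on_cballs_add)

lemma lipschitz_on_cballs_compose:
  assumes g: "lipschitz_on_cballs g" and f: "lipschitz_on_cballs f"
  shows "lipschitz_on_cballs (\<lambda>x. g (f x))"
  unfolding lipschitz_on_cballs_def
proof
  fix B
  obtain L where L: "L-lipschitz_on (cball 0 B) f" by (rule lipschitz_on_cballsE[OF f])
  obtain C where "\<And>x. norm x \<le> B \<Longrightarrow> norm (f x) \<le> C" by (rule lipschitz_on_cballs_bounded[OF f, of B]) blast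
  then have "f ` cball 0 B \<subseteq> cball 0 C" by auto
  moreover obtain M where "M-lipschitz_on (cball 0 C) g" by (rule lipschitz_on_cballsE[OF g])
  ultimately have "M-lipschitz_on (f ` cball 0 B) g" by (blast intro: lipschitz_on_subset)
  with L show "\<exists>L. L-lipschitz_on (cball 0 B) (\<lambda>x. g (f x))" by (blast intro: lipschitz_on_compose2)
qed

lemma lipschitz_on_cballs_bounded_linear:
  assumes "bounded_linear h" "lipschitz_on_cballs f"
  shows "lipschitz_on_cballs (\<lambda>x. h (f x))"
  by (rule lipschitz_on_cballs_compose[OF _ assms(2)])
     (auto simp: lipschitz_on_cballs_def intro: bounded_linear.lipschitz_boundE[OF assms(1)])

lemma lipschitz_on_cballs_bounded_bilinear:
  assumes "bounded_bilinear prd" "lipschitz_on_cballs f" "lipschitz_on_cballs g"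
  shows "lipschitz_on_cballs (\<lambda>x. prd (f x) (g x))"
proof (rule lipschitz_on_cballsI)
  interpret bounded_bilinear prd by (rule assms)
  fix B
  obtain K where K: "K > 0" "\<And>a b. norm (prd a b) \<le> norm a * norm b * K" using pos_bounded by blast
  obtain L where L: "L-lipschitz_on (cball 0 B) f" by (rule lipschitz_on_cballsE[OF assms(2)])
  obtain M where M: "M-lipschitz_on (cball 0 B) g" by (rule lipschitz_on_cballsE[OF assms(3)])
  obtain C where C: "\<And>x. norm x \<le> B \<Longrightarrow> norm (f x) \<le> C"
    by (rule lipschitz_on_cballs_bounded[OF assms(2), of B]) blast
  obtain D where D: "\<And>x. norm x \<le> B \<Longrightarrow> norm (g x) \<le> D"
    by (rule lipschitz_on_cballs_bounded[OF assms(3), of B]) blast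
  have "norm (prd (f x) (g x) - prd (f y) (g y)) \<le> (L * D * K + C * M * K) * norm (x - y)"
    if xy: "norm x \<le> B" "norm y \<le> B" for x y
  proof -
    have "prd (f x) (g x) - prd (f y) (g y) = prd (f x - f y) (g x) + prd (f y) (g x - g y)"
      by (simp add: diff_left diff_right)
    then have "norm (prd (f x) (g x) - prd (f y) (g y)) \<le> norm (prd (f x - f y) (g x)) + norm (prd (f y) (g x - g y))"
      by (simp only: norm_triangle_ineq)
    also have "\<dots> \<le> norm (f x - f y) * norm (g x) * K + norm (f y) * norm (g x - g y) * K"
      by (intro add_mono K)
    also have "\<dots> \<le> (L * norm (x - y)) * D * K + C * (M * norm (x - y)) * K"
      using K(1) lipschitz_on_nonneg[OF L] lipschitz_on_nonneg[OF M]
        order_trans[OF norm_ge_zero C[OF xy(2)]] order_trans[OF norm_ge_zero D[OF xy(1)]]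
      by (intro add_mono mult_mono C D lipschitz_on_normD[OF L] lipschitz_on_normD[OF M])
         (use xy in \<open>auto intro!: mult_nonneg_nonneg\<close>)
    finally show ?thesis by (simp add: algebra_simps)
  qed
  then show "\<exists>L. \<forall>x y. norm x \<le> B \<longrightarrow> norm y \<le> B \<longrightarrow>
      norm (prd (f x) (g x) - prd (f y) (g y)) \<le> L * norm (x - y)" by blast
qed

lemma lipschitz_on_cballs_power_series:
  fixes c :: "nat \<Rightarrow> real"
  assumes summ: "\<And>x. summable (\<lambda>n. c n * x ^ n)"
  shows "lipschitz_on_cballs (\<lambda>x. \<Sum>n. c n * x ^ n)"
proof (rule lipschitz_on_cballsI)
  fix B :: real
  let ?f' = "\<lambda>x. \<Sum>n. diffs c n * x ^ n"
  have deriv: "((\<lambda>x. \<Sum>n. c n * x ^ n) has_field_derivative ?f' x) (at x within S)" for x S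
    by (rule has_field_derivative_at_within[OF termdiffs_strong_converges_everywhere[OF summ]])
  have "continuous_on (cball 0 B) ?f'"
    by (rule DERIV_continuous_on[OF has_field_derivative_at_within[OF
            termdiffs_strong_converges_everywhere[OF termdiff_converges_all[OF summ]]]])
  then have "bounded (?f' ` cball 0 B)" by (intro compact_imp_bounded compact_continuous_image) auto
  then obtain C where C: "\<And>x. x \<in> cball 0 B \<Longrightarrow> norm (?f' x) \<le> C"
    unfolding bounded_iff by blast
  show "\<exists>L. \<forall>x y. norm x \<le> B \<longrightarrow> norm y \<le> B \<longrightarrow>
      norm ((\<Sum>n. c n * x ^ n) - (\<Sum>n. c n * y ^ n)) \<le> L * norm (x - y)"
    using field_differentiable_bound[of "cball 0 B", OF convex_cball deriv C]
    by (intro exI[of _ C]) auto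
qed

lemma summable_inverse_fact_power:
  fixes x :: real
  assumes "\<And>n. n \<le> k n"
  shows "summable (\<lambda>n. inverse (fact (k n)) * x ^ n)"
proof (rule summable_comparison_test'[OF summable_exp[of "\<bar>x\<bar>"]])
  fix n
  have "inverse (fact (k n)) \<le> (inverse (fact n) :: real)"
    using assms by (intro le_imp_inverse_le fact_mono) auto
  then show "norm (inverse (fact (k n)) * x ^ n) \<le> inverse (fact n) * \<bar>x\<bar> ^ n"
    by (simp add: abs_mult power_abs mult_right_mono)
qed

text \<open>The entire functions \<open>cosh (sqrt u)\<close> and \<open>sinh (sqrt u) / sqrt u\<close>: since the estimate of \<open>\<theta>\<close> may
  have either sign, the exponential of \<open>\<tau> S\<^sub>c(\<theta>)\<close> is written with them rather than with \<open>cos\<close> and \<open>sin\<close>.\<close>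
definition cosh_sqrt :: "real \<Rightarrow> real" where
  "cosh_sqrt u = (\<Sum>n. inverse (fact (2 * n)) * u ^ n)"

definition sinhc_sqrt :: "real \<Rightarrow> real" where
  "sinhc_sqrt u = (\<Sum>n. inverse (fact (2 * n + 1)) * u ^ n)"

lemma lipschitz_on_cballs_cosh_sqrt: "lipschitz_on_cballs cosh_sqrt"
  unfolding cosh_sqrt_def[abs_def]
  by (intro lipschitz_on_cballs_power_series summable_inverse_fact_power) simp

lemma lipschitz_on_cballs_sinhc_sqrt: "lipschitz_on_cballs sinhc_sqrt"
  unfolding sinhc_sqrt_def[abs_def]
  by (intro lipschitz_on_cballs_power_series summable_inverse_fact_power) simp

lemma cosh_sqrt_sums_even: "(\<lambda>k. if even k then u ^ (k div 2) / fact k else 0) sums cosh_sqrt u"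
proof -
  have "(\<lambda>n. inverse (fact (2 * n)) * u ^ n) sums cosh_sqrt u"
    unfolding cosh_sqrt_def by (intro summable_sums summable_inverse_fact_power) simp
  from sums_if[OF sums_zero this]
  have "(\<lambda>k. if even k then inverse (fact (2 * (k div 2))) * u ^ (k div 2) else 0) sums cosh_sqrt u" by simp
  then show ?thesis by (rule sums_cong[THEN iffD1, rotated]) (auto simp: divide_inverse)
qed

lemma sinhc_sqrt_sums_odd: "(\<lambda>k. if even k then 0 else u ^ (k div 2) / fact k) sums sinhc_sqrt u"
proof -
  have "(\<lambda>n. inverse (fact (2 * n + 1)) * u ^ n) sums sinhc_sqrt u"
    unfolding sinhc_sqrt_def by (intro summable_sums summable_inverse_fact_power) simp
  from sums_if'[OF this] show ?thesis
    by (rule sums_cong[THEN iffD1, rotated]) (auto simp: divide_inverse elim!: oddE)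
qed

lemma cosh_sqrt_neg: "cosh_sqrt (- x\<^sup>2) = cos x"
proof -
  have "(- 1) ^ n / fact (2 * n) * x ^ (2 * n) = inverse (fact (2 * n)) * (- x\<^sup>2) ^ n" for n
    by (subst power_minus) (simp add: power_mult divide_inverse)
  then show ?thesis using cos_paired[of x] by (simp add: cosh_sqrt_def sums_iff)
qed

lemma sinhc_sqrt_neg: "x * sinhc_sqrt (- x\<^sup>2) = sin x"
proof -
  have "(- 1) ^ n / fact (2 * n + 1) * x ^ (2 * n + 1) = x * (inverse (fact (2 * n + 1)) * (- x\<^sup>2) ^ n)" for n
    by (subst power_minus) (simp add: power_mult divide_inverse)
  then have "sin x = (\<Sum>n. x * (inverse (fact (2 * n + 1)) * (- x\<^sup>2) ^ n))"
    using sin_paired[of x] by (simp only: sums_iff)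
  also have "\<dots> = x * sinhc_sqrt (- x\<^sup>2)"
    unfolding sinhc_sqrt_def by (intro suminf_mult summable_inverse_fact_power) simp
  finally show ?thesis by simp
qed

lemma Sc_mult_vec: "(Sc th *v d) $ 1 = d $ 2" "(Sc th *v d) $ 2 = - th * d $ 1"
  by (simp_all add: Sc_def matrix_vector_mult_def sum_2)

lemma vec_mult_Sc: "(x v* Sc th) $ 1 = - th * x $ 2" "(x v* Sc th) $ 2 = x $ 1"
  by (simp_all add: Sc_def vector_matrix_mult_def sum_2)

lemma Sc_square: "Sc th ** Sc th = - th *\<^sub>R mat 1"
  by (simp add: vec_eq_iff forall_2 Sc_def matrix_matrix_mult_def sum_2 mat_def)

lemma mpow_Sc:
  "mpow (\<tau> *\<^sub>R Sc th) k = (if even k then (- (th * \<tau>\<^sup>2)) ^ (k div 2) *\<^sub>R mat 1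
     else ((- (th * \<tau>\<^sup>2)) ^ (k div 2) * \<tau>) *\<^sub>R Sc th)"
proof (induction k)
  case (Suc k)
  show ?case
  proof (cases "even k")
    case True
    then obtain j where "k = 2 * j" by blast
    then show ?thesis using Suc by (simp add: scalar_matrix_assoc[symmetric] matrix_scalar_ac mult.commute)
  next
    case False
    then obtain j where "k = 2 * j + 1" by (rule oddE)
    then show ?thesis using Suc Sc_square[of th]
      by (simp add: scalar_matrix_assoc[symmetric] matrix_scalar_ac power2_eq_square mult_ac)
  qed
qed simp

lemma mexp_Sc:
  "mexp (\<tau> *\<^sub>R Sc th) = cosh_sqrt (- (th * \<tau>\<^sup>2)) *\<^sub>R mat 1 + (\<tau> * sinhc_sqrt (- (th * \<tau>\<^sup>2))) *\<^sub>R Sc th"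
proof -
  let ?u = "- (th * \<tau>\<^sup>2)"
  let ?even = "\<lambda>k. if even k then ?u ^ (k div 2) / fact k else 0"
    and ?odd = "\<lambda>k. if even k then 0 else ?u ^ (k div 2) / fact k"
  have "(\<lambda>k. ?even k *\<^sub>R mat 1 + (\<tau> * ?odd k) *\<^sub>R Sc th) sums
      (cosh_sqrt ?u *\<^sub>R mat 1 + (\<tau> * sinhc_sqrt ?u) *\<^sub>R Sc th)"
    by (intro sums_add sums_scaleR_left sums_mult cosh_sqrt_sums_even sinhc_sqrt_sums_odd)
  moreover have "?even k *\<^sub>R mat 1 + (\<tau> * ?odd k) *\<^sub>R Sc th = (1 / fact k) *\<^sub>R mpow (\<tau> *\<^sub>R Sc th) k" for k
    by (simp add: mpow_Sc)
  ultimately show ?thesis unfolding mexp_def by (simp add: sums_iff)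
qed

lemma mexp_Sc_mult_vec:
  assumes "\<omega> > 0"
  shows "mexp (\<tau> *\<^sub>R Sc (\<omega>\<^sup>2)) *v d = cos (\<omega> * \<tau>) *\<^sub>R d + (sin (\<omega> * \<tau>) / \<omega>) *\<^sub>R (Sc (\<omega>\<^sup>2) *v d)"
proof -
  have "cosh_sqrt (- (\<omega>\<^sup>2 * \<tau>\<^sup>2)) = cos (\<omega> * \<tau>)"
    using cosh_sqrt_neg[of "\<omega> * \<tau>"] by (simp add: power_mult_distrib)
  moreover have "\<tau> * sinhc_sqrt (- (\<omega>\<^sup>2 * \<tau>\<^sup>2)) = sin (\<omega> * \<tau>) / \<omega>"
    using sinhc_sqrt_neg[of "\<omega> * \<tau>"] assms by (simp add: power_mult_distrib field_simps)
  ultimately show ?thesis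
    by (simp add: mexp_Sc matrix_vector_mult_add_rdistrib scaleR_matrix_vector_assoc[symmetric])
qed

lemma oscillator_flow:
  fixes u v :: "real \<Rightarrow> real"
  assumes "oscillator (\<omega>\<^sup>2) T u v" and "t \<ge> T" "\<tau> \<ge> 0" "\<omega> > 0"
  shows "vector [u (t + \<tau>), v (t + \<tau>)] = mexp (\<tau> *\<^sub>R Sc (\<omega>\<^sup>2)) *v vector [u t, v t]"
proof -
  interpret oscillator "\<omega>\<^sup>2" T u v by (rule assms)
  define x where "x s = u s - (cos (\<omega> * (s - t)) * u t + sin (\<omega> * (s - t)) / \<omega> * v t)" for s
  define y where "y s = v s - (cos (\<omega> * (s - t)) * v t - \<omega> * sin (\<omega> * (s - t)) * u t)" for s
  interpret deviation: oscillator "\<omega>\<^sup>2" t x y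
  proof
    fix s assume "s \<ge> t"
    then have s: "s \<ge> T" using \<open>t \<ge> T\<close> by simp
    show "(x has_real_derivative y s) (at s)"
      unfolding x_def[abs_def] y_def using DERIV_u[OF s] \<open>\<omega> > 0\<close>
      by (auto intro!: derivative_eq_intros simp: field_simps)
    show "(y has_real_derivative - \<omega>\<^sup>2 * x s) (at s)"
      unfolding y_def[abs_def] x_def using DERIV_v[OF s] \<open>\<omega> > 0\<close>
      by (auto intro!: derivative_eq_intros simp: field_simps power2_eq_square)
  qed (use \<open>\<omega> > 0\<close> in simp)
  have "deviation.energy = 0" by (simp add: deviation.energy_def x_def y_def)
  then have "x (t + \<tau>) = 0" "y (t + \<tau>) = 0"
    using deviation.vanishes_if_energy_0[of "t + \<tau>"] \<open>\<tau> \<ge> 0\<close> by simp_all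
  then show ?thesis
    unfolding mexp_Sc_mult_vec[OF \<open>\<omega> > 0\<close>] using \<open>\<omega> > 0\<close>
    by (simp add: vec_eq_iff forall_2 Sc_mult_vec x_def y_def power2_eq_square)
qed

lemma cspectrum_imaginary_imp_square:
  assumes "\<omega> > 0" "\<i> * complex_of_real \<omega> \<in> cspectrum G"
  shows "G *v (G *v u) = - (\<omega>\<^sup>2) *\<^sub>R u"
proof -
  let ?g = "\<lambda>i j. complex_of_real (G $ i $ j)" and ?\<mu> = "\<i> * complex_of_real \<omega>"
  obtain v :: "complex^2" where v: "v \<noteq> 0" "(\<chi> i j. ?g i j) *v v = ?\<mu> *s v"
    using assms(2) unfolding cspectrum_def by blast
  have eigen: "?g 1 1 * v $ 1 + ?g 1 2 * v $ 2 = ?\<mu> * v $ 1" "?g 2 1 * v $ 1 + ?g 2 2 * v $ 2 = ?\<mu> * v $ 2"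
    using v(2) by (simp_all add: vec_eq_iff forall_2 matrix_vector_mult_def sum_2)
  define charpoly where "charpoly = (?g 1 1 - ?\<mu>) * (?g 2 2 - ?\<mu>) - ?g 1 2 * ?g 2 1"
  have "charpoly * v $ 1 = 0" "charpoly * v $ 2 = 0" unfolding charpoly_def using eigen by algebra+
  moreover have "v $ 1 \<noteq> 0 \<or> v $ 2 \<noteq> 0" using v(1) by (simp add: vec_eq_iff forall_2)
  ultimately have root: "charpoly = 0" by auto
  have "Im charpoly = - \<omega> * (G $ 1 $ 1 + G $ 2 $ 2)" by (simp add: charpoly_def algebra_simps)
  then have trace: "G $ 2 $ 2 = - G $ 1 $ 1" using root assms(1) by simp
  have "Re charpoly = G $ 1 $ 1 * G $ 2 $ 2 - \<omega> * \<omega> - G $ 1 $ 2 * G $ 2 $ 1" by (simp add: charpoly_def algebra_simps)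
  then have det: "G $ 1 $ 1 * G $ 2 $ 2 - G $ 1 $ 2 * G $ 2 $ 1 = \<omega>\<^sup>2" using root by (simp add: power2_eq_square)
  have "G $ 1 $ 1 * (G $ 1 $ 1 * u $ 1 + G $ 1 $ 2 * u $ 2)
      + G $ 1 $ 2 * (G $ 2 $ 1 * u $ 1 + G $ 2 $ 2 * u $ 2) = - (\<omega>\<^sup>2 * u $ 1)"
    "G $ 2 $ 1 * (G $ 1 $ 1 * u $ 1 + G $ 1 $ 2 * u $ 2)
      + G $ 2 $ 2 * (G $ 2 $ 1 * u $ 1 + G $ 2 $ 2 * u $ 2) = - (\<omega>\<^sup>2 * u $ 2)"
    using trace det by algebra+
  then show ?thesis by (simp add: vec_eq_iff forall_2 matrix_vector_mult_def sum_2)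
qed

section \<open>The regulator profile\<close>

lemma second_order_energy_rate_le:
  fixes u v w :: "'a::real_inner"
  assumes "norm w \<le> A * norm u + D" "A \<ge> 0"
  shows "2 * (u \<bullet> v) + 2 * (v \<bullet> w) \<le> (A + 2) * (u \<bullet> u + v \<bullet> v + D\<^sup>2)"
proof -
  define p q where "p = norm u" and "q = norm v"
  have "u \<bullet> v \<le> p * q" by (simp add: p_def q_def norm_cauchy_schwarz)
  moreover have "v \<bullet> w \<le> q * norm w" by (simp add: q_def norm_cauchy_schwarz)
  moreover have "q * norm w \<le> q * (A * p + D)"
    using assms(1) by (intro mult_left_mono) (auto simp: p_def q_def)
  moreover have "2 * (p * q) \<le> p\<^sup>2 + q\<^sup>2" "2 * (q * D) \<le> q\<^sup>2 + D\<^sup>2"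
    using sum_squares_bound[of p q] sum_squares_bound[of q D] by simp_all
  moreover have "A * (2 * (p * q)) \<le> A * (p\<^sup>2 + q\<^sup>2)"
    using sum_squares_bound[of p q] assms(2) by (intro mult_left_mono) auto
  moreover have "0 \<le> A * D\<^sup>2" "0 \<le> D\<^sup>2" "0 \<le> p\<^sup>2" using assms(2) by auto
  moreover have "(A + 2) * (u \<bullet> u + v \<bullet> v + D\<^sup>2) = A * (p\<^sup>2 + q\<^sup>2) + A * D\<^sup>2 + 2 * p\<^sup>2 + 2 * q\<^sup>2 + 2 * D\<^sup>2"
    "2 * (q * (A * p + D)) = A * (2 * (p * q)) + 2 * (q * D)"
    by (simp_all add: p_def q_def power2_norm_eq_inner algebra_simps)
  ultimately show ?thesis by linarith
qed

lemma second_order_gronwall: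
  fixes F F' F'' :: "real \<Rightarrow> 'a::real_inner"
  assumes F: "\<And>x. x \<in> {a..b} \<Longrightarrow> (F has_vector_derivative F' x) (at x within {a..b})"
    and F': "\<And>x. x \<in> {a..b} \<Longrightarrow> (F' has_vector_derivative F'' x) (at x within {a..b})"
    and F'': "\<And>x. x \<in> {a..b} \<Longrightarrow> norm (F'' x) \<le> A * norm (F x) + D"
    and "A \<ge> 0" and x: "x \<in> {a..b}"
  shows "(norm (F x))\<^sup>2 + (norm (F' x))\<^sup>2 \<le> exp ((A + 2) * (x - a)) * ((norm (F a))\<^sup>2 + (norm (F' a))\<^sup>2 + D\<^sup>2)"
proof -
  define E where "E x = F x \<bullet> F x + F' x \<bullet> F' x + D\<^sup>2" for x
  have "continuous_on {a..b} F" "continuous_on {a..b} F'"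
    by (rule continuous_on_vector_derivative, rule F F', assumption)+
  then have cont_E: "continuous_on {a..b} E" unfolding E_def by (intro continuous_intros)
  have "(norm (F x))\<^sup>2 + (norm (F' x))\<^sup>2 \<le> E x" by (simp add: E_def power2_norm_eq_inner)
  also have "\<dots> \<le> exp ((A + 2) * x - (A + 2) * a) * E a"
  proof (rule gronwall)
    show "continuous_on {a..x} E" using cont_E by (rule continuous_on_subset) (use x in auto)
    fix y assume y: "a < y" "y < x"
    have at: "at y within {a..b} = at y" using y x by (intro at_within_Icc_at) auto
    have deriv: "(F has_vector_derivative F' y) (at y)" "(F' has_vector_derivative F'' y) (at y)"
      using F[of y] F'[of y] y x by (simp_all add: at)
    have "(E has_vector_derivative (F y \<bullet> F' y + F' y \<bullet> F y) + (F' y \<bullet> F'' y + F'' y \<bullet> F' y) + 0) (at y)"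
      unfolding E_def
      by (intro has_vector_derivative_add has_vector_derivative_const deriv
          bounded_bilinear.has_vector_derivative[OF bounded_bilinear_inner])
    then show "(E has_real_derivative 2 * (F y \<bullet> F' y) + 2 * (F' y \<bullet> F'' y)) (at y)"
      by (simp add: has_real_derivative_iff_has_vector_derivative inner_commute)
    show "((*) (A + 2) has_real_derivative A + 2) (at y)" by (auto intro!: derivative_eq_intros)
    show "2 * (F y \<bullet> F' y) + 2 * (F' y \<bullet> F'' y) \<le> (A + 2) * E y"
      unfolding E_def by (rule second_order_energy_rate_le[OF F'' \<open>A \<ge> 0\<close>]) (use y x in auto)
  qed (use x in \<open>auto intro: continuous_on_mult_left\<close>)
  finally show ?thesis by (simp add: E_def power2_norm_eq_inner right_diff_distrib)
qed

lemma norm_vec_mult_Sc_le: "norm (x v* Sc th) \<le> (1 + \<bar>th\<bar>) * norm x"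
proof -
  have "norm (x v* Sc th) \<le> \<bar>(x v* Sc th) $ 1\<bar> + \<bar>(x v* Sc th) $ 2\<bar>"
    using norm_le_l1_cart[of "x v* Sc th"] by (simp add: sum_2)
  also have "\<dots> \<le> \<bar>th\<bar> * norm x + norm x"
    unfolding vec_mult_Sc abs_mult
    by (intro add_mono mult_mono component_le_norm_cart) auto
  finally show ?thesis by (simp add: algebra_simps)
qed

lemma norm_vec_mult_Sc_diff_le: "norm (x v* Sc th - x v* Sc th') \<le> \<bar>th - th'\<bar> * norm x"
proof -
  have "x v* Sc th - x v* Sc th' = ((th' - th) * x $ 2) *\<^sub>R axis 1 1"
    by (simp add: vec_eq_iff forall_2 vec_mult_Sc algebra_simps axis_def)
  then have "norm (x v* Sc th - x v* Sc th') = \<bar>th - th'\<bar> * \<bar>x $ 2\<bar>" by (simp add: abs_mult abs_minus_commute)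
  also have "\<dots> \<le> \<bar>th - th'\<bar> * norm x" by (intro mult_left_mono component_le_norm_cart) simp
  finally show ?thesis .
qed

lemma lipschitz_on_cballs_vec_mult_Sc:
  assumes "lipschitz_on_cballs g"
  shows "lipschitz_on_cballs (\<lambda>th. g th v* Sc th)"
proof -
  have "(\<lambda>th. g th v* Sc th) = (\<lambda>th. g th v* Sc 0 - (th * g th $ 2) *\<^sub>R axis 1 1)"
    by (simp add: fun_eq_iff vec_eq_iff forall_2 vec_mult_Sc axis_def)
  then show ?thesis
    by (simp only:) (intro lipschitz_on_cballs_diff assms lipschitz_on_cballs_ident lipschitz_on_cballs_const
        lipschitz_on_cballs_bounded_linear[OF bounded_linear_vector_matrix_mult]
        lipschitz_on_cballs_bounded_linear[OF bounded_linear_vec_nth]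
        lipschitz_on_cballs_bounded_bilinear[OF bounded_bilinear_scaleR]
        lipschitz_on_cballs_bounded_bilinear[OF bounded_bilinear_mult])
qed

lemma Sc_profile_bound:
  fixes F F' h :: "real \<Rightarrow> real^2"
  assumes F: "\<And>x. x \<in> {0..1} \<Longrightarrow> (F has_vector_derivative F' x) (at x within {0..1})"
    and F': "\<And>x. x \<in> {0..1} \<Longrightarrow> (F' has_vector_derivative F x v* Sc th - a *\<^sub>R F x + h x) (at x within {0..1})"
    and h: "\<And>x. x \<in> {0..1} \<Longrightarrow> norm (h x) \<le> D" and th: "\<bar>th\<bar> \<le> B" and x: "x \<in> {0..1}"
  shows "(norm (F x))\<^sup>2 + (norm (F' x))\<^sup>2 \<le> exp (3 + B + \<bar>a\<bar>) * ((norm (F 0))\<^sup>2 + (norm (F' 0))\<^sup>2 + D\<^sup>2)"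
proof -
  define A where "A = 1 + B + \<bar>a\<bar>"
  have A: "A \<ge> 0" using th by (simp add: A_def)
  have "(norm (F x))\<^sup>2 + (norm (F' x))\<^sup>2 \<le> exp ((A + 2) * (x - 0)) * ((norm (F 0))\<^sup>2 + (norm (F' 0))\<^sup>2 + D\<^sup>2)"
  proof (rule second_order_gronwall[OF F F' _ A x])
    fix y :: real assume y: "y \<in> {0..1}"
    have "norm (F y v* Sc th - a *\<^sub>R F y + h y) \<le> norm (F y v* Sc th) + norm (a *\<^sub>R F y) + norm (h y)"
      by (intro order_trans[OF norm_triangle_ineq] add_right_mono norm_triangle_ineq4)
    also have "\<dots> \<le> (1 + B) * norm (F y) + \<bar>a\<bar> * norm (F y) + D"
      using h[OF y] th
      by (intro add_mono order_trans[OF norm_vec_mult_Sc_le] mult_right_mono) auto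
    finally show "norm (F y v* Sc th - a *\<^sub>R F y + h y) \<le> A * norm (F y) + D"
      by (simp add: A_def algebra_simps)
  qed auto
  also have "\<dots> \<le> exp (3 + B + \<bar>a\<bar>) * ((norm (F 0))\<^sup>2 + (norm (F' 0))\<^sup>2 + D\<^sup>2)"
    using mult_left_mono[of x 1 "A + 2"] x A by (intro mult_right_mono) (auto simp add: A_def ring_distribs)
  finally show ?thesis .
qed

lemma has_integral_phi_second_derivative:
  assumes g: "\<And>x. x \<in> {0..1} \<Longrightarrow> (g has_vector_derivative g' x) (at x within {0..1})"
    and g': "\<And>x. x \<in> {0..1} \<Longrightarrow> (g' has_vector_derivative g'' x) (at x within {0..1})"
  shows "((\<lambda>x. phi n x *\<^sub>R g'' x) has_integral
    (phi n 1 *\<^sub>R g' 1 - phi n 0 *\<^sub>R g' 0 - (real n * pi)\<^sup>2 *\<^sub>R ipv01 g (phi n))) {0..1}"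
proof -
  define c where "c = (if n = 0 then 1 else sqrt 2)"
  define \<phi>' where "\<phi>' x = - c * (real n * pi) * sin (real n * pi * x)" for x
  have phi': "(phi n has_real_derivative \<phi>' x) (at x within {0..1})" for x
    unfolding phi_alt[abs_def] \<phi>'_def c_def[symmetric] by (auto intro!: derivative_eq_intros)
  have phi'': "(\<phi>' has_real_derivative - ((real n * pi)\<^sup>2 * phi n x)) (at x within {0..1})" for x
    unfolding phi_alt[abs_def] \<phi>'_def[abs_def] c_def[symmetric]
    by (auto intro!: derivative_eq_intros simp: power2_eq_square)
  have "((\<lambda>x. (phi n x *\<^sub>R g'' x + \<phi>' x *\<^sub>R g' x) - (\<phi>' x *\<^sub>R g' x + - ((real n * pi)\<^sup>2 * phi n x) *\<^sub>R g x))
      has_integral ((phi n 1 *\<^sub>R g' 1 - \<phi>' 1 *\<^sub>R g 1) - (phi n 0 *\<^sub>R g' 0 - \<phi>' 0 *\<^sub>R g 0))) {0..1}"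
  proof (rule fundamental_theorem_of_calculus)
    fix x :: real assume "x \<in> {0..1}"
    then show "((\<lambda>x. phi n x *\<^sub>R g' x - \<phi>' x *\<^sub>R g x) has_vector_derivative
        (phi n x *\<^sub>R g'' x + \<phi>' x *\<^sub>R g' x) - (\<phi>' x *\<^sub>R g' x + - ((real n * pi)\<^sup>2 * phi n x) *\<^sub>R g x))
        (at x within {0..1})"
      by (intro has_vector_derivative_diff[OF has_vector_derivative_scaleR[OF phi' g']
            has_vector_derivative_scaleR[OF phi'' g]])
  qed simp
  moreover have "\<phi>' 0 = 0" "\<phi>' 1 = 0" by (simp_all add: \<phi>'_def sin_npi)
  ultimately have "((\<lambda>x. phi n x *\<^sub>R g'' x + (real n * pi)\<^sup>2 *\<^sub>R (phi n x *\<^sub>R g x)) has_integral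
      (phi n 1 *\<^sub>R g' 1 - phi n 0 *\<^sub>R g' 0)) {0..1}"
    by simp
  moreover have "((\<lambda>x. (real n * pi)\<^sup>2 *\<^sub>R (phi n x *\<^sub>R g x)) has_integral
      (real n * pi)\<^sup>2 *\<^sub>R ipv01 g (phi n)) {0..1}"
    unfolding ipv01_def
    by (intro has_integral_cmul integrable_integral integrable_continuous_real continuous_intros
        continuous_on_vector_derivative[OF g])
  ultimately have "((\<lambda>x. (phi n x *\<^sub>R g'' x + (real n * pi)\<^sup>2 *\<^sub>R (phi n x *\<^sub>R g x))
      - (real n * pi)\<^sup>2 *\<^sub>R (phi n x *\<^sub>R g x)) has_integral (phi n 1 *\<^sub>R g' 1 - phi n 0 *\<^sub>R g' 0 - (real n * pi)\<^sup>2 *\<^sub>R ipv01 g (phi n))) {0..1}"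
    by (rule has_integral_diff)
  then show ?thesis by simp
qed

definition injection_mode :: "nat \<Rightarrow> (nat \<Rightarrow> real) \<Rightarrow> nat \<Rightarrow> real" where
  "injection_mode N l n = (if n \<le> N then l n else 0)"

lemma ip01_injection: "ip01 (\<lambda>x. \<Sum>j\<le>N. l j * phi j x) (phi n) = injection_mode N l n"
  by (simp add: ip01_sum_phi injection_mode_def)

locale regulator_profile =
  fixes a :: real and N :: nat and l :: "nat \<Rightarrow> real" and f f' :: "real \<Rightarrow> real \<Rightarrow> real^2"
  assumes f_ode: "\<And>th x. x \<in> {0..1} \<Longrightarrow>
        ((\<lambda>y. f y th) has_vector_derivative f' x th) (at x within {0..1}) \<and>
        ((\<lambda>y. f' y th) has_vector_derivative
           (f x th v* Sc th - a *\<^sub>R f x th - (\<Sum>n\<le>N. l n * phi n x) *\<^sub>R f 0 th)) (at x within {0..1})"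
    and f'_0: "\<And>th. f' 0 th = 0" and f_0: "\<And>th. f 0 th = gamma_c"
begin

lemma f_deriv: "x \<in> {0..1} \<Longrightarrow> ((\<lambda>y. f y th) has_vector_derivative f' x th) (at x within {0..1})"
  and f'_deriv: "x \<in> {0..1} \<Longrightarrow> ((\<lambda>y. f' y th) has_vector_derivative
    f x th v* Sc th - a *\<^sub>R f x th - (\<Sum>n\<le>N. l n * phi n x) *\<^sub>R f 0 th) (at x within {0..1})"
  using f_ode by blast+

definition mode :: "nat \<Rightarrow> real \<Rightarrow> real^2" where
  "mode n th = ipv01 (\<lambda>x. f x th) (phi n)"

lemma continuous_on_f: "continuous_on {0..1} (\<lambda>x. f x th)"
  by (rule continuous_on_vector_derivative[OF f_deriv])

lemma f_phi_integrable: "(\<lambda>x. phi n x *\<^sub>R f x th) integrable_on {0..1}"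
  by (intro integrable_continuous_real continuous_intros continuous_on_f)

lemma ip01_f_inner: "ip01 (\<lambda>x. f x th \<bullet> d) (phi n) = mode n th \<bullet> d"
  using integral_component_eq[OF f_phi_integrable, of n th d]
  by (simp add: ip01_def mode_def ipv01_def mult.commute)

lemma profile_bounded:
  obtains C where "C \<ge> 0" "\<And>x th. x \<in> {0..1} \<Longrightarrow> \<bar>th\<bar> \<le> B \<Longrightarrow> norm (f x th) \<le> C"
proof -
  define D where "D = (\<Sum>n\<le>N. \<bar>l n\<bar> * sqrt 2) * norm gamma_c"
  define C where "C = exp (3 + B + \<bar>a\<bar>) * ((norm gamma_c)\<^sup>2 + D\<^sup>2)"
  show thesis
  proof (rule that[of "sqrt C"])
    fix x th :: real assume x: "x \<in> {0..1}" and th: "\<bar>th\<bar> \<le> B"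
    have "norm (- (\<Sum>n\<le>N. l n * phi n y) *\<^sub>R gamma_c) \<le> D" for y
      unfolding D_def norm_scaleR abs_minus_cancel
      by (intro mult_right_mono order_trans[OF sum_abs] sum_mono) (auto simp: abs_mult abs_phi_le mult_left_mono)
    then have "(norm (f x th))\<^sup>2 + (norm (f' x th))\<^sup>2 \<le> C"
      using Sc_profile_bound[where F="\<lambda>x. f x th" and F'="\<lambda>x. f' x th" and a=a
          and h="\<lambda>y. - (\<Sum>n\<le>N. l n * phi n y) *\<^sub>R gamma_c" and D=D, OF f_deriv _ _ th x] f'_deriv
      by (simp add: f_0 f'_0 C_def)
    then have "(norm (f x th))\<^sup>2 \<le> C" using zero_le_power2[of "norm (f' x th)"] by linarith
    then show "norm (f x th) \<le> sqrt C" by (rule real_le_rsqrt)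
  qed (simp add: C_def)
qed

lemma profile_lipschitz:
  obtains L where "L \<ge> 0"
    "\<And>x th th'. x \<in> {0..1} \<Longrightarrow> \<bar>th\<bar> \<le> B \<Longrightarrow> \<bar>th'\<bar> \<le> B \<Longrightarrow>
      norm (f x th - f x th') \<le> L * \<bar>th - th'\<bar> \<and> norm (f' x th - f' x th') \<le> L * \<bar>th - th'\<bar>"
proof -
  obtain C where C: "C \<ge> 0" "\<And>x th. x \<in> {0..1} \<Longrightarrow> \<bar>th\<bar> \<le> B \<Longrightarrow> norm (f x th) \<le> C"
    by (rule profile_bounded[of B]) blast
  define L where "L = sqrt (exp (3 + B + \<bar>a\<bar>)) * C"
  show thesis
  proof (rule that[of L])
    show "L \<ge> 0" using C(1) by (simp add: L_def)
    fix x th th' :: real assume x: "x \<in> {0..1}" and th: "\<bar>th\<bar> \<le> B" "\<bar>th'\<bar> \<le> B"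
    let ?F = "\<lambda>x. f x th - f x th'" and ?F' = "\<lambda>x. f' x th - f' x th'"
    have "(norm (?F x))\<^sup>2 + (norm (?F' x))\<^sup>2
        \<le> exp (3 + B + \<bar>a\<bar>) * ((norm (?F 0))\<^sup>2 + (norm (?F' 0))\<^sup>2 + (\<bar>th - th'\<bar> * C)\<^sup>2)"
    proof (rule Sc_profile_bound[where h="\<lambda>y. f y th' v* Sc th - f y th' v* Sc th'", OF _ _ _ th(1) x])
      fix y :: real assume y: "y \<in> {0..1}"
      show "(?F has_vector_derivative ?F' y) (at y within {0..1})"
        by (intro has_vector_derivative_diff f_deriv y)
      have "?F y v* Sc th = f y th v* Sc th - f y th' v* Sc th"
        by (rule linear_diff[OF bounded_linear.linear[OF bounded_linear_vector_matrix_mult]])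
      then have rhs: "(f y th v* Sc th - a *\<^sub>R f y th - (\<Sum>n\<le>N. l n * phi n y) *\<^sub>R f 0 th)
          - (f y th' v* Sc th' - a *\<^sub>R f y th' - (\<Sum>n\<le>N. l n * phi n y) *\<^sub>R f 0 th')
        = ?F y v* Sc th - a *\<^sub>R ?F y + (f y th' v* Sc th - f y th' v* Sc th')"
        by (simp add: f_0 algebra_simps)
      show "(?F' has_vector_derivative ?F y v* Sc th - a *\<^sub>R ?F y + (f y th' v* Sc th - f y th' v* Sc th'))
          (at y within {0..1})"
        unfolding rhs[symmetric] by (intro has_vector_derivative_diff f'_deriv y)
      show "norm (f y th' v* Sc th - f y th' v* Sc th') \<le> \<bar>th - th'\<bar> * C"
        by (rule order_trans[OF norm_vec_mult_Sc_diff_le]) (use C(2)[OF y th(2)] in \<open>simp add: mult_left_mono\<close>)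
    qed
    also have "\<dots> = (L * \<bar>th - th'\<bar>)\<^sup>2"
      by (simp add: f_0 f'_0 L_def power_mult_distrib)
    finally have "(norm (?F x))\<^sup>2 \<le> (L * \<bar>th - th'\<bar>)\<^sup>2" "(norm (?F' x))\<^sup>2 \<le> (L * \<bar>th - th'\<bar>)\<^sup>2"
      using zero_le_power2[of "norm (?F x)"] zero_le_power2[of "norm (?F' x)"] by linarith+
    then show "norm (?F x) \<le> L * \<bar>th - th'\<bar> \<and> norm (?F' x) \<le> L * \<bar>th - th'\<bar>"
      using \<open>L \<ge> 0\<close> by (auto intro: power2_le_imp_le)
  qed
qed

lemma lipschitz_on_cballs_f'_1: "lipschitz_on_cballs (f' 1)"
proof (rule lipschitz_on_cballsI)
  fix B
  obtain L where "\<And>x th th'. x \<in> {0..1} \<Longrightarrow> \<bar>th\<bar> \<le> B \<Longrightarrow> \<bar>th'\<bar> \<le> B \<Longrightarrow>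
      norm (f x th - f x th') \<le> L * \<bar>th - th'\<bar> \<and> norm (f' x th - f' x th') \<le> L * \<bar>th - th'\<bar>"
    by (rule profile_lipschitz[of B]) blast
  from this[of 1] show "\<exists>L. \<forall>x y. norm x \<le> B \<longrightarrow> norm y \<le> B \<longrightarrow> norm (f' 1 x - f' 1 y) \<le> L * norm (x - y)" by auto
qed

lemma lipschitz_on_cballs_mode: "lipschitz_on_cballs (mode n)"
proof (rule lipschitz_on_cballsI)
  fix B
  obtain L where L: "\<And>x th th'. x \<in> {0..1} \<Longrightarrow> \<bar>th\<bar> \<le> B \<Longrightarrow> \<bar>th'\<bar> \<le> B \<Longrightarrow>
      norm (f x th - f x th') \<le> L * \<bar>th - th'\<bar> \<and> norm (f' x th - f' x th') \<le> L * \<bar>th - th'\<bar>"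
    by (rule profile_lipschitz[of B]) blast
  have "norm (mode n u - mode n v) \<le> sqrt 2 * L * norm (u - v)" if "norm u \<le> B" "norm v \<le> B" for u v
  proof -
    have "mode n u - mode n v = ipv01 (\<lambda>x. f x u - f x v) (phi n)"
      unfolding mode_def ipv01_def scaleR_diff_right
      by (rule Henstock_Kurzweil_Integration.integral_diff[symmetric]) (rule f_phi_integrable)+
    also have "norm \<dots> \<le> sqrt 2 * (L * \<bar>u - v\<bar>)"
      by (rule norm_ipv01_phi_le) (use L that in auto)
    finally show ?thesis by (simp add: mult.assoc)
  qed
  then show "\<exists>L. \<forall>x y. norm x \<le> B \<longrightarrow> norm y \<le> B \<longrightarrow> norm (mode n x - mode n y) \<le> L * norm (x - y)" by blast
qed

lemma mode_equation:
  "mode n th v* Sc th = (a - (real n * pi)\<^sup>2) *\<^sub>R mode n th + phi n 1 *\<^sub>R f' 1 th + injection_mode N l n *\<^sub>R gamma_c"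
proof -
  let ?L = "\<lambda>x. \<Sum>j\<le>N. l j * phi j x"
  have lin: "linear (\<lambda>x :: real^2. x v* Sc th)" by (rule bounded_linear.linear[OF bounded_linear_vector_matrix_mult])
  have mode: "((\<lambda>x. phi n x *\<^sub>R f x th) has_integral mode n th) {0..1}"
    unfolding mode_def ipv01_def by (rule integrable_integral[OF f_phi_integrable])
  have "((\<lambda>x. (phi n x *\<^sub>R f x th) v* Sc th) has_integral mode n th v* Sc th) {0..1}"
    using has_integral_linear[OF mode bounded_linear_vector_matrix_mult[of "Sc th"]] by (simp add: o_def)
  moreover have "((\<lambda>x. ?L x * phi n x) has_integral injection_mode N l n) {0..1}"
    unfolding ip01_injection[symmetric] ip01_def
    by (intro integrable_integral integrable_continuous_real continuous_intros)
  then have "((\<lambda>x. (?L x * phi n x) *\<^sub>R gamma_c) has_integral injection_mode N l n *\<^sub>R gamma_c) {0..1}"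
    by (rule has_integral_scaleR_left)
  ultimately have "((\<lambda>x. (phi n x *\<^sub>R f x th) v* Sc th - a *\<^sub>R (phi n x *\<^sub>R f x th) - (?L x * phi n x) *\<^sub>R gamma_c)
      has_integral (mode n th v* Sc th - a *\<^sub>R mode n th - injection_mode N l n *\<^sub>R gamma_c)) {0..1}"
    by (intro has_integral_diff has_integral_cmul mode)
  moreover have "(phi n x *\<^sub>R f x th) v* Sc th - a *\<^sub>R (phi n x *\<^sub>R f x th) - (?L x * phi n x) *\<^sub>R gamma_c
      = phi n x *\<^sub>R (f x th v* Sc th - a *\<^sub>R f x th - ?L x *\<^sub>R f 0 th)" for x
    by (simp add: linear_scale[OF lin] f_0 scaleR_diff_right mult.commute)
  ultimately have "((\<lambda>x. phi n x *\<^sub>R (f x th v* Sc th - a *\<^sub>R f x th - ?L x *\<^sub>R f 0 th)) has_integral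
      (mode n th v* Sc th - a *\<^sub>R mode n th - injection_mode N l n *\<^sub>R gamma_c)) {0..1}"
    by (simp only:)
  from has_integral_unique[OF this has_integral_phi_second_derivative[OF f_deriv f'_deriv]]
  show ?thesis by (simp add: f'_0 mode_def[symmetric] algebra_simps)
qed

definition control_gain :: "(nat \<Rightarrow> real) \<Rightarrow> real \<Rightarrow> real \<Rightarrow> real^2" where
  "control_gain k \<tau> th = (\<Sum>n\<le>N. k n *\<^sub>R mode n th) - f' 1 th v* mexp (\<tau> *\<^sub>R Sc th)"

lemma lipschitz_on_cballs_control_gain: "lipschitz_on_cballs (control_gain k \<tau>)"
proof -
  let ?u = "\<lambda>th. - (th * \<tau>\<^sup>2)"
  have "f' 1 th v* mexp (\<tau> *\<^sub>R Sc th)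
      = cosh_sqrt (?u th) *\<^sub>R f' 1 th + (\<tau> * sinhc_sqrt (?u th)) *\<^sub>R (f' 1 th v* Sc th)" for th
    unfolding mexp_Sc
    by (simp add: vec_eq_iff forall_2 vector_matrix_mult_def sum_2 mat_def Sc_def algebra_simps)
  then have control_gain_eq: "control_gain k \<tau> = (\<lambda>th. (\<Sum>n\<le>N. k n *\<^sub>R mode n th) -
      (cosh_sqrt (?u th) *\<^sub>R f' 1 th + (\<tau> * sinhc_sqrt (?u th)) *\<^sub>R (f' 1 th v* Sc th)))"
    by (simp add: control_gain_def fun_eq_iff)
  have "bounded_linear ?u" by (intro bounded_linear_minus bounded_linear_mult_left)
  then have u: "lipschitz_on_cballs ?u" by (rule lipschitz_on_cballs_bounded_linear[OF _ lipschitz_on_cballs_ident])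
  show ?thesis unfolding control_gain_eq
    by (intro lipschitz_on_cballs_diff lipschitz_on_cballs_add lipschitz_on_cballs_sum lipschitz_on_cballs_const
        lipschitz_on_cballs_mode lipschitz_on_cballs_f'_1 lipschitz_on_cballs_vec_mult_Sc
        lipschitz_on_cballs_bounded_bilinear[OF bounded_bilinear_scaleR]
        lipschitz_on_cballs_bounded_bilinear[OF bounded_bilinear_mult]
        lipschitz_on_cballs_compose[OF lipschitz_on_cballs_cosh_sqrt u]
        lipschitz_on_cballs_compose[OF lipschitz_on_cballs_sinhc_sqrt u])
qed

end

section \<open>Modal asymptotics\<close>

lemma summable_inverse_eigenvalue: "summable (\<lambda>n. 1 / \<bar>(real n * pi)\<^sup>2 - c\<bar>)"
proof (rule summable_comparison_test_ev)
  show "summable (\<lambda>n. inverse (real n ^ 2))" by (rule inverse_power_summable) simp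
  show "\<forall>\<^sub>F n in sequentially. norm (1 / \<bar>(real n * pi)\<^sup>2 - c\<bar>) \<le> inverse (real n ^ 2)"
  proof (rule eventually_mono[OF eventually_ge_at_top[of "nat \<lceil>\<bar>c\<bar>\<rceil> + 1"]])
    fix n :: nat assume "nat \<lceil>\<bar>c\<bar>\<rceil> + 1 \<le> n"
    then have n: "1 \<le> real n" "\<bar>c\<bar> \<le> real n" by linarith+
    have "real n \<le> (real n)\<^sup>2" using n by (simp add: power2_eq_square)
    then have "\<bar>c\<bar> \<le> (real n)\<^sup>2" using n by linarith
    moreover have "3\<^sup>2 \<le> pi\<^sup>2" using pi_gt3 by (intro power_mono) auto
    then have "(real n)\<^sup>2 * 2 \<le> (real n)\<^sup>2 * pi\<^sup>2" by (intro mult_left_mono) auto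
    ultimately have "(real n)\<^sup>2 \<le> \<bar>(real n * pi)\<^sup>2 - c\<bar>" by (simp add: power_mult_distrib)
    moreover have "0 < (real n)\<^sup>2" using n by simp
    ultimately show "norm (1 / \<bar>(real n * pi)\<^sup>2 - c\<bar>) \<le> inverse (real n ^ 2)"
      by (simp add: inverse_eq_divide frac_le)
  qed
qed

lemma exp_minus_le_inverse: "x > 0 \<Longrightarrow> exp (- x) \<le> 1 / x" for x :: real
  using exp_ge_add_one_self[of x] by (simp add: exp_minus inverse_eq_divide frac_le del: exp_ge_add_one_self)

locale stable_tail =
  fixes a \<delta> :: real and N :: nat
  assumes \<delta>_pos: "\<delta> > 0" and N_tail: "\<forall>n>N. a - (real n * pi)\<^sup>2 < - \<delta>"
begin

definition \<mu> :: "nat \<Rightarrow> real" where "\<mu> n = a - (real n * pi)\<^sup>2"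

lemma \<mu>_less: "n > N \<Longrightarrow> \<mu> n < - \<delta>"
  using N_tail by (simp add: \<mu>_def)

lemma summable_inverse_\<mu>: "summable (\<lambda>n. 1 / \<bar>\<mu> n + \<alpha>\<bar>)"
proof -
  have "\<bar>\<mu> n + \<alpha>\<bar> = \<bar>(real n * pi)\<^sup>2 - (a + \<alpha>)\<bar>" for n by (simp add: \<mu>_def)
  then show ?thesis by (simp only: summable_inverse_eigenvalue)
qed

lemma summable_exp_\<mu>: "summable (\<lambda>n. exp (\<mu> n))"
proof (rule summable_comparison_test'[OF summable_inverse_\<mu>[of 0], of "N + 1"])
  fix n assume "n \<ge> N + 1"
  then have "\<mu> n < 0" using \<mu>_less[of n] \<delta>_pos by simp
  then show "norm (exp (\<mu> n)) \<le> 1 / \<bar>\<mu> n + 0\<bar>"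
    using exp_minus_le_inverse[of "- \<mu> n"] by simp
qed

definition mode_majorant :: "real \<Rightarrow> real \<Rightarrow> real \<Rightarrow> real \<Rightarrow> nat \<Rightarrow> real" where
  "mode_majorant \<alpha> T M K n = exp (\<mu> n) * (M * exp (\<alpha> * (T + 1))) + K * (1 / \<bar>\<mu> n + \<alpha>\<bar>)"

lemma summable_mode_majorant: "summable (mode_majorant \<alpha> T M K)"
  unfolding mode_majorant_def[abs_def]
  by (intro summable_add summable_mult summable_mult2 summable_exp_\<mu> summable_inverse_\<mu>)

lemma stable_mode_bound:
  assumes x: "\<And>t. t \<ge> T \<Longrightarrow> (x has_real_derivative \<mu> n * x t + g t) (at t)"
    and g: "\<And>t. t \<ge> T \<Longrightarrow> \<bar>g t\<bar> \<le> K * exp (- \<alpha> * t)"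
    and "\<alpha> < \<delta>" "K \<ge> 0" and M: "\<bar>x T\<bar> \<le> M" and "n > N" and t: "t \<ge> T + 1"
  shows "\<bar>x t\<bar> \<le> mode_majorant \<alpha> T M K n * exp (- \<alpha> * t)"
proof -
  have \<mu>: "\<mu> n < - \<alpha>" using \<mu>_less[OF \<open>n > N\<close>] \<open>\<alpha> < \<delta>\<close> by simp
  have "\<bar>x t\<bar> \<le> exp (- (- \<mu> n) * (t - T)) * \<bar>x T\<bar> + K / (- \<mu> n - \<alpha>) * exp (- \<alpha> * t)"
    by (rule abs_exp_forced_ode_bound[OF _ g]) (use x \<mu> t \<open>K \<ge> 0\<close> in auto)
  also have "exp (- (- \<mu> n) * (t - T)) * \<bar>x T\<bar> \<le> (exp (\<mu> n) * (exp (\<alpha> * (T + 1)) * exp (- \<alpha> * t))) * M"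
  proof (rule mult_mono)
    have "\<mu> n * (t - T - 1) \<le> - \<alpha> * (t - T - 1)" using \<mu> t by (intro mult_right_mono) auto
    then show "exp (- (- \<mu> n) * (t - T)) \<le> exp (\<mu> n) * (exp (\<alpha> * (T + 1)) * exp (- \<alpha> * t))"
      unfolding exp_add[symmetric] by (simp add: algebra_simps)
  qed (use M in auto)
  moreover have "\<bar>\<mu> n + \<alpha>\<bar> = - \<mu> n - \<alpha>" using \<mu> by simp
  ultimately show ?thesis by (simp add: mode_majorant_def ring_distribs mult_ac)
qed

definition modal_tail :: "(nat \<Rightarrow> real) \<Rightarrow> real" where
  "modal_tail c = (\<Sum>n. c (n + (N + 1)) * phi (n + (N + 1)) 0)"

lemma summable_modal_tail:
  assumes "summable (\<lambda>n. \<bar>c n\<bar>)"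
  shows "summable (\<lambda>n. c (n + (N + 1)) * phi (n + (N + 1)) 0)"
proof (rule summable_comparison_test')
  show "summable (\<lambda>n. \<bar>c (n + (N + 1))\<bar> * sqrt 2)"
    by (intro summable_mult2 summable_ignore_initial_segment[OF assms])
  show "norm (c (n + (N + 1)) * phi (n + (N + 1)) 0) \<le> \<bar>c (n + (N + 1))\<bar> * sqrt 2" for n
    by (simp add: abs_mult mult_left_mono abs_phi_le)
qed

lemma modal_tail_add:
  "summable (\<lambda>n. \<bar>c n\<bar>) \<Longrightarrow> summable (\<lambda>n. \<bar>d n\<bar>) \<Longrightarrow> modal_tail (\<lambda>n. c n + d n) = modal_tail c + modal_tail d"
  unfolding modal_tail_def distrib_right by (intro suminf_add[symmetric] summable_modal_tail)

lemma boundary_value_eq: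
  assumes "continuous_on {0..1} g" "summable (\<lambda>n. \<bar>ip01 g (phi n)\<bar>)"
  shows "g 0 = (\<Sum>n<N+1. ip01 g (phi n) * phi n 0) + modal_tail (\<lambda>n. ip01 g (phi n))"
proof -
  have "(\<lambda>n. ip01 g (phi n) * phi n 0) sums g 0" by (rule phi_series_sums[OF assms]) simp
  from suminf_split_initial_segment[OF sums_summable[OF this], of "N + 1"] sums_unique[OF this]
  show ?thesis by (simp add: modal_tail_def)
qed

lemma modal_tail_term_le:
  assumes x: "\<And>n. n > N \<Longrightarrow> \<bar>x n\<bar> \<le> A n * exp (- \<alpha> * t)"
  shows "norm (x (n + (N + 1)) * phi (n + (N + 1)) 0) \<le> A (n + (N + 1)) * (exp (- \<alpha> * t) * sqrt 2)"
proof -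
  have "\<bar>x (n + (N + 1))\<bar> \<le> A (n + (N + 1)) * exp (- \<alpha> * t)" by (intro x) auto
  then have "\<bar>x (n + (N + 1))\<bar> * \<bar>phi (n + (N + 1)) 0\<bar> \<le> A (n + (N + 1)) * exp (- \<alpha> * t) * sqrt 2"
    by (intro mult_mono abs_phi_le) auto
  then show ?thesis by (simp add: abs_mult mult.assoc)
qed

lemma modal_tail_expdecay:
  assumes A: "summable A" and "\<alpha> > 0"
    and x: "\<And>n t. n > N \<Longrightarrow> t \<ge> T \<Longrightarrow> \<bar>x n t\<bar> \<le> A n * exp (- \<alpha> * t)"
  shows "expdecay (\<lambda>t. modal_tail (\<lambda>n. x n t))"
proof (rule expdecayI[OF \<open>\<alpha> > 0\<close>])
  let ?A = "\<lambda>n. A (n + (N + 1))"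
  have summable_tail: "summable ?A" using A by (rule summable_ignore_initial_segment)
  fix t assume "t \<ge> T"
  then have "norm (modal_tail (\<lambda>n. x n t)) \<le> (\<Sum>n. ?A n * (exp (- \<alpha> * t) * sqrt 2))"
    unfolding modal_tail_def by (intro norm_suminf_le modal_tail_term_le x summable_mult2 summable_tail)
  also have "\<dots> = (\<Sum>n. ?A n) * (exp (- \<alpha> * t) * sqrt 2)" by (rule suminf_mult2[OF summable_tail, symmetric])
  finally show "\<bar>modal_tail (\<lambda>n. x n t)\<bar> \<le> (\<Sum>n. ?A n) * sqrt 2 * exp (- \<alpha> * t)" by (simp add: mult_ac)
qed

lemma continuous_on_modal_tail:
  assumes A: "summable A" and "\<alpha> > 0"
    and x: "\<And>n t. n > N \<Longrightarrow> t \<ge> T \<Longrightarrow> \<bar>x n t\<bar> \<le> A n * exp (- \<alpha> * t)"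
    and cont: "\<And>n. n > N \<Longrightarrow> continuous_on {T..} (x n)"
  shows "continuous_on {T..} (\<lambda>t. modal_tail (\<lambda>n. x n t))"
proof -
  let ?A = "\<lambda>n. A (n + (N + 1))"
  have "uniform_limit {T..} (\<lambda>m t. \<Sum>n<m. x (n + (N + 1)) t * phi (n + (N + 1)) 0)
      (\<lambda>t. modal_tail (\<lambda>n. x n t)) sequentially"
    unfolding modal_tail_def
  proof (rule Weierstrass_m_test)
    show "summable (\<lambda>n. ?A n * (exp (- \<alpha> * T) * sqrt 2))"
      by (intro summable_mult2 summable_ignore_initial_segment A)
    fix n t assume t: "t \<in> {T..}"
    have "?A n * exp (- \<alpha> * T) \<ge> 0" by (rule order_trans[OF abs_ge_zero x[of "n + (N + 1)" T]]) auto
    then have "?A n \<ge> 0" by (simp add: zero_le_mult_iff)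
    then have "?A n * (exp (- \<alpha> * t) * sqrt 2) \<le> ?A n * (exp (- \<alpha> * T) * sqrt 2)"
      using t \<open>\<alpha> > 0\<close> by (intro mult_left_mono mult_right_mono) auto
    then show "norm (x (n + (N + 1)) t * phi (n + (N + 1)) 0) \<le> ?A n * (exp (- \<alpha> * T) * sqrt 2)"
      using modal_tail_term_le[of "\<lambda>n. x n t" A \<alpha> t n] x t by simp
  qed
  then show ?thesis
    by (rule uniform_limit_theorem[rotated]) (auto intro!: continuous_intros cont always_eventually)
qed

end

locale exosystem =
  fixes G :: "real^2^2" and \<theta> :: real and p :: "real \<Rightarrow> real^2"
  assumes \<theta>_pos: "\<theta> > 0" and G_square: "\<And>u. G *v (G *v u) = - \<theta> *\<^sub>R u"
    and p_ode: "\<And>t. t \<ge> 0 \<Longrightarrow> (p has_vector_derivative (G *v p t)) (at t within {0..})"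
begin

lemma continuous_on_p: "T \<ge> 0 \<Longrightarrow> continuous_on {T..} p"
  by (rule continuous_on_subset[OF continuous_on_vector_derivative[OF p_ode]]) auto

lemma DERIV_inner_p:
  assumes "t > 0"
  shows "((\<lambda>t. u \<bullet> p t) has_real_derivative u \<bullet> (G *v p t)) (at t)"
proof -
  have "(p has_vector_derivative (G *v p t)) (at t)"
    using has_vector_derivative_within_subset[OF p_ode[of t], of "{0<..}"] assms
    by (simp add: at_within_open[of t "{0<..}"] subset_eq)
  then show ?thesis
    unfolding has_real_derivative_iff_has_vector_derivative
    by (rule bounded_linear.has_vector_derivative[OF bounded_linear_inner_right])
qed

lemma vec_mult_G_square: "v v* G v* G = - \<theta> *\<^sub>R v"
  by (rule vector_eq_rdot[THEN iffD1]) (simp add: dot_lmul_matrix G_square)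

lemma oscillator_inner_p:
  assumes "T > 0"
  shows "oscillator \<theta> T (\<lambda>t. q \<bullet> p t) (\<lambda>t. q \<bullet> (G *v p t))"
proof
  fix t assume "T \<le> t"
  then have "t > 0" using assms by simp
  then show "((\<lambda>t. q \<bullet> p t) has_real_derivative q \<bullet> (G *v p t)) (at t)" by (rule DERIV_inner_p)
  show "((\<lambda>t. q \<bullet> (G *v p t)) has_real_derivative - \<theta> * (q \<bullet> p t)) (at t)"
    using DERIV_inner_p[OF \<open>t > 0\<close>, of "q v* G"] by (simp add: dot_lmul_matrix G_square)
qed (rule \<theta>_pos)

end

subsection \<open>The observer error\<close>

locale observer_error =
  stable_tail a \<delta> N + lyapunov_matrix "N + 1" Q "\<lambda>i j. Amat a i j + l i * Cvec j" \<delta> + exosystem G \<theta> p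
  for a \<delta> :: real and N :: nat and Q :: "nat \<Rightarrow> nat \<Rightarrow> real" and l :: "nat \<Rightarrow> real"
    and G :: "real^2^2" and \<theta> :: real and p :: "real \<Rightarrow> real^2" +
  fixes b :: "nat \<Rightarrow> real^2" and B :: real and E :: "nat \<Rightarrow> real \<Rightarrow> real" and v :: "real \<Rightarrow> real \<Rightarrow> real"
  assumes b_le: "\<And>n. norm (b n) \<le> B"
    and cont_v: "\<And>t. t > 0 \<Longrightarrow> continuous_on {0..1} (v t)"
    and ip01_v: "\<And>n t. t > 0 \<Longrightarrow> ip01 (v t) (phi n) = E n t"
    and E_modes: "\<And>n t. t \<ge> 0 \<Longrightarrow>
        ((\<lambda>s. (a - (real n * pi)\<^sup>2) * E n s + b n \<bullet> p s + injection_mode N l n * v s 0)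
          has_integral (E n t - E n 0)) {0..t}"
begin

lemma continuous_on_E: "T \<ge> 0 \<Longrightarrow> continuous_on {T..} (E n)"
  by (rule continuous_on_subset[OF has_integral_imp_continuous_on[OF E_modes]]) auto

lemma DERIV_E:
  assumes "continuous_on {T..} (\<lambda>t. injection_mode N l n * v t 0)" "0 \<le> T" "T < t"
  shows "(E n has_real_derivative \<mu> n * E n t + b n \<bullet> p t + injection_mode N l n * v t 0) (at t)"
proof -
  have "continuous_on {T..} (\<lambda>t. (a - (real n * pi)\<^sup>2) * E n t + b n \<bullet> p t + injection_mode N l n * v t 0)"
    using assms by (intro continuous_on_add[OF _ assms(1)] continuous_intros continuous_on_E continuous_on_p)
  from has_integral_imp_DERIV[OF E_modes this assms(2,3)] show ?thesis by (simp add: \<mu>_def)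
qed

definition steady_state :: "nat \<Rightarrow> real^2" where
  "steady_state n = - (1 / (\<theta> + (\<mu> n)\<^sup>2)) *\<^sub>R (b n v* G + \<mu> n *\<^sub>R b n)"

lemma steady_state_equation:
  "steady_state n \<bullet> (G *v u) = \<mu> n * (steady_state n \<bullet> u) + b n \<bullet> u"
proof -
  have "\<theta> + (\<mu> n)\<^sup>2 > 0" using \<theta>_pos by (simp add: add_pos_nonneg)
  moreover have "(b n v* G) \<bullet> (G *v u) = - \<theta> * (b n \<bullet> u)" "(b n v* G) \<bullet> u = b n \<bullet> (G *v u)"
    by (simp_all add: dot_lmul_matrix G_square)
  ultimately show ?thesis
    unfolding steady_state_def inner_scaleR_left inner_add_left
    by (simp add: field_simps power2_eq_square)
qed

lemma steady_state_le:
  obtains C where "C \<ge> 0" "\<And>n. n > N \<Longrightarrow> norm (steady_state n) \<le> C * (1 / \<bar>\<mu> n\<bar>)"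
proof -
  obtain K where K: "\<And>u. norm (u v* G) \<le> norm u * K" "K > 0"
    using bounded_linear.pos_bounded[OF bounded_linear_vector_matrix_mult[of G]] by blast
  have B: "B \<ge> 0" using norm_ge_zero b_le order_trans by blast
  show thesis
  proof (rule that[of "B * K / \<delta> + B"])
    show "0 \<le> B * K / \<delta> + B" using B K(2) \<delta>_pos by simp
    fix n assume "n > N"
    then have \<mu>: "\<bar>\<mu> n\<bar> > \<delta>" "\<bar>\<mu> n\<bar> > 0" using \<mu>_less[of n] \<delta>_pos by auto
    have "norm (b n v* G) \<le> B * K" using order_trans[OF K(1) mult_right_mono[OF b_le]] K(2) by simp
    also have "\<dots> \<le> B * K / \<delta> * \<bar>\<mu> n\<bar>"
      using mult_left_mono[of \<delta> "\<bar>\<mu> n\<bar>" "B * K / \<delta>"] \<mu> B K(2) \<delta>_pos by simp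
    finally have "norm (b n v* G + \<mu> n *\<^sub>R b n) \<le> B * K / \<delta> * \<bar>\<mu> n\<bar> + \<bar>\<mu> n\<bar> * B"
      using b_le[of n] by (intro norm_triangle_mono) (auto simp: mult_left_mono)
    then have "norm (steady_state n) \<le> (1 / (\<theta> + (\<mu> n)\<^sup>2)) * ((B * K / \<delta> + B) * \<bar>\<mu> n\<bar>)"
      unfolding steady_state_def norm_scaleR using \<theta>_pos
      by (intro mult_mono) (auto simp: ring_distribs mult.commute)
    also have "\<dots> \<le> (1 / (\<mu> n)\<^sup>2) * ((B * K / \<delta> + B) * \<bar>\<mu> n\<bar>)"
      using \<mu> \<theta>_pos B K(2) \<delta>_pos by (intro mult_right_mono divide_left_mono) (auto simp: add_pos_nonneg)
    also have "\<dots> = (B * K / \<delta> + B) * (\<bar>\<mu> n\<bar> / \<bar>\<mu> n\<bar>\<^sup>2)" by simp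
    also have "\<bar>\<mu> n\<bar> / \<bar>\<mu> n\<bar>\<^sup>2 = 1 / \<bar>\<mu> n\<bar>"
      unfolding power2_eq_square using \<mu>(2) by (intro nonzero_divide_mult_cancel_left) simp
    finally show "norm (steady_state n) \<le> (B * K / \<delta> + B) * (1 / \<bar>\<mu> n\<bar>)" .
  qed
qed

lemma summable_steady_state: "summable (\<lambda>n. norm (steady_state n))"
proof -
  obtain C where C: "\<And>n. n > N \<Longrightarrow> norm (steady_state n) \<le> C * (1 / \<bar>\<mu> n\<bar>)"
    by (rule steady_state_le) blast
  show ?thesis
    by (rule summable_comparison_test'[OF summable_mult[OF summable_inverse_\<mu>[of 0]], of "N + 1" _ C]) (use C in auto)
qed

definition transient :: "nat \<Rightarrow> real \<Rightarrow> real" where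
  "transient n t = E n t - steady_state n \<bullet> p t"

lemma DERIV_transient:
  assumes "n > N" "t > 0"
  shows "(transient n has_real_derivative \<mu> n * transient n t) (at t)"
proof -
  have "injection_mode N l n = 0" using assms by (simp add: injection_mode_def)
  then have "(E n has_real_derivative \<mu> n * E n t + b n \<bullet> p t) (at t)"
    using DERIV_E[of 0 n t] assms by simp
  from DERIV_diff[OF this DERIV_inner_p[OF \<open>t > 0\<close>, of "steady_state n"]] show ?thesis
    by (simp add: transient_def[abs_def] steady_state_equation algebra_simps)
qed

lemma transient_bounded_at_1:
  obtains M where "\<And>n. \<bar>transient n 1\<bar> \<le> M"
proof -
  obtain M where M: "M \<ge> 0" "\<And>n. \<bar>ip01 (v 1) (phi n)\<bar> \<le> M"
    by (rule ip01_phi_bounded[OF cont_v[of 1]]) auto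
  obtain C where C: "\<And>n. norm (steady_state n) \<le> C"
    using summable_imp_bounded[OF summable_steady_state] by (auto simp: bounded_iff)
  have "\<bar>transient n 1\<bar> \<le> M + C * norm (p 1)" for n
  proof -
    have "\<bar>steady_state n \<bullet> p 1\<bar> \<le> C * norm (p 1)"
      by (rule order_trans[OF Cauchy_Schwarz_ineq2 mult_right_mono[OF C]]) simp
    then show ?thesis using M(2)[of n] ip01_v[of 1 n] by (simp add: transient_def)
  qed
  then show thesis by (rule that)
qed

lemma transient_le:
  obtains A where "summable A" "\<And>n t. n > N \<Longrightarrow> t \<ge> 2 \<Longrightarrow> \<bar>transient n t\<bar> \<le> A n * exp (- (\<delta> / 2) * t)"
proof -
  obtain M where M: "\<And>n. \<bar>transient n 1\<bar> \<le> M" by (rule transient_bounded_at_1) blast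
  show thesis
  proof (rule that[OF summable_mode_majorant])
    fix n t assume n: "n > N" and t: "(t::real) \<ge> 2"
    show "\<bar>transient n t\<bar> \<le> mode_majorant (\<delta> / 2) 1 M 0 n * exp (- (\<delta> / 2) * t)"
      by (rule stable_mode_bound[where g="\<lambda>_. 0"]) (use DERIV_transient[OF n] n t M \<delta>_pos in auto)
  qed
qed

definition steady_state_tail :: "real^2" where
  "steady_state_tail = (\<Sum>n. phi (n + (N + 1)) 0 *\<^sub>R steady_state (n + (N + 1)))"

lemma modal_tail_steady_state: "modal_tail (\<lambda>n. steady_state n \<bullet> u) = steady_state_tail \<bullet> u"
proof -
  have "summable (\<lambda>n. phi (n + (N + 1)) 0 *\<^sub>R steady_state (n + (N + 1)))"
  proof (rule summable_comparison_test')
    show "summable (\<lambda>n. sqrt 2 * norm (steady_state (n + (N + 1))))"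
      by (intro summable_mult summable_ignore_initial_segment[OF summable_steady_state])
    show "norm (phi (n + (N + 1)) 0 *\<^sub>R steady_state (n + (N + 1)))
        \<le> sqrt 2 * norm (steady_state (n + (N + 1)))" for n
      by (simp add: mult_right_mono abs_phi_le)
  qed
  from bounded_linear.suminf[OF bounded_linear_inner_left this, of u] show ?thesis
    by (simp add: modal_tail_def steady_state_tail_def mult.commute)
qed

lemma boundary_error_eq:
  assumes "t \<ge> 2"
  shows "v t 0 = (\<Sum>j<N+1. E j t * phi j 0) + steady_state_tail \<bullet> p t + modal_tail (\<lambda>n. transient n t)"
proof -
  obtain A where A: "summable A" "\<And>n t. n > N \<Longrightarrow> t \<ge> 2 \<Longrightarrow> \<bar>transient n t\<bar> \<le> A n * exp (- (\<delta> / 2) * t)"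
    by (rule transient_le) blast
  have summable_transient: "summable (\<lambda>n. \<bar>transient n t\<bar>)"
    by (rule summable_comparison_test'[OF summable_mult2[OF A(1)], of "N + 1" _ "exp (- (\<delta> / 2) * t)"])
       (use A(2) assms in auto)
  have summable_steady: "summable (\<lambda>n. \<bar>steady_state n \<bullet> p t\<bar>)"
    by (rule summable_comparison_test'[OF summable_mult2[OF summable_steady_state], of 0 _ "norm (p t)"])
       (simp add: Cauchy_Schwarz_ineq2)
  have E_eq: "E n t = steady_state n \<bullet> p t + transient n t" for n by (simp add: transient_def)
  have "summable (\<lambda>n. \<bar>E n t\<bar>)"
    by (rule summable_comparison_test'[OF summable_add[OF summable_steady summable_transient], of 0])
       (simp add: E_eq)
  then have "v t 0 = (\<Sum>j<N+1. E j t * phi j 0) + modal_tail (\<lambda>n. E n t)"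
    using boundary_value_eq[OF cont_v[of t]] assms by (simp add: ip01_v)
  also have "modal_tail (\<lambda>n. E n t) = steady_state_tail \<bullet> p t + modal_tail (\<lambda>n. transient n t)"
    unfolding E_eq modal_tail_steady_state[symmetric] by (rule modal_tail_add[OF summable_steady summable_transient])
  finally show ?thesis by simp
qed

lemma transient_tail_expdecay: "expdecay (\<lambda>t. modal_tail (\<lambda>n. transient n t))"
  and continuous_on_transient_tail: "continuous_on {2..} (\<lambda>t. modal_tail (\<lambda>n. transient n t))"
proof -
  obtain A where A: "summable A" "\<And>n t. n > N \<Longrightarrow> t \<ge> 2 \<Longrightarrow> \<bar>transient n t\<bar> \<le> A n * exp (- (\<delta> / 2) * t)"
    by (rule transient_le) blast
  show "expdecay (\<lambda>t. modal_tail (\<lambda>n. transient n t))"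
    by (rule modal_tail_expdecay[OF A(1) _ A(2)]) (use \<delta>_pos in auto)
  have "continuous_on {2..} (transient n)" if "n > N" for n
    by (rule DERIV_continuous_on[OF has_field_derivative_at_within[OF DERIV_transient]]) (use that in auto)
  then show "continuous_on {2..} (\<lambda>t. modal_tail (\<lambda>n. transient n t))"
    using \<delta>_pos by (intro continuous_on_modal_tail[OF A(1) _ A(2)]) auto
qed

lemma continuous_on_boundary_error: "continuous_on {2..} (\<lambda>t. v t 0)"
proof (rule continuous_on_eq)
  show "continuous_on {2..} (\<lambda>t. (\<Sum>j<N+1. E j t * phi j 0) + steady_state_tail \<bullet> p t
      + modal_tail (\<lambda>n. transient n t))"
    by (intro continuous_intros continuous_on_E continuous_on_p continuous_on_transient_tail) auto
qed (simp add: boundary_error_eq)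

lemma DERIV_deviation:
  assumes c: "c i v* G - mvec (N + 1) (\<lambda>i j. Amat a i j + l i * Cvec j) c i = l i *\<^sub>R steady_state_tail + b i"
    and i: "i < N + 1" and "t > 2"
  shows "((\<lambda>t. E i t - c i \<bullet> p t) has_real_derivative
    mvec (N + 1) (\<lambda>i j. Amat a i j + l i * Cvec j) (\<lambda>j. E j t - c j \<bullet> p t) i
      + l i * modal_tail (\<lambda>n. transient n t)) (at t)"
proof -
  let ?M = "\<lambda>i j. Amat a i j + l i * Cvec j"
  have "(E i has_real_derivative \<mu> i * E i t + b i \<bullet> p t + l i * v t 0) (at t)"
    using DERIV_E[OF continuous_on_mult_left[OF continuous_on_boundary_error], of t i] i \<open>t > 2\<close>
    by (simp add: injection_mode_def)
  from DERIV_diff[OF this DERIV_inner_p[of t "c i"]] \<open>t > 2\<close>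
  have deriv: "((\<lambda>t. E i t - c i \<bullet> p t) has_real_derivative
      (\<mu> i * E i t + b i \<bullet> p t + l i * v t 0) - c i \<bullet> (G *v p t)) (at t)" by simp
  have "c i \<bullet> (G *v p t) = (mvec (N + 1) ?M c i + (l i *\<^sub>R steady_state_tail + b i)) \<bullet> p t"
    using c by (simp add: dot_lmul_matrix[symmetric] algebra_simps)
  also have "\<dots> = mvec (N + 1) ?M (\<lambda>j. c j \<bullet> p t) i + l i * (steady_state_tail \<bullet> p t) + b i \<bullet> p t"
    by (simp add: mvec_def inner_add_left inner_sum_left)
  finally have steady: "c i \<bullet> (G *v p t) =
    mvec (N + 1) ?M (\<lambda>j. c j \<bullet> p t) i + l i * (steady_state_tail \<bullet> p t) + b i \<bullet> p t" .
  have "mvec (N + 1) ?M (\<lambda>j. E j t) i = mvec (N + 1) (Amat a) (\<lambda>j. E j t) i + l i * (\<Sum>j<N+1. E j t * phi j 0)"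
    by (simp add: mvec_def ring_distribs sum.distrib Cvec_def mult_ac sum_distrib_left del: sum.lessThan_Suc)
  then have "mvec (N + 1) ?M (\<lambda>j. E j t) i = \<mu> i * E i t + l i * (\<Sum>j<N+1. E j t * phi j 0)"
    using mvec_Amat[OF i, of a "\<lambda>j. E j t"] by (simp add: \<mu>_def)
  then show ?thesis
    using boundary_error_eq[of t] \<open>t > 2\<close>
    by (intro DERIV_cong[OF deriv]) (simp add: steady mvec_diff algebra_simps del: sum.lessThan_Suc)
qed

theorem boundary_error_tracks_exosystem:
  obtains q where "expdecay (\<lambda>t. v t 0 - q \<bullet> p t)"
proof -
  obtain c where c: "\<And>i. i < N + 1 \<Longrightarrow>
      c i v* G - mvec (N + 1) (\<lambda>i j. Amat a i j + l i * Cvec j) c i = l i *\<^sub>R steady_state_tail + b i"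
    by (rule sylvester_solvable[OF \<theta>_pos vec_mult_G_square, of "\<lambda>i. l i *\<^sub>R steady_state_tail + b i"]) blast
  have deviation: "expdecay (\<lambda>t. E i t - c i \<bullet> p t)" if "i < N + 1" for i
    by (rule linear_system_expdecay[where T=3, OF DERIV_deviation[OF c]
          expdecay_cmult[OF transient_tail_expdecay] that]) auto
  have "expdecay (\<lambda>t. (\<Sum>j<N+1. phi j 0 * (E j t - c j \<bullet> p t)) + modal_tail (\<lambda>n. transient n t))"
    by (intro expdecay_add expdecay_sum expdecay_cmult transient_tail_expdecay deviation) simp
  then have "expdecay (\<lambda>t. v t 0 - (steady_state_tail + (\<Sum>j<N+1. phi j 0 *\<^sub>R c j)) \<bullet> p t)"
    by (rule expdecay_cong[of _ 2])
       (simp add: boundary_error_eq inner_add_left inner_sum_left right_diff_distrib sum_subtractf mult.commute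
          del: sum.lessThan_Suc)
  then show thesis by (rule that)
qed

end

subsection \<open>The target system\<close>

locale target_system = stable_tail a \<delta> N + delay_lmi a \<delta> \<tau> N k P1 P2 P3 S R
  for a \<delta> \<tau> :: real and N :: nat and k :: "nat \<Rightarrow> real" and P1 P2 P3 S R :: "nat \<Rightarrow> nat \<Rightarrow> real" +
  fixes l :: "nat \<Rightarrow> real" and Z :: "nat \<Rightarrow> real \<Rightarrow> real" and z :: "real \<Rightarrow> real \<Rightarrow> real" and v r :: "real \<Rightarrow> real"
    and T :: real
  assumes DERIV_Z: "\<And>n t. t \<ge> T \<Longrightarrow> (Z n has_real_derivative (a - (real n * pi)\<^sup>2) * Z n t
        + phi n 1 * ((\<Sum>j\<le>N. k j * Z j (t - \<tau>)) + v t) - injection_mode N l n * r t) (at t)"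
    and v_expdecay: "expdecay v" and cont_v: "continuous_on {T..} v"
    and r_expdecay: "expdecay r" and cont_r: "continuous_on {T..} r"
    and cont_z: "\<And>t. t \<ge> T \<Longrightarrow> continuous_on {0..1} (z t)"
    and ip01_z: "\<And>n t. t \<ge> T \<Longrightarrow> ip01 (z t) (phi n) = Z n t"
begin

definition input :: "real \<Rightarrow> real" where
  "input t = (\<Sum>j\<le>N. k j * Z j (t - \<tau>)) + v t"

lemma continuous_on_Z: "continuous_on {T..} (Z n)"
  by (intro continuous_at_imp_continuous_on ballI DERIV_isCont[OF DERIV_Z]) simp

lemma continuous_on_input: "continuous_on {T + \<tau>..} input"
  unfolding input_def[abs_def] using \<tau>_pos
  by (intro continuous_intros continuous_on_compose2[OF continuous_on_Z] continuous_on_subset[OF cont_v]) auto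

lemma low_modes_expdecay:
  assumes "i < N + 1"
  shows "expdecay (Z i)"
proof -
  interpret delay_system a \<delta> \<tau> N k P1 P2 P3 S R Z "\<lambda>i t. \<mu> i * Z i t + phi i 1 * input t - l i * r t"
    "\<lambda>i t. phi i 1 * v t - l i * r t" "T + \<tau>"
  proof
    fix i t assume i: "i < N + 1" and t: "t \<ge> T + \<tau>"
    show "(Z i has_real_derivative \<mu> i * Z i t + phi i 1 * input t - l i * r t) (at t)"
      using DERIV_Z[of t i] i t \<tau>_pos by (simp add: \<mu>_def input_def injection_mode_def)
    show "\<mu> i * Z i t + phi i 1 * input t - l i * r t =
        delay_rhs (\<lambda>j. Z j t) (\<lambda>j. Z j (t - \<tau>)) i + (phi i 1 * v t - l i * r t)"
      unfolding delay_rhs_def mvec_Amat[OF i]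
      by (simp add: mvec_def input_def \<mu>_def Bvec_def sum_distrib_left lessThan_Suc_atMost algebra_simps
          del: sum.lessThan_Suc)
  next
    fix i
    show "continuous_on {T + \<tau>..} (\<lambda>t. \<mu> i * Z i t + phi i 1 * input t - l i * r t)"
      using \<tau>_pos
      by (intro continuous_intros continuous_on_input continuous_on_subset[OF continuous_on_Z]
          continuous_on_subset[OF cont_r]) auto
    show "expdecay (\<lambda>t. phi i 1 * v t - l i * r t)" by (intro expdecay_diff expdecay_cmult v_expdecay r_expdecay)
  qed
  show ?thesis using assms by (rule state_expdecay)
qed

lemma input_expdecay: "expdecay input"
  unfolding input_def[abs_def]
  by (intro expdecay_add expdecay_sum expdecay_cmult expdecay_shift low_modes_expdecay v_expdecay) simp

lemma high_modes_le:
  obtains A \<alpha> Tmin where "summable A" "\<alpha> > 0" "Tmin \<ge> T"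
    "\<And>n t. n > N \<Longrightarrow> t \<ge> Tmin \<Longrightarrow> \<bar>Z n t\<bar> \<le> A n * exp (- \<alpha> * t)"
proof -
  obtain \<alpha> K Ts where u: "0 < \<alpha>" "\<alpha> < \<delta>" "K \<ge> 0" "Ts \<ge> T" "\<And>t. t \<ge> Ts \<Longrightarrow> \<bar>input t\<bar> \<le> K * exp (- \<alpha> * t)"
    by (rule expdecayE[OF input_expdecay \<delta>_pos, where Tmin=T]) blast
  obtain M where M: "\<And>n. \<bar>ip01 (z Ts) (phi n)\<bar> \<le> M"
    by (rule ip01_phi_bounded[OF cont_z[OF u(4)]]) blast
  show thesis
  proof (rule that[of "mode_majorant \<alpha> Ts M (sqrt 2 * K)" \<alpha> "Ts + 1", OF summable_mode_majorant u(1)])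
    fix n t assume n: "n > N" and t: "(t::real) \<ge> Ts + 1"
    show "\<bar>Z n t\<bar> \<le> mode_majorant \<alpha> Ts M (sqrt 2 * K) n * exp (- \<alpha> * t)"
    proof (rule stable_mode_bound[where x="Z n" and g="\<lambda>t. phi n 1 * input t"])
      fix s assume s: "s \<ge> Ts"
      show "(Z n has_real_derivative \<mu> n * Z n s + phi n 1 * input s) (at s)"
        using DERIV_Z[of s n] s n u(4) by (simp add: \<mu>_def input_def injection_mode_def)
      have "\<bar>phi n 1\<bar> * \<bar>input s\<bar> \<le> sqrt 2 * (K * exp (- \<alpha> * s))"
        using u(5)[OF s] by (intro mult_mono) (auto simp: abs_phi_le)
      then show "\<bar>phi n 1 * input s\<bar> \<le> sqrt 2 * K * exp (- \<alpha> * s)" by (simp add: abs_mult mult.assoc)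
    qed (use M[of n] ip01_z[OF u(4)] u n t in auto)
  qed (use u in simp)
qed

theorem boundary_value_expdecay: "expdecay (\<lambda>t. z t 0)"
proof -
  obtain A \<alpha> Tmin where A: "summable A" "\<alpha> > 0" "Tmin \<ge> T"
    "\<And>n t. n > N \<Longrightarrow> t \<ge> Tmin \<Longrightarrow> \<bar>Z n t\<bar> \<le> A n * exp (- \<alpha> * t)"
    by (rule high_modes_le) blast
  have "expdecay (\<lambda>t. (\<Sum>n<N+1. phi n 0 * Z n t) + modal_tail (\<lambda>n. Z n t))"
    by (intro expdecay_add expdecay_sum expdecay_cmult low_modes_expdecay modal_tail_expdecay[OF A(1,2,4)]) auto
  then show ?thesis
  proof (rule expdecay_cong)
    fix t assume "t \<ge> Tmin"
    then have "summable (\<lambda>n. \<bar>ip01 (z t) (phi n)\<bar>)" "t \<ge> T"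
      using summable_comparison_test'[OF summable_mult2[OF A(1)], of "N + 1" "\<lambda>n. \<bar>Z n t\<bar>" "exp (- \<alpha> * t)"] A(3,4)
      by (auto simp: ip01_z)
    then show "z t 0 = (\<Sum>n<N+1. phi n 0 * Z n t) + modal_tail (\<lambda>n. Z n t)"
      using boundary_value_eq[OF cont_z] by (simp add: ip01_z mult.commute)
  qed
qed

end

section \<open>The closed loop\<close>

lemma inner_vector_2: "x \<bullet> (vector [u, v] :: real^2) = x $ 1 * u + x $ 2 * v"
  by (simp add: inner_vec_def sum_2)

lemma norm_vector_2_le: "norm (vector [u, v] :: real^2) \<le> \<bar>u\<bar> + \<bar>v\<bar>"
  using norm_le_l1_cart[of "vector [u, v] :: real^2"] by (simp add: sum_2)

lemma expdecay_inner_bounded: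
  fixes x y :: "real \<Rightarrow> 'a::real_inner"
  assumes "expdecay (\<lambda>t. norm (x t))" "(\<lambda>t. norm (y t)) \<in> O(\<lambda>_. 1)"
  shows "expdecay (\<lambda>t. x t \<bullet> y t)"
  by (rule expdecay_bigo[OF bigo_geI[of 0 _ 1] expdecay_mult_bounded[OF assms]]) (simp add: Cauchy_Schwarz_ineq2)

lemma expdecay_lipschitz_inner:
  fixes \<psi> :: "real \<Rightarrow> 'a::real_inner" and x x\<^sub>0 :: "real \<Rightarrow> 'a" and th :: "real \<Rightarrow> real"
  assumes \<psi>: "lipschitz_on_cballs \<psi>" and th: "th \<in> O(\<lambda>_. 1)"
    and x: "expdecay (\<lambda>t. norm (x t - x\<^sub>0 t))" and x\<^sub>0: "(\<lambda>t. norm (x\<^sub>0 t)) \<in> O(\<lambda>_. 1)"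
    and alt: "expdecay (\<lambda>t. th t - \<theta>) \<or> (\<forall>t\<ge>T. x\<^sub>0 t = 0)"
  shows "expdecay (\<lambda>t. \<psi> (th t) \<bullet> x t - \<psi> \<theta> \<bullet> x\<^sub>0 t)"
proof -
  obtain B Tb where B: "B > 0" "\<And>t. t \<ge> Tb \<Longrightarrow> \<bar>th t\<bar> \<le> B" by (rule bigo_const_1E[OF th]) blast
  obtain C where C: "\<And>y. norm y \<le> B \<Longrightarrow> norm (\<psi> y) \<le> C" by (rule lipschitz_on_cballs_bounded[OF \<psi>]) blast
  have "(\<lambda>t. norm (\<psi> (th t))) \<in> O(\<lambda>_. 1)"
    by (rule bigo_geI[of Tb _ C]) (use B(2) C in auto)
  with x have estimate_error: "expdecay (\<lambda>t. (x t - x\<^sub>0 t) \<bullet> \<psi> (th t))" by (rule expdecay_inner_bounded)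
  from alt have "expdecay (\<lambda>t. (\<psi> (th t) - \<psi> \<theta>) \<bullet> x\<^sub>0 t)"
  proof
    assume decay: "expdecay (\<lambda>t. th t - \<theta>)"
    obtain L where L: "L-lipschitz_on (cball 0 (B + \<bar>\<theta>\<bar>)) \<psi>" by (rule lipschitz_on_cballsE[OF \<psi>])
    have "(\<lambda>t. norm (\<psi> (th t) - \<psi> \<theta>)) \<in> O(\<lambda>t. th t - \<theta>)"
    proof (rule bigo_geI[of Tb _ L])
      fix t assume "t \<ge> Tb"
      then have "norm (\<psi> (th t) - \<psi> \<theta>) \<le> L * norm (th t - \<theta>)"
        using B(1) B(2)[of t] by (intro lipschitz_on_normD[OF L]) auto
      then show "\<bar>norm (\<psi> (th t) - \<psi> \<theta>)\<bar> \<le> L * \<bar>th t - \<theta>\<bar>" by simp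
    qed
    then show ?thesis by (rule expdecay_inner_bounded[OF expdecay_bigo[OF _ decay] x\<^sub>0])
  next
    assume "\<forall>t\<ge>T. x\<^sub>0 t = 0"
    then show ?thesis by (intro expdecay_cong[OF expdecay_0, of T]) auto
  qed
  from expdecay_add[OF estimate_error this] show ?thesis
    by (rule expdecay_cong[of _ 0]) (simp add: inner_diff_left inner_diff_right inner_commute)
qed

locale closed_loop =
  stable_tail a \<delta> N + regulator_profile a N l f f' + delay_lmi a \<delta> \<tau> N k P1 P2 P3 S R
  + lyapunov_matrix "N + 1" Q "\<lambda>i j. Amat a i j + l i * Cvec j" \<delta> + exosystem G "\<omega>\<^sup>2" p
  for a \<delta> \<tau> :: real and N :: nat and k l :: "nat \<Rightarrow> real" and f f' :: "real \<Rightarrow> real \<Rightarrow> real^2"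
    and P1 P2 P3 S R Q :: "nat \<Rightarrow> nat \<Rightarrow> real" and G :: "real^2^2" and \<omega> :: real and p :: "real \<Rightarrow> real^2" +
  fixes \<iota> \<mu>0 \<mu>1 :: real and d1 :: "real \<Rightarrow> real^2" and d2 d3 d4 :: "real^2"
    and w eh :: "real \<Rightarrow> real \<Rightarrow> real" and \<xi> \<chi>1 \<phi>h \<theta>h U :: "real \<Rightarrow> real"
  assumes \<omega>_pos: "\<omega> > 0" and gains: "\<iota> > 0" "\<mu>0 > 1 / (4 * \<iota>)" "\<mu>1 > 0" and d1_Linf: "Linf_01 d1"
    and w_cont: "\<And>t. t > 0 \<Longrightarrow> continuous_on {0..1} (\<lambda>x. w x t)"
    and w_modes: "\<And>n t. t \<ge> 0 \<Longrightarrow>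
        ((\<lambda>s. (a - (real n * pi)\<^sup>2) * ip01 (\<lambda>x. w x s) (phi n)
              + phi n 1 * (U (s - \<tau>) + d3 \<bullet> p s) - phi n 0 * (d2 \<bullet> p s)
              + ipv01 d1 (phi n) \<bullet> p s)
          has_integral (ip01 (\<lambda>x. w x t) (phi n) - ip01 (\<lambda>x. w x 0) (phi n))) {0..t}"
    and eh_cont: "\<And>t. t > 0 \<Longrightarrow> continuous_on {0..1} (\<lambda>x. eh x t)"
    and eh_modes: "\<And>n t. t \<ge> 0 \<Longrightarrow>
        ((\<lambda>s. (a - (real n * pi)\<^sup>2) * ip01 (\<lambda>x. eh x s) (phi n)
              + phi n 1 * U (s - \<tau>)
              + ip01 (\<lambda>x. \<Sum>j\<le>N. l j * phi j x) (phi n) * (eh 0 s - (w 0 s - d4 \<bullet> p s)))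
          has_integral (ip01 (\<lambda>x. eh x t) (phi n) - ip01 (\<lambda>x. eh x 0) (phi n))) {0..t}"
    and xi_ode: "\<And>t. t \<ge> 0 \<Longrightarrow>
        ((\<lambda>s. - \<iota> * \<xi> s - ((w 0 s - d4 \<bullet> p s) - eh 0 s)) has_integral (\<xi> t - \<xi> 0)) {0..t}"
    and chi_ode: "\<And>t. t \<ge> 0 \<Longrightarrow>
        ((\<lambda>s. \<phi>h s + \<iota> * ((w 0 s - d4 \<bullet> p s) - eh 0 s) + \<theta>h s * \<xi> s
              + \<mu>0 * (((w 0 s - d4 \<bullet> p s) - eh 0 s) - \<chi>1 s)) has_integral (\<chi>1 t - \<chi>1 0)) {0..t}"
    and phi_ode: "\<And>t. t \<ge> 0 \<Longrightarrow>
        ((\<lambda>s. - \<iota> * \<phi>h s - \<iota>\<^sup>2 * ((w 0 s - d4 \<bullet> p s) - eh 0 s)) has_integral (\<phi>h t - \<phi>h 0)) {0..t}"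
    and theta_ode: "\<And>t. t \<ge> 0 \<Longrightarrow>
        ((\<lambda>s. \<mu>1 * \<xi> s * (((w 0 s - d4 \<bullet> p s) - eh 0 s) - \<chi>1 s)) has_integral (\<theta>h t - \<theta>h 0)) {0..t}"
    and U_def: "\<And>t. t \<ge> 0 \<Longrightarrow>
        U t = (let dh = vector [\<chi>1 t, \<phi>h t + \<xi> t * \<theta>h t + \<iota> * \<chi>1 t] :: real^2 in
                 (\<Sum>n\<le>N. k n * ip01 (\<lambda>x. eh x t) (phi n))
               + (\<Sum>n\<le>N. k n *\<^sub>R ipv01 (\<lambda>x. f x (\<theta>h t)) (phi n)) \<bullet> dh
               - f' 1 (\<theta>h t) \<bullet> (mexp (\<tau> *\<^sub>R Sc (\<theta>h t)) *v dh))"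
begin

lemma \<mu>0_pos: "\<mu>0 > 0"
  using gains(1) by (intro less_trans[OF _ gains(2)]) simp

definition plant_mode :: "nat \<Rightarrow> real \<Rightarrow> real" where
  "plant_mode n t = ip01 (\<lambda>x. w x t) (phi n)"

definition observer_mode :: "nat \<Rightarrow> real \<Rightarrow> real" where
  "observer_mode n t = ip01 (\<lambda>x. eh x t) (phi n)"

definition innovation :: "real \<Rightarrow> real" where
  "innovation t = (w 0 t - d4 \<bullet> p t) - eh 0 t"

definition disturbance_mode :: "nat \<Rightarrow> real^2" where
  "disturbance_mode n = phi n 1 *\<^sub>R d3 - phi n 0 *\<^sub>R d2 + ipv01 d1 (phi n) - injection_mode N l n *\<^sub>R d4"

definition estimate :: "real \<Rightarrow> real^2" where
  "estimate t = vector [\<chi>1 t, \<phi>h t + \<xi> t * \<theta>h t + \<iota> * \<chi>1 t]"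

lemma observer_mode_equation:
  assumes "t \<ge> 0"
  shows "((\<lambda>s. (a - (real n * pi)\<^sup>2) * observer_mode n s + phi n 1 * U (s - \<tau>) - injection_mode N l n * innovation s)
    has_integral (observer_mode n t - observer_mode n 0)) {0..t}"
  using eh_modes[OF assms, of n] unfolding observer_mode_def ip01_injection innovation_def
  by (simp add: algebra_simps)

lemma error_mode_equation:
  assumes "t \<ge> 0"
  shows "((\<lambda>s. (a - (real n * pi)\<^sup>2) * (plant_mode n s - observer_mode n s) + disturbance_mode n \<bullet> p s
      + injection_mode N l n * (w 0 s - eh 0 s))
    has_integral ((plant_mode n t - observer_mode n t) - (plant_mode n 0 - observer_mode n 0))) {0..t}"
  using has_integral_diff[OF w_modes[OF assms, of n] eh_modes[OF assms, of n]]
  unfolding ip01_injection disturbance_mode_def plant_mode_def observer_mode_def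
    inner_diff_left inner_add_left inner_scaleR_left
  by (simp add: algebra_simps)

lemma disturbance_mode_bounded: obtains B where "\<And>n. norm (disturbance_mode n) \<le> B"
proof -
  obtain B where B: "\<And>x. x \<in> {0..1} \<Longrightarrow> norm (d1 x) \<le> B" using d1_Linf unfolding Linf_01_def by blast
  have "norm (disturbance_mode n) \<le>
    (sqrt 2 * norm d3 + sqrt 2 * norm d2 + sqrt 2 * B) + (\<Sum>j\<le>N. \<bar>l j\<bar>) * norm d4" for n
    unfolding disturbance_mode_def
  proof (intro norm_triangle_le_diff norm_triangle_le add_mono norm_ipv01_phi_le[OF B])
    show "norm (phi n 1 *\<^sub>R d3) \<le> sqrt 2 * norm d3" "norm (phi n 0 *\<^sub>R d2) \<le> sqrt 2 * norm d2"
      by (simp_all add: abs_phi_le mult_right_mono)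
    have "\<bar>injection_mode N l n\<bar> \<le> (\<Sum>j\<le>N. \<bar>l j\<bar>)"
      unfolding injection_mode_def by (cases "n \<le> N") (auto intro: member_le_sum sum_nonneg)
    then show "norm (injection_mode N l n *\<^sub>R d4) \<le> (\<Sum>j\<le>N. \<bar>l j\<bar>) * norm d4" by (simp add: mult_right_mono)
  qed
  then show thesis by (rule that)
qed

lemma innovation_tracks_exosystem:
  obtains q where "expdecay (\<lambda>t. innovation t - q \<bullet> p t)" "continuous_on {2..} innovation"
proof -
  obtain B where B: "\<And>n. norm (disturbance_mode n) \<le> B" by (rule disturbance_mode_bounded) blast
  interpret error: observer_error a \<delta> N Q l G "\<omega>\<^sup>2" p disturbance_mode B
    "\<lambda>n t. plant_mode n t - observer_mode n t" "\<lambda>t x. w x t - eh x t"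
  proof
    show "continuous_on {0..1} (\<lambda>x. w x t - eh x t)" if "t > 0" for t
      by (intro continuous_intros w_cont eh_cont that)
    show "ip01 (\<lambda>x. w x t - eh x t) (phi n) = plant_mode n t - observer_mode n t" if "t > 0" for n t
      unfolding plant_mode_def observer_mode_def by (intro ip01_diff_left w_cont eh_cont that continuous_on_phi)
  qed (rule B error_mode_equation, assumption?)+
  have innovation_eq: "innovation t = (w 0 t - eh 0 t) - d4 \<bullet> p t" for t by (simp add: innovation_def)
  obtain q where "expdecay (\<lambda>t. (w 0 t - eh 0 t) - q \<bullet> p t)" by (rule error.boundary_error_tracks_exosystem)
  then have "expdecay (\<lambda>t. innovation t - (q - d4) \<bullet> p t)" by (simp add: innovation_eq inner_diff_left algebra_simps)
  moreover have "continuous_on {2..} innovation"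
    unfolding innovation_eq[abs_def]
    by (intro continuous_intros error.continuous_on_boundary_error continuous_on_p) simp
  ultimately show thesis by (rule that)
qed

lemma U_eq:
  assumes "t \<ge> 0"
  shows "U t = (\<Sum>n\<le>N. k n * observer_mode n t) + control_gain k \<tau> (\<theta>h t) \<bullet> estimate t"
  unfolding U_def[OF assms] Let_def observer_mode_def estimate_def control_gain_def mode_def
    inner_diff_left dot_lmul_matrix by simp

lemma continuous_on_states:
  assumes "T \<ge> 0"
  shows "continuous_on {T..} \<xi>" "continuous_on {T..} \<chi>1" "continuous_on {T..} \<phi>h" "continuous_on {T..} \<theta>h"
    "continuous_on {T..} (observer_mode n)"
  by (rule continuous_on_subset[OF has_integral_imp_continuous_on],
      rule xi_ode chi_ode phi_ode theta_ode observer_mode_equation, assumption, use assms in simp)+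

lemma continuous_on_U: "continuous_on {0..} U"
proof (rule continuous_on_eq)
  show "continuous_on {0..} (\<lambda>t. (\<Sum>n\<le>N. k n * observer_mode n t)
      + (control_gain k \<tau> (\<theta>h t) $ 1 * \<chi>1 t + control_gain k \<tau> (\<theta>h t) $ 2 * (\<phi>h t + \<xi> t * \<theta>h t + \<iota> * \<chi>1 t)))"
    by (intro continuous_intros continuous_on_states
        continuous_on_compose2[OF lipschitz_on_cballs_imp_continuous_on[OF lipschitz_on_cballs_control_gain]]) auto
qed (simp add: U_eq estimate_def inner_vector_2)

end

locale tracked_closed_loop = closed_loop +
  fixes q :: "real^2"
  assumes innovation_tracks: "expdecay (\<lambda>t. innovation t - q \<bullet> p t)"
    and cont_innovation: "continuous_on {2..} innovation"
begin

sublocale observer: adaptive_observer "\<omega>\<^sup>2" 3 "\<lambda>t. q \<bullet> p t" "\<lambda>t. q \<bullet> (G *v p t)" \<iota> \<mu>0 \<mu>1 innovation \<xi> \<chi>1 \<phi>h \<theta>h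
proof -
  interpret oscillator "\<omega>\<^sup>2" 3 "\<lambda>t. q \<bullet> p t" "\<lambda>t. q \<bullet> (G *v p t)" by (rule oscillator_inner_p) simp
  show "adaptive_observer (\<omega>\<^sup>2) 3 (\<lambda>t. q \<bullet> p t) (\<lambda>t. q \<bullet> (G *v p t)) \<iota> \<mu>0 \<mu>1 innovation \<xi> \<chi>1 \<phi>h \<theta>h"
  proof
    fix t :: real assume t: "t \<ge> 3"
    show "(\<xi> has_real_derivative - \<iota> * \<xi> t - innovation t) (at t)"
      by (rule has_integral_imp_DERIV[OF xi_ode[folded innovation_def], where T=2])
         (use t in \<open>auto intro!: continuous_intros continuous_on_states cont_innovation\<close>)
    show "(\<chi>1 has_real_derivative \<phi>h t + \<iota> * innovation t + \<theta>h t * \<xi> t + \<mu>0 * (innovation t - \<chi>1 t)) (at t)"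
      by (rule has_integral_imp_DERIV[OF chi_ode[folded innovation_def], where T=2])
         (use t in \<open>auto intro!: continuous_intros continuous_on_states cont_innovation\<close>)
    show "(\<phi>h has_real_derivative - \<iota> * \<phi>h t - \<iota>\<^sup>2 * innovation t) (at t)"
      by (rule has_integral_imp_DERIV[OF phi_ode[folded innovation_def], where T=2])
         (use t in \<open>auto intro!: continuous_intros continuous_on_states cont_innovation\<close>)
    show "(\<theta>h has_real_derivative \<mu>1 * \<xi> t * (innovation t - \<chi>1 t)) (at t)"
      by (rule has_integral_imp_DERIV[OF theta_ode[folded innovation_def], where T=2])
         (use t in \<open>auto intro!: continuous_intros continuous_on_states cont_innovation\<close>)
  qed (rule gains \<mu>0_pos innovation_tracks)+
qed

definition regulator_state :: "real \<Rightarrow> real^2" where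
  "regulator_state t = vector [q \<bullet> p t, q \<bullet> (G *v p t)]"

lemma continuous_on_inner_regulator_state: "T \<ge> 0 \<Longrightarrow> continuous_on {T..} (\<lambda>t. u \<bullet> regulator_state t)"
  unfolding regulator_state_def inner_vector_2
  by (intro continuous_intros continuous_on_p bounded_linear.continuous_on[OF matrix_vector_mul_bounded_linear])

lemma DERIV_inner_regulator_state:
  assumes "t \<ge> 3"
  shows "((\<lambda>t. u \<bullet> regulator_state t) has_real_derivative u \<bullet> (Sc (\<omega>\<^sup>2) *v regulator_state t)) (at t)"
proof -
  have "Sc (\<omega>\<^sup>2) *v regulator_state t = vector [q \<bullet> (G *v p t), - (\<omega>\<^sup>2) * (q \<bullet> p t)]"
    by (simp add: vec_eq_iff forall_2 Sc_mult_vec regulator_state_def)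
  then show ?thesis
    unfolding regulator_state_def inner_vector_2
    using observer.DERIV_u[OF assms] observer.DERIV_v[OF assms]
    by (auto intro!: derivative_eq_intros simp: inner_vector_2)
qed

lemma control_gain_estimate_expdecay:
  "expdecay (\<lambda>t. control_gain k \<tau> (\<theta>h t) \<bullet> estimate t - control_gain k \<tau> (\<omega>\<^sup>2) \<bullet> regulator_state t)"
proof (rule expdecay_lipschitz_inner[OF lipschitz_on_cballs_control_gain observer.\<theta>h_bounded, where T=3])
  let ?e1 = "\<lambda>t. \<chi>1 t - q \<bullet> p t" and ?e2 = "\<lambda>t. \<phi>h t + \<xi> t * \<theta>h t + \<iota> * \<chi>1 t - q \<bullet> (G *v p t)"
  have estimate_error: "estimate t - regulator_state t = vector [?e1 t, ?e2 t]" for t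
    by (simp add: vec_eq_iff forall_2 estimate_def regulator_state_def)
  show "expdecay (\<lambda>t. norm (estimate t - regulator_state t))"
    unfolding estimate_error
    by (rule expdecay_bigo[OF bigo_geI[of 0 _ 1] expdecay_add[OF expdecay_abs expdecay_abs,
          OF observer.\<chi>1_tracks_d1 observer.second_estimate_tracks_d2]])
       (simp add: norm_vector_2_le)
  have "(\<lambda>t. \<bar>q \<bullet> p t\<bar> + \<bar>q \<bullet> (G *v p t)\<bar>) \<in> O(\<lambda>_. 1)"
    by (rule sum_in_bigo(1)) (use observer.bounded in simp_all)
  then show "(\<lambda>t. norm (regulator_state t)) \<in> O(\<lambda>_. 1)"
    by (rule landau_o.big.trans[OF bigo_geI[of 0 _ 1], rotated]) (simp add: regulator_state_def norm_vector_2_le)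
  show "expdecay (\<lambda>t. \<theta>h t - \<omega>\<^sup>2) \<or> (\<forall>t\<ge>3. regulator_state t = 0)"
    using observer.\<theta>h_converges_or_trivial by (auto simp: regulator_state_def vec_eq_iff forall_2)
qed

definition target_mode :: "nat \<Rightarrow> real \<Rightarrow> real" where
  "target_mode n t = observer_mode n t + mode n (\<omega>\<^sup>2) \<bullet> regulator_state t"

definition input_mismatch :: "real \<Rightarrow> real" where
  "input_mismatch t = U (t - \<tau>) + f' 1 (\<omega>\<^sup>2) \<bullet> regulator_state t - (\<Sum>j\<le>N. k j * target_mode j (t - \<tau>))"

lemma input_mismatch_eq:
  assumes "t \<ge> \<tau> + 3"
  shows "input_mismatch t = control_gain k \<tau> (\<theta>h (t - \<tau>)) \<bullet> estimate (t - \<tau>)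
    - control_gain k \<tau> (\<omega>\<^sup>2) \<bullet> regulator_state (t - \<tau>)"
proof -
  define s where "s = t - \<tau>"
  have s: "s \<ge> 3" "t = s + \<tau>" using assms by (auto simp: s_def)
  have "regulator_state (s + \<tau>) = mexp (\<tau> *\<^sub>R Sc (\<omega>\<^sup>2)) *v regulator_state s"
    unfolding regulator_state_def
    by (rule oscillator_flow[OF observer.oscillator_axioms]) (use s \<tau>_pos \<omega>_pos in auto)
  then have "f' 1 (\<omega>\<^sup>2) \<bullet> regulator_state t = (f' 1 (\<omega>\<^sup>2) v* mexp (\<tau> *\<^sub>R Sc (\<omega>\<^sup>2))) \<bullet> regulator_state s"
    by (simp add: s dot_lmul_matrix)
  moreover have "(\<Sum>j\<le>N. k j * target_mode j s) =
      (\<Sum>j\<le>N. k j * observer_mode j s) + (\<Sum>j\<le>N. k j *\<^sub>R mode j (\<omega>\<^sup>2)) \<bullet> regulator_state s"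
    by (simp add: target_mode_def distrib_left sum.distrib inner_sum_left)
  ultimately show ?thesis
    using s by (simp add: input_mismatch_def U_eq control_gain_def inner_diff_left)
qed

lemma continuous_on_delayed_U: "T \<ge> \<tau> \<Longrightarrow> continuous_on {T..} (\<lambda>t. U (t - \<tau>))"
  by (rule continuous_on_compose2[OF continuous_on_U]) (auto intro!: continuous_intros)

lemma continuous_on_input_mismatch: "continuous_on {\<tau> + 3..} input_mismatch"
proof -
  have "continuous_on {0..} (target_mode n)" for n
    unfolding target_mode_def[abs_def]
    by (intro continuous_intros continuous_on_states continuous_on_inner_regulator_state) auto
  then have "continuous_on {\<tau> + 3..} (\<lambda>t. target_mode n (t - \<tau>))" for n
    by (rule continuous_on_compose2) (auto intro!: continuous_intros)
  then show ?thesis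
    unfolding input_mismatch_def[abs_def] using \<tau>_pos
    by (intro continuous_intros continuous_on_delayed_U continuous_on_inner_regulator_state) auto
qed

lemma DERIV_target_mode:
  assumes "t \<ge> \<tau> + 3"
  shows "(target_mode n has_real_derivative (a - (real n * pi)\<^sup>2) * target_mode n t
      + phi n 1 * ((\<Sum>j\<le>N. k j * target_mode j (t - \<tau>)) + input_mismatch t)
      - injection_mode N l n * (innovation t - q \<bullet> p t)) (at t)"
proof -
  have t: "t \<ge> 3" "\<tau> + 2 \<ge> 0" "\<tau> + 2 < t" using assms \<tau>_pos by auto
  have "(observer_mode n has_real_derivative
      (a - (real n * pi)\<^sup>2) * observer_mode n t + phi n 1 * U (t - \<tau>) - injection_mode N l n * innovation t) (at t)"
    by (rule has_integral_imp_DERIV[OF observer_mode_equation _ t(2,3)])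
       (use \<tau>_pos in \<open>auto intro!: continuous_intros continuous_on_delayed_U continuous_on_states
          continuous_on_subset[OF cont_innovation]\<close>)
  from DERIV_add[OF this DERIV_inner_regulator_state[OF t(1), of "mode n (\<omega>\<^sup>2)"]]
  have deriv: "(target_mode n has_real_derivative
      (a - (real n * pi)\<^sup>2) * observer_mode n t + phi n 1 * U (t - \<tau>) - injection_mode N l n * innovation t
      + mode n (\<omega>\<^sup>2) \<bullet> (Sc (\<omega>\<^sup>2) *v regulator_state t)) (at t)"
    unfolding target_mode_def[abs_def] .
  have "mode n (\<omega>\<^sup>2) \<bullet> (Sc (\<omega>\<^sup>2) *v regulator_state t) = (mode n (\<omega>\<^sup>2) v* Sc (\<omega>\<^sup>2)) \<bullet> regulator_state t"
    by (simp add: dot_lmul_matrix)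
  also have "\<dots> = (a - (real n * pi)\<^sup>2) * (mode n (\<omega>\<^sup>2) \<bullet> regulator_state t)
      + phi n 1 * (f' 1 (\<omega>\<^sup>2) \<bullet> regulator_state t) + injection_mode N l n * (q \<bullet> p t)"
    by (simp add: mode_equation inner_add_left inner_vector_2 gamma_c_def regulator_state_def algebra_simps)
  finally show ?thesis
    by (intro DERIV_cong[OF deriv]) (simp add: input_mismatch_def target_mode_def algebra_simps)
qed

theorem tracking_error_expdecay: "expdecay (\<lambda>t. w 0 t - d4 \<bullet> p t)"
proof -
  interpret target: target_system a \<delta> \<tau> N k P1 P2 P3 S R l target_mode
    "\<lambda>t x. eh x t + f x (\<omega>\<^sup>2) \<bullet> regulator_state t" input_mismatch "\<lambda>t. innovation t - q \<bullet> p t" "\<tau> + 3"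
  proof
    show "expdecay input_mismatch"
      by (rule expdecay_cong[OF expdecay_shift[OF control_gain_estimate_expdecay]]) (rule input_mismatch_eq)
    show "continuous_on {\<tau> + 3..} (\<lambda>t. innovation t - q \<bullet> p t)"
      using \<tau>_pos by (intro continuous_intros continuous_on_subset[OF cont_innovation] continuous_on_p) auto
    fix t assume "t \<ge> \<tau> + 3"
    then have t: "t > 0" using \<tau>_pos by simp
    have profile: "continuous_on {0..1} (\<lambda>x. f x (\<omega>\<^sup>2) \<bullet> regulator_state t)"
      by (intro continuous_intros continuous_on_f)
    show "continuous_on {0..1} (\<lambda>x. eh x t + f x (\<omega>\<^sup>2) \<bullet> regulator_state t)"
      by (intro continuous_intros profile eh_cont t)
    show "ip01 (\<lambda>x. eh x t + f x (\<omega>\<^sup>2) \<bullet> regulator_state t) (phi n) = target_mode n t" for n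
      unfolding target_mode_def observer_mode_def ip01_f_inner[symmetric]
      by (intro ip01_add_left eh_cont t profile continuous_on_phi)
  qed (rule DERIV_target_mode continuous_on_input_mismatch innovation_tracks, assumption?)+
  from expdecay_add[OF target.boundary_value_expdecay innovation_tracks] show ?thesis
    by (simp add: f_0 gamma_c_def regulator_state_def inner_vector_2 innovation_def)
qed

end

theorem (in closed_loop) output_regulation: "expdecay (\<lambda>t. w 0 t - d4 \<bullet> p t)"
proof -
  obtain q where "expdecay (\<lambda>t. innovation t - q \<bullet> p t)" "continuous_on {2..} innovation"
    by (rule innovation_tracks_exosystem)
  then interpret tracked_closed_loop a \<delta> \<tau> N k l f f' P1 P2 P3 S R Q G \<omega> p \<iota> \<mu>0 \<mu>1 d1 d2 d3 d4 w eh \<xi> \<chi>1 \<phi>h \<theta>h U q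
    by unfold_locales
  show ?thesis by (rule tracking_error_expdecay)
qed

theorem theorem2:
  fixes a \<tau> \<delta> \<iota> \<mu>0 \<mu>1 :: real
    and d1 :: "real \<Rightarrow> real^2" and d2 d3 d4 :: "real^2" and G :: "real^2^2"
    and N :: nat and k l :: "nat \<Rightarrow> real"
    and f f' :: "real \<Rightarrow> real \<Rightarrow> real^2"
    and w eh :: "real \<Rightarrow> real \<Rightarrow> real"
    and p :: "real \<Rightarrow> real^2"
    and \<xi> \<chi>1 \<phi>h \<theta>h U :: "real \<Rightarrow> real"
  assumes tau_pos: "\<tau> > 0"
    and d1_Linf: "Linf_01 d1"
    and G_spec: "\<exists>\<omega>>0. cspectrum G = {\<i> * complex_of_real \<omega>, - \<i> * complex_of_real \<omega>}"
    and delta_pos: "\<delta> > 0"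
    and N_tail: "\<forall>n>N. a - (real n * pi)\<^sup>2 < - \<delta>"
    and LMI: "\<exists>P1 P2 P3 S R Q :: nat \<Rightarrow> nat \<Rightarrow> real.
        posdef (N+1) P1 \<and> posdef (N+1) S \<and> posdef (N+1) R \<and> posdef (N+1) Q \<and>
        negdef (3 * (N+1)) (Phi a N k \<delta> \<tau> P1 P2 P3 S R) \<and>
        negdef (N+1) (\<lambda>i j. let ALC = (\<lambda>i j. Amat a i j + l i * Cvec j) in
             mmul (N+1) Q ALC i j + mmul (N+1) (mtr ALC) Q i j + 2 * \<delta> * Q i j)"
    and gains: "\<iota> > 0" "\<mu>0 > 1 / (4 * \<iota>)" "\<mu>1 > 0"
    \<comment> \<open>f(.,theta) solves f'' = f S_c(theta) - a f - L(x) f(0), f'(0) = 0, f(0) = gamma_c on [0,1];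
        f' is its x-derivative\<close>
    and f_ode: "\<And>th x. x \<in> {0..1} \<Longrightarrow>
        ((\<lambda>y. f y th) has_vector_derivative f' x th) (at x within {0..1}) \<and>
        ((\<lambda>y. f' y th) has_vector_derivative
           (f x th v* Sc th - a *\<^sub>R f x th - (\<Sum>n\<le>N. l n * phi n x) *\<^sub>R f 0 th)) (at x within {0..1})"
    and f_init: "\<And>th. f' 0 th = 0" "\<And>th. f 0 th = gamma_c"
    \<comment> \<open>initial data of the PDE states in L2(0,1)\<close>
    and w0_L2: "L2_01 (\<lambda>x. w x 0)" and eh0_L2: "L2_01 (\<lambda>x. eh x 0)"
    \<comment> \<open>(weak) solution of the closed-loop system for t \<ge> 0\<close>
    and w_L2: "\<And>t. t \<ge> 0 \<Longrightarrow> L2_01 (\<lambda>x. w x t)"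
    and w_cont: "\<And>t. t > 0 \<Longrightarrow> continuous_on {0..1} (\<lambda>x. w x t)"
    and w_modes: "\<And>n t. t \<ge> 0 \<Longrightarrow>
        ((\<lambda>s. (a - (real n * pi)\<^sup>2) * ip01 (\<lambda>x. w x s) (phi n)
              + phi n 1 * (U (s - \<tau>) + d3 \<bullet> p s) - phi n 0 * (d2 \<bullet> p s)
              + ipv01 d1 (phi n) \<bullet> p s)
          has_integral (ip01 (\<lambda>x. w x t) (phi n) - ip01 (\<lambda>x. w x 0) (phi n))) {0..t}"
    and p_ode: "\<And>t. t \<ge> 0 \<Longrightarrow> (p has_vector_derivative (G *v p t)) (at t within {0..})"
    and eh_L2: "\<And>t. t \<ge> 0 \<Longrightarrow> L2_01 (\<lambda>x. eh x t)"
    and eh_cont: "\<And>t. t > 0 \<Longrightarrow> continuous_on {0..1} (\<lambda>x. eh x t)"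
    and eh_modes: "\<And>n t. t \<ge> 0 \<Longrightarrow>
        ((\<lambda>s. (a - (real n * pi)\<^sup>2) * ip01 (\<lambda>x. eh x s) (phi n)
              + phi n 1 * U (s - \<tau>)
              + ip01 (\<lambda>x. \<Sum>j\<le>N. l j * phi j x) (phi n) * (eh 0 s - (w 0 s - d4 \<bullet> p s)))
          has_integral (ip01 (\<lambda>x. eh x t) (phi n) - ip01 (\<lambda>x. eh x 0) (phi n))) {0..t}"
    and xi_ode: "\<And>t. t \<ge> 0 \<Longrightarrow>
        ((\<lambda>s. - \<iota> * \<xi> s - ((w 0 s - d4 \<bullet> p s) - eh 0 s)) has_integral (\<xi> t - \<xi> 0)) {0..t}"
    and chi_ode: "\<And>t. t \<ge> 0 \<Longrightarrow>
        ((\<lambda>s. \<phi>h s + \<iota> * ((w 0 s - d4 \<bullet> p s) - eh 0 s) + \<theta>h s * \<xi> s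
              + \<mu>0 * (((w 0 s - d4 \<bullet> p s) - eh 0 s) - \<chi>1 s)) has_integral (\<chi>1 t - \<chi>1 0)) {0..t}"
    and phi_ode: "\<And>t. t \<ge> 0 \<Longrightarrow>
        ((\<lambda>s. - \<iota> * \<phi>h s - \<iota>\<^sup>2 * ((w 0 s - d4 \<bullet> p s) - eh 0 s)) has_integral (\<phi>h t - \<phi>h 0)) {0..t}"
    and theta_ode: "\<And>t. t \<ge> 0 \<Longrightarrow>
        ((\<lambda>s. \<mu>1 * \<xi> s * (((w 0 s - d4 \<bullet> p s) - eh 0 s) - \<chi>1 s)) has_integral (\<theta>h t - \<theta>h 0)) {0..t}"
    and U_neg: "\<And>s. s < 0 \<Longrightarrow> U s = 0"
    and U_def: "\<And>t. t \<ge> 0 \<Longrightarrow>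
        U t = (let dh = vector [\<chi>1 t, \<phi>h t + \<xi> t * \<theta>h t + \<iota> * \<chi>1 t] :: real^2 in
                 (\<Sum>n\<le>N. k n * ip01 (\<lambda>x. eh x t) (phi n))
               + (\<Sum>n\<le>N. k n *\<^sub>R ipv01 (\<lambda>x. f x (\<theta>h t)) (phi n)) \<bullet> dh
               - f' 1 (\<theta>h t) \<bullet> (mexp (\<tau> *\<^sub>R Sc (\<theta>h t)) *v dh))"
  shows "((\<lambda>t. \<bar>w 0 t - d4 \<bullet> p t\<bar>) \<longlongrightarrow> 0) at_top \<and>
         (\<exists>\<alpha>>0. \<exists>M T. \<forall>t\<ge>T. \<bar>w 0 t - d4 \<bullet> p t\<bar> \<le> M * exp (- \<alpha> * t))"
proof -
  obtain \<omega> where \<omega>: "\<omega> > 0" "cspectrum G = {\<i> * complex_of_real \<omega>, - \<i> * complex_of_real \<omega>}"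
    using G_spec by blast
  then have G_square: "G *v (G *v u) = - (\<omega>\<^sup>2) *\<^sub>R u" for u
    by (intro cspectrum_imaginary_imp_square) auto
  obtain P1 P2 P3 S R Q where LMI_witnesses: "posdef (N+1) P1" "posdef (N+1) S" "posdef (N+1) R" "posdef (N+1) Q"
    "negdef (3 * (N+1)) (Phi a N k \<delta> \<tau> P1 P2 P3 S R)"
    "negdef (N+1) (\<lambda>i j. mmul (N+1) Q (\<lambda>i j. Amat a i j + l i * Cvec j) i j
        + mmul (N+1) (mtr (\<lambda>i j. Amat a i j + l i * Cvec j)) Q i j + 2 * \<delta> * Q i j)"
    using LMI unfolding Let_def by blast
  interpret closed_loop a \<delta> \<tau> N k l f f' P1 P2 P3 S R Q G \<omega> p \<iota> \<mu>0 \<mu>1 d1 d2 d3 d4 w eh \<xi> \<chi>1 \<phi>h \<theta>h U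
    by unfold_locales
       (rule LMI_witnesses \<omega>(1) zero_less_power[OF \<omega>(1)] tau_pos delta_pos N_tail gains d1_Linf f_ode f_init G_square
          p_ode w_cont w_modes eh_cont eh_modes xi_ode chi_ode phi_ode theta_ode U_def; assumption)+
  obtain \<alpha> M T where "\<alpha> > 0" "\<And>t. t \<ge> T \<Longrightarrow> \<bar>w 0 t - d4 \<bullet> p t\<bar> \<le> M * exp (- \<alpha> * t)"
    by (rule expdecayE[OF output_regulation zero_less_one]) blast
  moreover have "((\<lambda>t. \<bar>w 0 t - d4 \<bullet> p t\<bar>) \<longlongrightarrow> 0) at_top"
    by (rule expdecay_imp_tendsto_0[OF expdecay_abs[OF output_regulation]])
  ultimately show ?thesis by blast
qed

end
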